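(* Let $\tau>0$, let $A$ be a real symmetric $m\times m$ matrix with eigenvalues $0>\lambda_1\ge\lambda_2\ge\dots\ge\lambda_m$, and let $f:\mathbb R\times\mathbb R^m\to\mathbb R^m$, $g:\mathbb R\times\mathbb R^m\to\mathbb R^{m\times d}$ satisfy $f(t+\tau,x)=f(t,x)$, $g(t+\tau,x)=g(t,x)$ for all $t\in\mathbb R$, $x\in\mathbb R^m$. Assume there are constants $C_0,\beta_1,\beta_2>0$ with $\beta_1+\frac{\beta_2^2}{2}<|\lambda_1|$ such that for all $s,t\in\mathbb R$, $x,y\in\mathbb R^m$, $$|f(s,x)-f(t,y)|\le C_0|s-t|^{1/2}+\beta_1|x-y|,\qquad |g(s,x)-g(t,y)|\le C_0|s-t|^{1/2}+\beta_2|x-y|.$$ Let $X_r^*$ be the random periodic solution of $dX_t=[AX_t+f(t,X_t)]dt+g(t,X_t)dW_t$ and, for $\Delta t=\tau/n$, let $\widehat X_r^*$ be the approximating random periodic solution obtained from the Euler-Maruyama scheme with step $\Delta t$. Then there is a constant $\widetilde K>0$, independent of $\Delta t$ and $r$, such that for all sufficiently small $\Delta t=\tau/n$ and any $r\ge 0$, $$\|X_r^*-\widehat X_r^*\|_2\le\widetilde K\sqrt{\Delta t}.$$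
   Context: $|\cdot|$ is the Euclidean norm of vectors and the Frobenius norm of matrices; $\|\xi\|_p=(\mathbb E|\xi|^p)^{1/p}$. $W$ is a two-sided Wiener process in $\mathbb R^d$ on $(\Omega,\mathcal F,\mathbb P)$, $\mathcal F^t=\bigvee_{s\le t}\sigma\{W_u-W_v:s\le v\le u\le t\}$. Initial values $\xi$ at time $-k\tau$ are $\mathcal F^{-k\tau}$-measurable (for each $k\in\mathbb N$) with $\|\xi\|_2\le K^*$ for some constant $K^*>0$. $X_r^{-k\tau}(\xi)$, $r\ge-k\tau$, is the solution of the SDE with value $\xi$ at time $-k\tau$. Euler-Maruyama scheme: $\Delta t=\tau/n$, $n\in\mathbb N$, with $\Delta t\le1/\rho$, $\rho=|\lambda_m|$; $\widehat X_{-k\tau}^{-k\tau}=\xi$ and, for $i\ge0$, $$\widehat X_{-k\tau+(i+1)\Delta t}^{-k\tau}=\widehat X_{-k\tau+i\Delta t}^{-k\tau}+A\widehat X_{-k\tau+i\Delta t}^{-k\tau}\Delta t+f(i\Delta t,\widehat X_{-k\tau+i\Delta t}^{-k\tau})\Delta t+g(i\Delta t,\widehat X_{-k\tau+i\Delta t}^{-k\tau})\big(W_{-k\tau+(i+1)\Delta t}-W_{-k\tau+i\Delta t}\big).$$ For $r\ge0$ with $N'\Delta t\le r<(N'+1)\Delta t$: $\widehat X_r^{-k\tau}$ is this iterate if $r=N'\Delta t$, and otherwise $\widehat X_r^{-k\tau}=\widehat X_{N'\Delta t}^{-k\tau}+f(N'\Delta t,\widehat X_{N'\Delta t}^{-k\tau})(r-N'\Delta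 t)+g(N'\Delta t,\widehat X_{N'\Delta t}^{-k\tau})(W_r-W_{N'\Delta t})$. For $r\ge0$, $X_r^*$ and $\widehat X_r^*$ are the $L^2(\Omega)$-limits of $X_r^{-k\tau}(\xi)$ and $\widehat X_r^{-k\tau}(\xi)$ as $k\to\infty$; under the hypotheses (with $\Delta t$ small enough) these limits exist, do not depend on $\xi$, and are random periodic of period $\tau$. *)

theory Defs
  imports "HOL-Probability.Probability"
begin

text \<open>
  The norm on \<open>real ^ 'm\<close> is Euclidean; the norm on \<open>real ^ 'd ^ 'm\<close> (matrices with rows indexed
  by \<open>'m\<close> and columns by \<open>'d\<close>) is the Frobenius norm.
\<close>

subsection \<open>Square-integrable random vectors\<close>

definition sq_integrable :: "'w measure \<Rightarrow> ('w \<Rightarrow> 'b::euclidean_space) \<Rightarrow> bool" where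
  "sq_integrable M Y \<longleftrightarrow> Y \<in> borel_measurable M \<and> integrable M (\<lambda>\<omega>. (norm (Y \<omega>))\<^sup>2)"

definition L2_norm :: "'w measure \<Rightarrow> ('w \<Rightarrow> 'b::euclidean_space) \<Rightarrow> real" where
  "L2_norm M Y = sqrt (\<integral>\<omega>. (norm (Y \<omega>))\<^sup>2 \<partial>M)"

text \<open>
  The Bochner integral of a non-integrable function is 0, so membership in \<open>L\<^sup>2\<close> is required
  explicitly, of the sequence and of its limit.
\<close>

definition L2_limit :: "'w measure \<Rightarrow> (nat \<Rightarrow> 'w \<Rightarrow> 'b::euclidean_space) \<Rightarrow> ('w \<Rightarrow> 'b) \<Rightarrow> bool" where
  "L2_limit M Y Z \<longleftrightarrow> (\<forall>k. sq_integrable M (Y k)) \<and> sq_integrable M Z \<and>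
     (\<lambda>k. L2_norm M (\<lambda>\<omega>. Y k \<omega> - Z \<omega>)) \<longlonglongrightarrow> 0"


subsection \<open>Two-sided Wiener process and its filtration\<close>

definition two_sided_wiener :: "'w measure \<Rightarrow> (real \<Rightarrow> 'w \<Rightarrow> real ^ 'd) \<Rightarrow> bool" where
  "two_sided_wiener M W \<longleftrightarrow>
     prob_space M \<and>
     (\<forall>t. W t \<in> borel_measurable M) \<and>
     (AE \<omega> in M. W 0 \<omega> = 0) \<and>
     (AE \<omega> in M. continuous_on UNIV (\<lambda>t. W t \<omega>)) \<and>
     (\<forall>n t. strict_mono_on {..n} t \<longrightarrow>
        prob_space.indep_vars M (\<lambda>_. borel) (\<lambda>i \<omega>. W (t (Suc i)) \<omega> - W (t i) \<omega>) {..<n::nat}) \<and>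
     (\<forall>s t. s < t \<longrightarrow>
        prob_space.indep_vars M (\<lambda>_. borel) (\<lambda>j \<omega>. (W t \<omega> - W s \<omega>) $ j) (UNIV :: 'd set) \<and>
        (\<forall>j. distributed M lborel (\<lambda>\<omega>. (W t \<omega> - W s \<omega>) $ j) (normal_density 0 (sqrt (t - s)))))"

text \<open>
  The join over \<open>s \<le> t\<close> of the \<open>\<sigma>\<close>-algebras generated by \<open>W u - W v\<close>, \<open>s \<le> v \<le> u \<le> t\<close>, is
  generated by all these increments together, so \<open>s\<close> disappears.
\<close>

definition incr_filtration :: "'w measure \<Rightarrow> (real \<Rightarrow> 'w \<Rightarrow> real ^ 'd) \<Rightarrow> real \<Rightarrow> 'w measure" where
  "incr_filtration M W t = sigma (space M)
     {(\<lambda>\<omega>. W u \<omega> - W v \<omega>) -` B \<inter> space M | u v B. v \<le> u \<and> u \<le> t \<and> B \<in> sets borel}"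

text \<open>
  Stochastic integrals, hence solutions, are determined only up to null sets; adaptedness is
  therefore understood with respect to the filtration augmented by the null sets.
\<close>

definition aug_filtration :: "'w measure \<Rightarrow> (real \<Rightarrow> 'w \<Rightarrow> real ^ 'd) \<Rightarrow> real \<Rightarrow> 'w measure" where
  "aug_filtration M W t = sigma (space M) (sets (incr_filtration M W t) \<union> null_sets M)"


subsection \<open>Ito integral\<close>

text \<open>
  An adapted step process on \<open>[a, b)\<close> has the value \<open>\<phi> i\<close> on \<open>[p i, p (i + 1))\<close>, \<open>i < n\<close>, where
  \<open>a = p 0 \<le> \<dots> \<le> p n = b\<close> and \<open>\<phi> i\<close> is square-integrable and measurable at time \<open>p i\<close>.
\<close>

definition adapted_step ::
  "'w measure \<Rightarrow> (real \<Rightarrow> 'w \<Rightarrow> real ^ 'd) \<Rightarrow> real \<Rightarrow> real \<Rightarrow>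
   nat \<Rightarrow> (nat \<Rightarrow> real) \<Rightarrow> (nat \<Rightarrow> 'w \<Rightarrow> real ^ 'd ^ 'm) \<Rightarrow> bool" where
  "adapted_step M W a b n p \<phi> \<longleftrightarrow>
     p 0 = a \<and> p n = b \<and> mono_on {..n} p \<and>
     (\<forall>i<n. \<phi> i \<in> borel_measurable (aug_filtration M W (p i)) \<and> sq_integrable M (\<phi> i))"

definition step_process ::
  "nat \<Rightarrow> (nat \<Rightarrow> real) \<Rightarrow> (nat \<Rightarrow> 'w \<Rightarrow> real ^ 'd ^ 'm) \<Rightarrow> real \<Rightarrow> 'w \<Rightarrow> real ^ 'd ^ 'm" where
  "step_process n p \<phi> s \<omega> = (\<Sum>i<n. indicator {p i..<p (Suc i)} s *\<^sub>R \<phi> i \<omega>)"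

definition step_integral ::
  "(real \<Rightarrow> 'w \<Rightarrow> real ^ 'd) \<Rightarrow> nat \<Rightarrow> (nat \<Rightarrow> real) \<Rightarrow> (nat \<Rightarrow> 'w \<Rightarrow> real ^ 'd ^ 'm) \<Rightarrow> 'w \<Rightarrow> real ^ 'm" where
  "step_integral W n p \<phi> \<omega> = (\<Sum>i<n. \<phi> i \<omega> *v (W (p (Suc i)) \<omega> - W (p i) \<omega>))"

text \<open>
  \<open>I\<close> is (a version of) the Ito integral of \<open>H\<close> over \<open>[a, b]\<close>: \<open>H\<close> is approximated in
  \<open>L\<^sup>2(dt \<otimes> P)\<close> by adapted step processes, and \<open>I\<close> is the \<open>L\<^sup>2(P)\<close>-limit of their integrals.  The
  closure of the step processes consists of the adapted \<open>H\<close> with finite second moment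
  \<open>E \<integral> |H|\<^sup>2 dt\<close>.
\<close>

definition has_ito_integral ::
  "'w measure \<Rightarrow> (real \<Rightarrow> 'w \<Rightarrow> real ^ 'd) \<Rightarrow> real \<Rightarrow> real \<Rightarrow>
   (real \<Rightarrow> 'w \<Rightarrow> real ^ 'd ^ 'm) \<Rightarrow> ('w \<Rightarrow> real ^ 'm) \<Rightarrow> bool" where
  "has_ito_integral M W a b H I \<longleftrightarrow>
     (\<lambda>(s, \<omega>). H s \<omega>) \<in> borel_measurable (restrict_space borel {a..b} \<Otimes>\<^sub>M M) \<and>
     (\<exists>n p \<phi>. (\<forall>j. adapted_step M W a b (n j) (p j) (\<phi> j)) \<and>
        (\<lambda>j. \<integral>\<^sup>+\<omega>. (\<integral>\<^sup>+s\<in>{a..b}.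
           ennreal ((norm (step_process (n j) (p j) (\<phi> j) s \<omega> - H s \<omega>))\<^sup>2) \<partial>lborel) \<partial>M)
          \<longlonglongrightarrow> 0 \<and>
        L2_limit M (\<lambda>j. step_integral W (n j) (p j) (\<phi> j)) I)"


subsection \<open>The stochastic differential equation\<close>

text \<open>
  \<open>X\<close> is a strong solution on \<open>[a, \<infinity>)\<close> of \<open>dX = (A X + f(t, X)) dt + g(t, X) dW\<close> with value \<open>\<xi>\<close> at
  time \<open>a\<close>, in the usual \<open>L\<^sup>2\<close> class in which it is unique.  Joint measurability only has to
  be required because paths are merely almost surely continuous.
\<close>

definition sde_solution ::
  "'w measure \<Rightarrow> (real \<Rightarrow> 'w \<Rightarrow> real ^ 'd) \<Rightarrow> real ^ 'm ^ 'm \<Rightarrow> (real \<Rightarrow> real ^ 'm \<Rightarrow> real ^ 'm) \<Rightarrow>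
   (real \<Rightarrow> real ^ 'm \<Rightarrow> real ^ 'd ^ 'm) \<Rightarrow> real \<Rightarrow> ('w \<Rightarrow> real ^ 'm) \<Rightarrow>
   (real \<Rightarrow> 'w \<Rightarrow> real ^ 'm) \<Rightarrow> bool" where
  "sde_solution M W A f g a \<xi> X \<longleftrightarrow>
     (\<lambda>(s, \<omega>). X s \<omega>) \<in> borel_measurable (restrict_space borel {a..} \<Otimes>\<^sub>M M) \<and>
     (\<forall>t\<ge>a. X t \<in> borel_measurable (aug_filtration M W t)) \<and>
     (AE \<omega> in M. continuous_on {a..} (\<lambda>t. X t \<omega>)) \<and>
     (\<forall>T\<ge>a. (\<integral>\<^sup>+\<omega>. (\<integral>\<^sup>+s\<in>{a..T}. ennreal ((norm (X s \<omega>))\<^sup>2) \<partial>lborel) \<partial>M) < \<infinity>) \<and>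
     (AE \<omega> in M. X a \<omega> = \<xi> \<omega>) \<and>
     (\<forall>t\<ge>a. \<exists>I. has_ito_integral M W a t (\<lambda>s \<omega>. g s (X s \<omega>)) I \<and>
        (AE \<omega> in M. X t \<omega> = \<xi> \<omega> + (LINT s:{a..t}|lborel. A *v X s \<omega> + f s (X s \<omega>)) + I \<omega>))"


subsection \<open>The Euler-Maruyama scheme\<close>

text \<open>
  \<open>em_iterate W A f g h a \<xi> i\<close> is the iterate at time \<open>a + i h\<close> for step size \<open>h\<close> and starting
  time \<open>a\<close>.  The coefficients are evaluated at \<open>i h\<close> rather than \<open>a + i h\<close>; this is harmless when
  \<open>a\<close> is a multiple of their period.
\<close>

primrec em_iterate ::
  "(real \<Rightarrow> 'w \<Rightarrow> real ^ 'd) \<Rightarrow> real ^ 'm ^ 'm \<Rightarrow> (real \<Rightarrow> real ^ 'm \<Rightarrow> real ^ 'm) \<Rightarrow>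
   (real \<Rightarrow> real ^ 'm \<Rightarrow> real ^ 'd ^ 'm) \<Rightarrow> real \<Rightarrow> real \<Rightarrow> ('w \<Rightarrow> real ^ 'm) \<Rightarrow>
   nat \<Rightarrow> 'w \<Rightarrow> real ^ 'm" where
  "em_iterate W A f g h a \<xi> 0 = \<xi>"
| "em_iterate W A f g h a \<xi> (Suc i) = (\<lambda>\<omega>.
     let x = em_iterate W A f g h a \<xi> i \<omega> in
       x + h *\<^sub>R (A *v x) + h *\<^sub>R f (real i * h) x
         + g (real i * h) x *v (W (a + real (Suc i) * h) \<omega> - W (a + real i * h) \<omega>))"

text \<open>
  \<open>em_interp W \<tau> A f g n k \<xi> r\<close>, \<open>r \<ge> 0\<close>, is the scheme with step \<open>h = \<tau> / n\<close> started at time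
  \<open>- k \<tau>\<close>; the grid point \<open>N h\<close> is reached after \<open>k n + N\<close> steps.  Between grid points the linear
  term \<open>A\<close> does not enter the interpolation; at grid points the correction vanishes.
\<close>

definition em_interp ::
  "(real \<Rightarrow> 'w \<Rightarrow> real ^ 'd) \<Rightarrow> real \<Rightarrow> real ^ 'm ^ 'm \<Rightarrow> (real \<Rightarrow> real ^ 'm \<Rightarrow> real ^ 'm) \<Rightarrow>
   (real \<Rightarrow> real ^ 'm \<Rightarrow> real ^ 'd ^ 'm) \<Rightarrow> nat \<Rightarrow> nat \<Rightarrow> ('w \<Rightarrow> real ^ 'm) \<Rightarrow>
   real \<Rightarrow> 'w \<Rightarrow> real ^ 'm" where
  "em_interp W \<tau> A f g n k \<xi> r \<omega> =
     (let h = \<tau> / real n;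
          N = nat \<lfloor>r / h\<rfloor>;
          t = real N * h;
          x = em_iterate W A f g h (- (real k * \<tau>)) \<xi> (k * n + N) \<omega>
      in x + (r - t) *\<^sub>R f t x + g t x *v (W r \<omega> - W t \<omega>))"


subsection \<open>Eigenvalues\<close>

text \<open>
  \<open>lam 1 \<ge> \<dots> \<ge> lam m\<close> are the eigenvalues of \<open>A\<close>, i.e. the roots of its characteristic
  polynomial, listed with multiplicity.
\<close>

definition eigenvalue_list :: "real ^ 'm ^ 'm \<Rightarrow> (nat \<Rightarrow> real) \<Rightarrow> bool" where
  "eigenvalue_list A lam \<longleftrightarrow>
     (\<forall>x. det (mat x - A) = (\<Prod>i = 1..CARD('m). x - lam i)) \<and> antimono_on {1..CARD('m)} lam"

end

theory Submission
  imports Defs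
begin

text \<open>
  Since both coefficients are Lipschitz with \<open>\<beta>\<^sub>1 + \<beta>\<^sub>2\<^sup>2 / 2 < \<bar>\<lambda>\<^sub>1\<bar>\<close>, one Euler step contracts the mean square
  distance of two states by a factor \<open>1 - c h\<close>.  The exact solution satisfies the scheme up to a remainder
  \<open>R + S\<close> with \<open>E |R|\<^sup>2 = O(h\<^sup>3)\<close> and \<open>E |S|\<^sup>2 = O(h\<^sup>2)\<close>, where \<open>S\<close> is orthogonal to the past; hence the mean square
  error \<open>e\<close> satisfies \<open>e' \<le> (1 - c h) e + C h\<^sup>2\<close>, and \<open>e = O(h)\<close> uniformly in time and in the starting time.
  The same recursion, applied to the solution itself, gives the uniform second moments on which the
  constants depend.  Ito's formula is not needed: orthogonality of the increments of the integral to the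
  past and the isometry (up to a constant) suffice.
\<close>

subsection \<open>Square-integrable random vectors\<close>

text \<open>Every \<open>has_ito_integral\<close> comes with step processes of its own, so the
  integrals up to \<open>s\<close> and up to \<open>t\<close> are unrelated by definition, and the
  equation says nothing directly about \<open>X t - X s\<close>. Splitting step processes at
  \<open>s\<close> recovers the increment; of it only what survives an L2 limit is kept. The class
  of solutions controls second moments only after integration over time, hence a crude bound at
  fixed times has to precede the estimates with good constants.

  Why the orders of \<open>R\<close> and \<open>S\<close> suffice: \<open>R\<close> is correlated
  with the state, so Young's inequality charges its mean square with a factor 1/h; \<open>S\<close>
  is correlated only with the noise of the same step, whose mean square is already O(h), and is
  charged with a constant. Both charges are O(h^2), against a contraction of order h. Solution and
  scheme share the initial value, so the error recursion starts from 0 and its constant sees the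
  initial value only through its second moment. The bound is thus the same for all starting times
  and passes to the limit in k at fixed r.\<close>

lemma norm_add_sq_le:
  fixes x y :: "'b::real_inner"
  assumes "\<epsilon> > 0"
  shows "(norm (x + y))\<^sup>2 \<le> (1 + \<epsilon>) * (norm x)\<^sup>2 + (1 + 1 / \<epsilon>) * (norm y)\<^sup>2"
proof -
  have "0 \<le> (norm (\<epsilon> *\<^sub>R x - y))\<^sup>2" by simp
  also have "\<dots> = \<epsilon>\<^sup>2 * (norm x)\<^sup>2 - 2 * \<epsilon> * (x \<bullet> y) + (norm y)\<^sup>2"
    unfolding power2_norm_eq_inner by (simp add: algebra_simps inner_commute power2_eq_square)
  finally have "2 * \<epsilon> * (x \<bullet> y) \<le> \<epsilon> * (\<epsilon> * (norm x)\<^sup>2 + (norm y)\<^sup>2 / \<epsilon>)"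
    using assms by (simp add: algebra_simps power2_eq_square)
  hence "2 * (x \<bullet> y) \<le> \<epsilon> * (norm x)\<^sup>2 + (norm y)\<^sup>2 / \<epsilon>"
    using assms by (simp add: mult.assoc mult.left_commute[of 2])
  moreover have "(norm (x + y))\<^sup>2 = (norm x)\<^sup>2 + 2 * (x \<bullet> y) + (norm y)\<^sup>2"
    unfolding power2_norm_eq_inner by (simp add: algebra_simps inner_commute)
  ultimately show ?thesis by (simp add: algebra_simps)
qed

lemma two_inner_le:
  fixes x y :: "'b::real_inner"
  assumes "\<epsilon> > 0"
  shows "2 * (x \<bullet> y) \<le> \<epsilon> * (norm x)\<^sup>2 + (norm y)\<^sup>2 / \<epsilon>"
proof -
  have "(norm (x + y))\<^sup>2 = (norm x)\<^sup>2 + 2 * (x \<bullet> y) + (norm y)\<^sup>2"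
    unfolding power2_norm_eq_inner by (simp add: algebra_simps inner_commute)
  with norm_add_sq_le[OF assms, of x y] show ?thesis by (simp add: algebra_simps)
qed

lemma norm_add_sq_le2:
  fixes x y :: "'b::real_inner"
  shows "(norm (x + y))\<^sup>2 \<le> 2 * (norm x)\<^sup>2 + 2 * (norm y)\<^sup>2"
  using norm_add_sq_le[of 1 x y] by simp

lemma sum_sq_le2: "(x + y)\<^sup>2 \<le> 2 * x\<^sup>2 + 2 * (y::real)\<^sup>2"
  using norm_add_sq_le2[of x y] by simp

lemma sq_integrableI:
  assumes "Y \<in> borel_measurable M" "(\<integral>\<^sup>+\<omega>. ennreal ((norm (Y \<omega>))\<^sup>2) \<partial>M) < \<infinity>"
  shows "sq_integrable M Y"
  unfolding sq_integrable_def using assms by (auto intro!: integrableI_nonneg)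

lemma sq_integrable_bound:
  assumes "Y \<in> borel_measurable M" "integrable M h" "AE \<omega> in M. (norm (Y \<omega>))\<^sup>2 \<le> h \<omega>"
  shows "sq_integrable M Y"
  unfolding sq_integrable_def using assms
  by (auto intro!: Bochner_Integration.integrable_bound[OF assms(2)] elim: AE_mp)

lemma sq_integrable_measurable: "sq_integrable M Y \<Longrightarrow> Y \<in> borel_measurable M"
  and sq_integrable_norm2: "sq_integrable M Y \<Longrightarrow> integrable M (\<lambda>\<omega>. (norm (Y \<omega>))\<^sup>2)"
  by (auto simp: sq_integrable_def)

lemma sq_integrable_nn:
  "sq_integrable M Y \<Longrightarrow>
    (\<integral>\<^sup>+\<omega>. ennreal ((norm (Y \<omega>))\<^sup>2) \<partial>M) = ennreal (\<integral>\<omega>. (norm (Y \<omega>))\<^sup>2 \<partial>M)"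
  by (intro nn_integral_eq_integral) (auto simp: sq_integrable_def)

lemma sq_integrable_nn_bound:
  assumes "Y \<in> borel_measurable M" "(\<integral>\<^sup>+\<omega>. ennreal ((norm (Y \<omega>))\<^sup>2) \<partial>M) \<le> ennreal c" "c \<ge> 0"
  shows "sq_integrable M Y" "(\<integral>\<omega>. (norm (Y \<omega>))\<^sup>2 \<partial>M) \<le> c"
proof -
  show *: "sq_integrable M Y"
    using assms by (intro sq_integrableI) (auto simp: order_le_less_trans)
  show "(\<integral>\<omega>. (norm (Y \<omega>))\<^sup>2 \<partial>M) \<le> c"
    using assms by (simp add: sq_integrable_nn[OF *])
qed

lemma sq_integrable_zero [simp]: "sq_integrable M (\<lambda>\<omega>. 0)"
  by (simp add: sq_integrable_def)

lemma sq_integrable_add: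
  assumes "sq_integrable M Y" "sq_integrable M Z"
  shows "sq_integrable M (\<lambda>\<omega>. Y \<omega> + Z \<omega>)"
  using assms
  by (intro sq_integrable_bound[where h="\<lambda>\<omega>. 2 * (norm (Y \<omega>))\<^sup>2 + 2 * (norm (Z \<omega>))\<^sup>2"])
     (auto simp: sq_integrable_def norm_add_sq_le2)

lemma sq_integrable_scaleR:
  assumes "sq_integrable M Y"
  shows "sq_integrable M (\<lambda>\<omega>. c *\<^sub>R Y \<omega>)"
  using assms by (auto simp: sq_integrable_def power_mult_distrib)

lemma sq_integrable_minus:
  "sq_integrable M Y \<Longrightarrow> sq_integrable M (\<lambda>\<omega>. - Y \<omega>)"
  by (auto simp: sq_integrable_def)

lemma sq_integrable_diff:
  "sq_integrable M Y \<Longrightarrow> sq_integrable M Z \<Longrightarrow> sq_integrable M (\<lambda>\<omega>. Y \<omega> - Z \<omega>)"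
  using sq_integrable_add[OF _ sq_integrable_minus] by fastforce

lemma sq_integrable_cong_AE:
  assumes "sq_integrable M Y" "Z \<in> borel_measurable M" "AE \<omega> in M. Y \<omega> = Z \<omega>"
  shows "sq_integrable M Z"
  using assms by (intro sq_integrable_bound[OF _ sq_integrable_norm2[OF assms(1)]]) auto

lemma (in finite_measure) sq_integrable_growth:
  assumes "sq_integrable M Y" "Z \<in> borel_measurable M"
    and "\<And>\<omega>. \<omega> \<in> space M \<Longrightarrow> norm (Z \<omega>) \<le> C + L * norm (Y \<omega>)"
  shows "sq_integrable M Z"
proof (rule sq_integrable_bound[where h="\<lambda>\<omega>. 2 * C\<^sup>2 + 2 * L\<^sup>2 * (norm (Y \<omega>))\<^sup>2"])
  show "AE \<omega> in M. (norm (Z \<omega>))\<^sup>2 \<le> 2 * C\<^sup>2 + 2 * L\<^sup>2 * (norm (Y \<omega>))\<^sup>2"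
  proof (rule AE_I2)
    fix \<omega> assume "\<omega> \<in> space M"
    from power_mono[OF assms(3)[OF this], of 2]
    show "(norm (Z \<omega>))\<^sup>2 \<le> 2 * C\<^sup>2 + 2 * L\<^sup>2 * (norm (Y \<omega>))\<^sup>2"
      using sum_sq_le2[of C "L * norm (Y \<omega>)"] by (simp add: power_mult_distrib)
  qed
qed (use assms in \<open>auto simp: sq_integrable_def\<close>)

lemma sq_integrable_inner:
  assumes "sq_integrable M Y" "sq_integrable M Z"
  shows "integrable M (\<lambda>\<omega>. Y \<omega> \<bullet> Z \<omega>)"
proof (rule Bochner_Integration.integrable_bound)
  show "integrable M (\<lambda>\<omega>. (norm (Y \<omega>))\<^sup>2 + (norm (Z \<omega>))\<^sup>2)"
    using assms by (auto simp: sq_integrable_def)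
  show "(\<lambda>\<omega>. Y \<omega> \<bullet> Z \<omega>) \<in> borel_measurable M"
    using assms by (auto simp: sq_integrable_def)
  show "AE \<omega> in M. norm (Y \<omega> \<bullet> Z \<omega>) \<le> norm ((norm (Y \<omega>))\<^sup>2 + (norm (Z \<omega>))\<^sup>2)"
  proof (rule AE_I2)
    fix \<omega>
    have "2 * (Y \<omega> \<bullet> Z \<omega>) \<le> (norm (Y \<omega>))\<^sup>2 + (norm (Z \<omega>))\<^sup>2"
      "2 * (- Y \<omega> \<bullet> Z \<omega>) \<le> (norm (Y \<omega>))\<^sup>2 + (norm (Z \<omega>))\<^sup>2"
      using two_inner_le[of 1 "Y \<omega>" "Z \<omega>"] two_inner_le[of 1 "- Y \<omega>" "Z \<omega>"] by simp_all
    then show "norm (Y \<omega> \<bullet> Z \<omega>) \<le> norm ((norm (Y \<omega>))\<^sup>2 + (norm (Z \<omega>))\<^sup>2)"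
      by (simp add: abs_if)
  qed
qed

lemma sq_integrable_mult:
  fixes Y Z :: "'w \<Rightarrow> real"
  assumes "sq_integrable M Y" "sq_integrable M Z"
  shows "integrable M (\<lambda>\<omega>. Y \<omega> * Z \<omega>)"
  using sq_integrable_inner[OF assms] by simp

lemma L2_norm_sq: "(L2_norm M Y)\<^sup>2 = (\<integral>\<omega>. (norm (Y \<omega>))\<^sup>2 \<partial>M)"
  by (simp add: L2_norm_def)

lemma L2_norm_nonneg [simp]: "L2_norm M Y \<ge> 0"
  by (simp add: L2_norm_def)

lemma L2_norm_minus_commute: "L2_norm M (\<lambda>\<omega>. Y \<omega> - Z \<omega>) = L2_norm M (\<lambda>\<omega>. Z \<omega> - Y \<omega>)"
  by (simp add: L2_norm_def norm_minus_commute)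

lemma L2_Cauchy_Schwarz:
  assumes "sq_integrable M Y" "sq_integrable M Z"
  shows "\<bar>\<integral>\<omega>. Y \<omega> \<bullet> Z \<omega> \<partial>M\<bar> \<le> L2_norm M Y * L2_norm M Z"
proof -
  note [measurable] = assms[THEN sq_integrable_measurable]
  have "ennreal \<bar>\<integral>\<omega>. Y \<omega> \<bullet> Z \<omega> \<partial>M\<bar> \<le> (\<integral>\<^sup>+\<omega>. ennreal (norm (Y \<omega> \<bullet> Z \<omega>)) \<partial>M)"
    using integral_norm_bound_ennreal[OF sq_integrable_inner[OF assms]] by simp
  also have "\<dots> \<le> (\<integral>\<^sup>+\<omega>. ennreal (norm (Y \<omega>)) * ennreal (norm (Z \<omega>)) \<partial>M)"
    by (intro nn_integral_mono) (simp add: ennreal_mult[symmetric] Cauchy_Schwarz_ineq2)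
  finally have "(ennreal \<bar>\<integral>\<omega>. Y \<omega> \<bullet> Z \<omega> \<partial>M\<bar>)\<^sup>2
      \<le> (\<integral>\<^sup>+\<omega>. ennreal (norm (Y \<omega>)) * ennreal (norm (Z \<omega>)) \<partial>M)\<^sup>2"
    by (rule power_mono) simp
  also have "\<dots> \<le> (\<integral>\<^sup>+\<omega>. (ennreal (norm (Y \<omega>)))\<^sup>2 \<partial>M) * (\<integral>\<^sup>+\<omega>. (ennreal (norm (Z \<omega>)))\<^sup>2 \<partial>M)"
    by (rule Cauchy_Schwarz_nn_integral) measurable
  also have "\<dots> = ennreal ((L2_norm M Y)\<^sup>2 * (L2_norm M Z)\<^sup>2)"
    by (simp add: ennreal_power sq_integrable_nn assms L2_norm_sq ennreal_mult)
  finally have "\<bar>\<integral>\<omega>. Y \<omega> \<bullet> Z \<omega> \<partial>M\<bar>\<^sup>2 \<le> (L2_norm M Y * L2_norm M Z)\<^sup>2"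
    by (simp add: ennreal_power power_mult_distrib)
  then show ?thesis
    by (rule power2_le_imp_le) simp
qed

lemma integral_norm_add_sq:
  assumes "sq_integrable M Y" "sq_integrable M Z"
  shows "(\<integral>\<omega>. (norm (Y \<omega> + Z \<omega>))\<^sup>2 \<partial>M) =
    (\<integral>\<omega>. (norm (Y \<omega>))\<^sup>2 \<partial>M) + 2 * (\<integral>\<omega>. Y \<omega> \<bullet> Z \<omega> \<partial>M) + (\<integral>\<omega>. (norm (Z \<omega>))\<^sup>2 \<partial>M)"
proof -
  have "(norm (Y \<omega> + Z \<omega>))\<^sup>2 = (norm (Y \<omega>))\<^sup>2 + 2 * (Y \<omega> \<bullet> Z \<omega>) + (norm (Z \<omega>))\<^sup>2" for \<omega>
    unfolding power2_norm_eq_inner by (simp add: algebra_simps inner_commute)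
  then show ?thesis
    using assms sq_integrable_inner[OF assms] by (simp add: sq_integrable_def)
qed

lemma L2_norm_triangle:
  assumes "sq_integrable M Y" "sq_integrable M Z"
  shows "L2_norm M (\<lambda>\<omega>. Y \<omega> + Z \<omega>) \<le> L2_norm M Y + L2_norm M Z"
proof (rule power2_le_imp_le)
  show "(L2_norm M (\<lambda>\<omega>. Y \<omega> + Z \<omega>))\<^sup>2 \<le> (L2_norm M Y + L2_norm M Z)\<^sup>2"
    using L2_Cauchy_Schwarz[OF assms]
    by (simp add: L2_norm_sq integral_norm_add_sq[OF assms] power2_sum)
qed simp

lemma integral_norm_add_sq_le2:
  assumes "sq_integrable M Y" "sq_integrable M Z"
  shows "(\<integral>\<omega>. (norm (Y \<omega> + Z \<omega>))\<^sup>2 \<partial>M) \<le>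
    2 * (\<integral>\<omega>. (norm (Y \<omega>))\<^sup>2 \<partial>M) + 2 * (\<integral>\<omega>. (norm (Z \<omega>))\<^sup>2 \<partial>M)"
proof -
  have "(\<integral>\<omega>. (norm (Y \<omega> + Z \<omega>))\<^sup>2 \<partial>M) \<le> (\<integral>\<omega>. 2 * (norm (Y \<omega>))\<^sup>2 + 2 * (norm (Z \<omega>))\<^sup>2 \<partial>M)"
    using assms sq_integrable_add[OF assms]
    by (intro integral_mono) (auto simp: sq_integrable_def norm_add_sq_le2)
  also have "\<dots> = 2 * (\<integral>\<omega>. (norm (Y \<omega>))\<^sup>2 \<partial>M) + 2 * (\<integral>\<omega>. (norm (Z \<omega>))\<^sup>2 \<partial>M)"
    using assms by (simp add: sq_integrable_def)
  finally show ?thesis .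
qed

subsection \<open>Independence of Brownian increments from the past\<close>

locale wiener =
  fixes M :: "'w measure" and W :: "real \<Rightarrow> 'w \<Rightarrow> real ^ 'd"
  assumes wiener: "two_sided_wiener M W"

sublocale wiener \<subseteq> prob_space M
  using wiener by (simp add: two_sided_wiener_def)

context wiener
begin

abbreviation "F \<equiv> aug_filtration M W"

lemma W_measurable [measurable]: "W t \<in> borel_measurable M"
  using wiener by (simp add: two_sided_wiener_def)

lemma incr_generator_subset:
  "{(\<lambda>\<omega>. W u \<omega> - W v \<omega>) -` B \<inter> space M | u v B. v \<le> u \<and> u \<le> t \<and> B \<in> sets borel} \<subseteq> sets M"
  by (auto intro!: measurable_sets)

lemma sets_incr_filtration:
  "sets (incr_filtration M W t) = sigma_sets (space M)
    {(\<lambda>\<omega>. W u \<omega> - W v \<omega>) -` B \<inter> space M | u v B. v \<le> u \<and> u \<le> t \<and> B \<in> sets borel}"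
  unfolding incr_filtration_def by (rule sets_measure_of) auto

lemma sets_incr_filtration_subset: "sets (incr_filtration M W t) \<subseteq> sets M"
  unfolding sets_incr_filtration by (rule sets.sigma_sets_subset) (rule incr_generator_subset)

lemma space_incr_filtration [simp]: "space (incr_filtration M W t) = space M"
  by (auto simp: incr_filtration_def space_measure_of_conv)

lemma space_F [simp]: "space (F t) = space M"
  by (auto simp: aug_filtration_def space_measure_of_conv)

lemma sets_F: "sets (F t) = sigma_sets (space M) (sets (incr_filtration M W t) \<union> null_sets M)"
  unfolding aug_filtration_def
  using sets_incr_filtration_subset[of t] sets.sets_into_space
  by (intro sets_measure_of) (auto dest!: null_setsD2)

lemma subalgebra_F: "subalgebra M (F t)"
  unfolding subalgebra_def sets_F using sets_incr_filtration_subset[of t]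
  by (auto intro!: sets.sigma_sets_subset dest: null_setsD2)

lemma subalgebra_incr_F: "subalgebra (F t) (incr_filtration M W t)"
  unfolding subalgebra_def sets_F by auto

lemma subalgebra_F_mono: "s \<le> t \<Longrightarrow> subalgebra (F t) (F s)"
proof -
  assume "s \<le> t"
  then have "sets (incr_filtration M W s) \<subseteq> sets (incr_filtration M W t)"
    unfolding sets_incr_filtration by (intro sigma_sets_mono') force
  then show ?thesis
    unfolding subalgebra_def sets_F by (auto intro!: sigma_sets_mono')
qed

lemmas measurable_FD = measurable_from_subalg[OF subalgebra_F]
lemmas measurable_F_mono = measurable_from_subalg[OF subalgebra_F_mono]

lemma incr_measurable:
  assumes "v \<le> u" "u \<le> t"
  shows "(\<lambda>\<omega>. W u \<omega> - W v \<omega>) \<in> borel_measurable (F t)"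
proof -
  have "(\<lambda>\<omega>. W u \<omega> - W v \<omega>) \<in> borel_measurable (incr_filtration M W t)"
  proof (rule measurableI)
    fix B :: "(real ^ 'd) set" assume "B \<in> sets borel"
    with assms show "(\<lambda>\<omega>. W u \<omega> - W v \<omega>) -` B \<inter> space (incr_filtration M W t)
        \<in> sets (incr_filtration M W t)"
      unfolding sets_incr_filtration by (auto intro!: sigma_sets.Basic)
  qed simp
  then show ?thesis
    by (rule measurable_from_subalg[OF subalgebra_incr_F])
qed

text \<open>Independence is granted only for consecutive increments along an increasing finite
  sequence of times. So \<open>T\<close> is enumerated in increasing order with \<open>t\<close>
  appended: for \<open>u\<close> in \<open>T\<close>, \<open>W u - W s\<close> is minus the sum of
  the increments between \<open>u\<close> and \<open>s\<close>, the maximum of \<open>T\<close>,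
  hence a function of the first \<open>n\<close> increments, while \<open>W t - W s\<close> is the
  last one.\<close>

lemma finite_past_indep:
  assumes T: "finite T" "T \<subseteq> {..s}" "s \<in> T" and st: "s < t"
    and C: "C \<in> sets (PiM T (\<lambda>_. borel))" and B: "B \<in> sets borel"
  shows "prob (((\<lambda>\<omega>. \<lambda>u\<in>T. W u \<omega> - W s \<omega>) -` C \<inter> space M) \<inter> ((\<lambda>\<omega>. W t \<omega> - W s \<omega>) -` B \<inter> space M))
    = prob ((\<lambda>\<omega>. \<lambda>u\<in>T. W u \<omega> - W s \<omega>) -` C \<inter> space M) * prob ((\<lambda>\<omega>. W t \<omega> - W s \<omega>) -` B \<inter> space M)"
proof -
  define n where "n = card T - 1"
  have card: "card T = Suc n"
    using T card_gt_0_iff[of T] by (auto simp: n_def)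
  define l where "l = sorted_list_of_set T"
  have l: "length l = Suc n" "set l = T" "sorted_wrt (<) l"
    using T card by (auto simp: l_def)
  define p where "p i = (if i \<le> n then l ! i else t)" for i
  have p_le: "p i \<in> T" if "i \<le> n" for i
    using that l by (auto simp: p_def)
  have mono: "strict_mono_on {..Suc n} p"
  proof (rule strict_mono_onI)
    fix i j assume ij: "i \<in> {..Suc n}" "j \<in> {..Suc n}" "i < j"
    show "p i < p j"
    proof (cases "j \<le> n")
      case True
      with ij l show ?thesis by (auto simp: p_def sorted_wrt_iff_nth_less)
    next
      case False
      with ij have "i \<le> n" by auto
      from p_le[OF this] T(2) st False show ?thesis
        using ij by (auto simp: p_def)
    qed
  qed
  have ex: "\<exists>j\<le>n. p j = u" if "u \<in> T" for u
  proof -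
    from that l(2) obtain j where "j < length l" "l ! j = u" by (auto simp: in_set_conv_nth)
    with l(1) show ?thesis by (intro exI[of _ j]) (auto simp: p_def)
  qed
  then obtain ix where ix: "ix u \<le> n" "p (ix u) = u" if "u \<in> T" for u
    by metis
  have pn: "p n = s"
  proof -
    have "p (ix s) \<le> p n"
      using ix[OF T(3)] mono
      by (metis atMost_iff le_SucI order.refl strict_mono_on_leD)
    then show ?thesis
      using ix[OF T(3)] p_le[of n] T(2) by force
  qed
  have pSn: "p (Suc n) = t" by (simp add: p_def)
  have "indep_vars (\<lambda>_. borel) (\<lambda>i \<omega>. W (p (Suc i)) \<omega> - W (p i) \<omega>) {..<Suc n}"
    using wiener mono unfolding two_sided_wiener_def by blast
  then have iv: "indep_var
      (PiM {..<n} (\<lambda>_. borel)) (\<lambda>\<omega>. \<lambda>i\<in>{..<n}. W (p (Suc i)) \<omega> - W (p i) \<omega>)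
      (PiM {n} (\<lambda>_. borel)) (\<lambda>\<omega>. \<lambda>i\<in>{n}. W (p (Suc i)) \<omega> - W (p i) \<omega>)"
    (is "indep_var _ ?X _ ?Y")
    by (rule indep_var_restrict) auto
  \<comment> \<open>\<open>Z\<close> rebuilds the values relative to \<open>W s\<close> from the
    increments before \<open>s\<close> by telescoping; \<open>ix u\<close> is the position of
    \<open>u\<close> in the enumeration.\<close>
  define Z :: "(nat \<Rightarrow> real ^ 'd) \<Rightarrow> real \<Rightarrow> real ^ 'd"
    where "Z = (\<lambda>x. \<lambda>u\<in>T. - (\<Sum>i\<in>{ix u..<n}. x i))"
  have Zm: "Z \<in> measurable (PiM {..<n} (\<lambda>_. borel)) (PiM T (\<lambda>_. borel))"
    unfolding Z_def
    by (auto intro!: measurable_restrict borel_measurable_uminus borel_measurable_sum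
        measurable_component_singleton)
  have ZX: "Z (?X \<omega>) = (\<lambda>u\<in>T. W u \<omega> - W s \<omega>)" for \<omega>
  proof
    fix u
    have "(\<Sum>i\<in>{ix u..<n}. ?X \<omega> i) = W s \<omega> - W u \<omega>"
      if u: "u \<in> T"
    proof -
      have "(\<Sum>i\<in>{ix u..<n}. ?X \<omega> i) = (\<Sum>i\<in>{ix u..<n}. W (p (Suc i)) \<omega> - W (p i) \<omega>)"
        by (intro sum.cong) auto
      also have "\<dots> = W (p n) \<omega> - W (p (ix u)) \<omega>"
        using ix(1)[OF u] by (rule sum_Suc_diff')
      finally show ?thesis using pn ix(2)[OF u] by simp
    qed
    then show "Z (?X \<omega>) u = (\<lambda>u\<in>T. W u \<omega> - W s \<omega>) u"
      unfolding Z_def by (cases "u \<in> T") auto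
  qed
  let ?C = "Z -` C \<inter> space (PiM {..<n} (\<lambda>_. borel))"
  let ?B = "(\<lambda>x. x n) -` B \<inter> space (PiM {n} (\<lambda>_. borel :: (real ^ 'd) measure))"
  have "?C \<in> sets (PiM {..<n} (\<lambda>_. borel))"
    using Zm C by (rule measurable_sets)
  moreover have "?B \<in> sets (PiM {n} (\<lambda>_. borel))"
    using measurable_component_singleton B by (rule measurable_sets) simp
  ultimately have "prob ((\<lambda>x. (?X x, ?Y x)) -` (?C \<times> ?B) \<inter> space M)
      = prob (?X -` ?C \<inter> space M) * prob (?Y -` ?B \<inter> space M)"
    by (rule indep_varD[OF iv])
  moreover have "?X -` ?C = (\<lambda>\<omega>. \<lambda>u\<in>T. W u \<omega> - W s \<omega>) -` C"
    by (auto simp: space_PiM ZX)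
  moreover have "?Y -` ?B = (\<lambda>\<omega>. W t \<omega> - W s \<omega>) -` B"
    by (auto simp: space_PiM pn pSn)
  moreover have "(\<lambda>x. (?X x, ?Y x)) -` (?C \<times> ?B) \<inter> space M = (?X -` ?C \<inter> space M) \<inter> (?Y -` ?B \<inter> space M)"
    by blast
  ultimately show ?thesis by simp
qed

text \<open>Single increments do not generate by an intersection-stable family. Events determined by
  finitely many values \<open>W u - W s\<close>, \<open>u \<le> s\<close>, do form one, because two
  finite sets of times lie in their union; they are independent of the later increment by
  \<open>finite_past_indep\<close>, and every increment before \<open>s\<close> is a difference of
  two such values.\<close>

lemma indep_set_incr_filtration:
  assumes st: "s < t"
  shows "indep_set (sets (incr_filtration M W s))
    (sigma_sets (space M) {(\<lambda>\<omega>. W t \<omega> - W s \<omega>) -` B \<inter> space M | B. B \<in> sets borel})"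
proof -
  define V where "V T = (\<lambda>\<omega>. \<lambda>u\<in>T. W u \<omega> - W s \<omega>)" for T
  define \<G> where "\<G> T = {V T -` C \<inter> space M | C. C \<in> sets (PiM T (\<lambda>_. borel))}" for T
  define \<T> where "\<T> = {T. finite T \<and> T \<subseteq> {..s} \<and> s \<in> T}"
  define \<B> where "\<B> = {(\<lambda>\<omega>. W t \<omega> - W s \<omega>) -` B \<inter> space M | B. B \<in> sets (borel :: (real^'d) measure)}"
  have \<G>_mono: "\<G> T \<subseteq> \<G> T'" if TT: "T \<subseteq> T'" for T T'
  proof
    fix A assume "A \<in> \<G> T"
    then obtain C where C: "C \<in> sets (PiM T (\<lambda>_. borel))" "A = V T -` C \<inter> space M"
      by (auto simp: \<G>_def)
    have "(\<lambda>f. restrict f T) -` C \<inter> space (PiM T' (\<lambda>_. borel :: (real^'d) measure)) \<in> sets (PiM T' (\<lambda>_. borel))"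
      using measurable_restrict_subset[OF TT] C(1) by (rule measurable_sets)
    moreover have "A = V T' -` ((\<lambda>f. restrict f T) -` C \<inter> space (PiM T' (\<lambda>_. borel))) \<inter> space M"
      using TT unfolding C V_def
      by (auto simp: space_PiM restrict_restrict Int_absorb1)
    ultimately show "A \<in> \<G> T'" unfolding \<G>_def by blast
  qed
  have indep: "indep_set (\<Union>T\<in>\<T>. \<G> T) \<B>"
  proof (rule indep_setI)
    have "V T \<in> measurable M (PiM T (\<lambda>_. borel))" for T
      unfolding V_def by measurable
    then show "(\<Union>T\<in>\<T>. \<G> T) \<subseteq> events"
      by (auto simp: \<G>_def intro!: measurable_sets)
    show "\<B> \<subseteq> events"
      by (auto simp: \<B>_def intro!: measurable_sets)
  next
    fix A B assume "A \<in> (\<Union>T\<in>\<T>. \<G> T)" "B \<in> \<B>"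
    then show "prob (A \<inter> B) = prob A * prob B"
      unfolding \<G>_def \<B>_def V_def \<T>_def using st by (auto intro!: finite_past_indep)
  qed
  have "Int_stable (\<Union>T\<in>\<T>. \<G> T)"
  proof (rule Int_stableI)
    fix A B assume "A \<in> (\<Union>T\<in>\<T>. \<G> T)" "B \<in> (\<Union>T\<in>\<T>. \<G> T)"
    then obtain T T' where T: "T \<in> \<T>" "A \<in> \<G> T" "T' \<in> \<T>" "B \<in> \<G> T'" by auto
    then have "A \<in> \<G> (T \<union> T')" "B \<in> \<G> (T \<union> T')"
      using \<G>_mono[of T "T \<union> T'"] \<G>_mono[of T' "T \<union> T'"] by auto
    then obtain C D where "C \<in> sets (PiM (T \<union> T') (\<lambda>_. borel))" "A = V (T \<union> T') -` C \<inter> space M"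
      "D \<in> sets (PiM (T \<union> T') (\<lambda>_. borel))" "B = V (T \<union> T') -` D \<inter> space M"
      unfolding \<G>_def by blast
    then have "A \<inter> B \<in> \<G> (T \<union> T')"
      unfolding \<G>_def by (intro CollectI exI[of _ "C \<inter> D"]) auto
    moreover have "T \<union> T' \<in> \<T>" using T by (auto simp: \<T>_def)
    ultimately show "A \<inter> B \<in> (\<Union>T\<in>\<T>. \<G> T)" by blast
  qed
  moreover have "Int_stable \<B>"
  proof (rule Int_stableI)
    fix A B assume "A \<in> \<B>" "B \<in> \<B>"
    then obtain C D where "C \<in> sets (borel :: (real^'d) measure)" "A = (\<lambda>\<omega>. W t \<omega> - W s \<omega>) -` C \<inter> space M"
      "D \<in> sets (borel :: (real^'d) measure)" "B = (\<lambda>\<omega>. W t \<omega> - W s \<omega>) -` D \<inter> space M"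
      unfolding \<B>_def by blast
    then show "A \<inter> B \<in> \<B>"
      unfolding \<B>_def by (intro CollectI exI[of _ "C \<inter> D"]) auto
  qed
  ultimately have *: "indep_set (sigma_sets (space M) (\<Union>T\<in>\<T>. \<G> T)) (sigma_sets (space M) \<B>)"
    by (rule indep_set_sigma_sets[OF indep])
  have "sets (incr_filtration M W s) \<subseteq> sigma_sets (space M) (\<Union>T\<in>\<T>. \<G> T)"
    unfolding sets_incr_filtration
  proof (rule sigma_sets_mono', safe)
    fix u v :: real and B :: "(real^'d) set"
    assume uv: "v \<le> u" "u \<le> s" and B: "B \<in> sets borel"
    define T where "T = {u, v, s}"
    have T: "T \<in> \<T>" using uv by (auto simp: \<T>_def T_def)
    have "(\<lambda>x. x u - x v) \<in> borel_measurable (PiM T (\<lambda>_. borel :: (real^'d) measure))"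
      by (auto simp: T_def intro!: borel_measurable_diff measurable_component_singleton)
    then have "(\<lambda>x. x u - x v) -` B \<inter> space (PiM T (\<lambda>_. borel :: (real^'d) measure)) \<in> sets (PiM T (\<lambda>_. borel))"
      using B by (rule measurable_sets)
    moreover have "(\<lambda>\<omega>. W u \<omega> - W v \<omega>) -` B \<inter> space M =
        V T -` ((\<lambda>x. x u - x v) -` B \<inter> space (PiM T (\<lambda>_. borel :: (real^'d) measure))) \<inter> space M"
      unfolding V_def by (auto simp: T_def space_PiM)
    ultimately have "(\<lambda>\<omega>. W u \<omega> - W v \<omega>) -` B \<inter> space M \<in> \<G> T"
      unfolding \<G>_def by blast
    with T show "(\<lambda>\<omega>. W u \<omega> - W v \<omega>) -` B \<inter> space M \<in> (\<Union>T\<in>\<T>. \<G> T)" by blast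
  qed
  with * show ?thesis
    unfolding \<B>_def indep_set_def
    by (elim indep_sets_mono_sets) (auto split: bool.splits)
qed

text \<open>Null sets among the generators alter an event only up to a null set: this holds for the
  generators and is stable under complements and countable unions.\<close>

lemma sets_F_AE_incr:
  assumes "A \<in> sets (F s)"
  shows "\<exists>A' \<in> sets (incr_filtration M W s). AE \<omega> in M. \<omega> \<in> A \<longleftrightarrow> \<omega> \<in> A'"
  using assms unfolding sets_F
proof (induction rule: sigma_sets.induct)
  case (Basic A)
  then show ?case
  proof
    assume "A \<in> null_sets M"
    then have "AE \<omega> in M. \<omega> \<notin> A" by (rule AE_not_in)
    then show ?thesis by (intro bexI[of _ "{}"]) auto
  qed auto
next
  case Empty
  show ?case by (intro bexI[of _ "{}"]) auto
next
  case (Compl A)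
  then obtain A' where "A' \<in> sets (incr_filtration M W s)" "AE \<omega> in M. \<omega> \<in> A \<longleftrightarrow> \<omega> \<in> A'" by blast
  then show ?case
    by (intro bexI[of _ "space M - A'"])
       (auto simp: space_incr_filtration[symmetric, of s] simp del: space_incr_filtration)
next
  case (Union A)
  then obtain A' where "\<And>i. A' i \<in> sets (incr_filtration M W s)"
    and *: "\<And>i. AE \<omega> in M. \<omega> \<in> A i \<longleftrightarrow> \<omega> \<in> A' i" by metis
  moreover have "AE \<omega> in M. \<forall>i::nat. \<omega> \<in> A i \<longleftrightarrow> \<omega> \<in> A' i"
    using * by (simp add: AE_all_countable)
  ultimately show ?case
    by (intro bexI[of _ "\<Union>i. A' i"]) auto
qed

text \<open>Replacing an event by its almost sure twin in the unaugmented filtration changes no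
  probability.\<close>

lemma indep_set_F:
  assumes st: "s < t"
  shows "indep_set (sets (F s))
    (sigma_sets (space M) {(\<lambda>\<omega>. W t \<omega> - W s \<omega>) -` B \<inter> space M | B. B \<in> sets borel})"
    (is "indep_set _ ?B")
proof (rule indep_setI)
  show "sets (F s) \<subseteq> events" using subalgebra_F[of s] by (auto simp: subalgebra_def)
  show BM: "?B \<subseteq> events"
    by (rule sets.sigma_sets_subset) (auto intro!: measurable_sets)
  fix A B assume AB: "A \<in> sets (F s)" "B \<in> ?B"
  obtain A' where A': "A' \<in> sets (incr_filtration M W s)" "AE \<omega> in M. \<omega> \<in> A \<longleftrightarrow> \<omega> \<in> A'"
    using sets_F_AE_incr[OF AB(1)] by blast
  have ev: "A \<in> events" "A' \<in> events" "B \<in> events"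
    using AB BM A' sets_incr_filtration_subset[of s] subalgebra_F[of s]
    by (auto simp: subalgebra_def)
  have "prob (A \<inter> B) = prob (A' \<inter> B)" "prob A = prob A'"
    using A'(2) ev by (auto intro!: finite_measure_eq_AE)
  with indep_setD[OF indep_set_incr_filtration[OF st] A'(1) AB(2)]
  show "prob (A \<inter> B) = prob A * prob B" by simp
qed

text \<open>\<open>indep_var\<close> wants both variables in one type; \<open>h\<close> takes the
  vector-valued increment to the type of \<open>Z\<close>.\<close>

lemma indep_var_F:
  fixes Z :: "'w \<Rightarrow> 'b::topological_space"
  assumes st: "s < t" and Z: "Z \<in> borel_measurable (F s)" and h: "h \<in> borel_measurable borel"
  shows "indep_var borel Z borel (\<lambda>\<omega>. h (W t \<omega> - W s \<omega>))"
  unfolding indep_var_eq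
proof (intro conjI)
  show "random_variable borel Z" by (rule measurable_FD[OF Z])
  show "random_variable borel (\<lambda>\<omega>. h (W t \<omega> - W s \<omega>))"
    by (rule measurable_compose[OF _ h]) simp
  let ?B = "sigma_sets (space M) {(\<lambda>\<omega>. W t \<omega> - W s \<omega>) -` B \<inter> space M | B. B \<in> sets borel}"
  have "sigma_sets (space M) {Z -` A \<inter> space M | A. A \<in> sets borel} \<subseteq> sets (F s)"
    unfolding space_F[symmetric, of s] using measurable_sets[OF Z]
    by (intro sets.sigma_sets_subset) auto
  moreover have "sigma_sets (space M) {(\<lambda>\<omega>. h (W t \<omega> - W s \<omega>)) -` A \<inter> space M | A. A \<in> sets borel} \<subseteq> ?B"
  proof (rule sigma_sets_mono', safe)
    fix A :: "'b set" assume "A \<in> sets borel"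
    then have "h -` A \<in> sets borel" using measurable_sets[OF h] by simp
    then show "\<exists>B. (\<lambda>\<omega>. h (W t \<omega> - W s \<omega>)) -` A \<inter> space M = (\<lambda>\<omega>. W t \<omega> - W s \<omega>) -` B \<inter> space M \<and> B \<in> sets borel"
      by (intro exI[of _ "h -` A"]) auto
  qed
  ultimately show "indep_set (sigma_sets (space M) {Z -` A \<inter> space M | A. A \<in> sets borel})
      (sigma_sets (space M) {(\<lambda>\<omega>. h (W t \<omega> - W s \<omega>)) -` A \<inter> space M | A. A \<in> sets borel})"
    using indep_set_F[OF st]
    unfolding indep_set_def by (elim indep_sets_mono_sets) (auto split: bool.splits)
qed

lemma incr_moments:
  assumes st: "s < t"
  defines "D \<equiv> \<lambda>\<omega>. W t \<omega> - W s \<omega>"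
  shows "integrable M (\<lambda>\<omega>. D \<omega> $ j)" "expectation (\<lambda>\<omega>. D \<omega> $ j) = 0"
    and "integrable M (\<lambda>\<omega>. D \<omega> $ j * D \<omega> $ k)"
    and "expectation (\<lambda>\<omega>. D \<omega> $ j * D \<omega> $ k) = (if j = k then t - s else 0)"
proof -
  have dist: "\<And>j. distributed M lborel (\<lambda>\<omega>. D \<omega> $ j) (normal_density 0 (sqrt (t - s)))"
    and ind: "indep_vars (\<lambda>_. borel) (\<lambda>j \<omega>. D \<omega> $ j) UNIV"
    using wiener st unfolding two_sided_wiener_def D_def by auto
  have pos: "0 < sqrt (t - s)" using st by simp
  show i1: "integrable M (\<lambda>\<omega>. D \<omega> $ j)" for j
    using distributed_integrable[OF dist, of "\<lambda>x. x"] integrable_normal_moment_nz_1[OF pos, of 0]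
    by (simp add: normal_density_nonneg)
  show e1: "expectation (\<lambda>\<omega>. D \<omega> $ j) = 0" for j
    using distributed_integral[OF dist, of "\<lambda>x. x"] integral_normal_moment_nz_1[OF pos, of 0]
    by (simp add: normal_density_nonneg)
  have i2: "integrable M (\<lambda>\<omega>. (D \<omega> $ j)\<^sup>2)" for j
    using distributed_integrable[OF dist, of "\<lambda>x. x\<^sup>2"] integrable_normal_moment[OF pos, of 0 2]
    by (simp add: normal_density_nonneg)
  have e2: "expectation (\<lambda>\<omega>. (D \<omega> $ j)\<^sup>2) = t - s" for j
    using distributed_integral[OF dist, of "\<lambda>x. x\<^sup>2"] integral_normal_moment_even[OF pos, of 0 1] st
    by (simp add: normal_density_nonneg fact_numeral)
  \<comment> \<open>A pair is extracted from the independent family by applying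
    \<open>indep_vars_sum\<close> to a sum with the single summand \<open>k\<close>.\<close>
  have "indep_var borel (\<lambda>\<omega>. D \<omega> $ j) borel (\<lambda>\<omega>. D \<omega> $ k)" if "j \<noteq> k"
    using indep_vars_sum[of "{k}" j "\<lambda>j \<omega>. D \<omega> $ j"] indep_vars_subset[OF ind, of "{j, k}"] that
    by simp
  note * = indep_var_integrable[OF this i1 i1] indep_var_lebesgue_integral[OF this i1 i1]
  show "integrable M (\<lambda>\<omega>. D \<omega> $ j * D \<omega> $ k)"
    using *(1) i2[of j] by (cases "j = k") (auto simp: power2_eq_square)
  show "expectation (\<lambda>\<omega>. D \<omega> $ j * D \<omega> $ k) = (if j = k then t - s else 0)"
    using *(2) e2[of j] e1 by (cases "j = k") (auto simp: power2_eq_square)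
qed

lemma F_mult_incr:
  assumes st: "s \<le> t" and Z: "Z \<in> borel_measurable (F s)" "integrable M (Z :: _ \<Rightarrow> real)"
  defines "D \<equiv> \<lambda>\<omega>. W t \<omega> - W s \<omega>"
  shows "integrable M (\<lambda>\<omega>. Z \<omega> * D \<omega> $ j)" "expectation (\<lambda>\<omega>. Z \<omega> * D \<omega> $ j) = 0"
    and "integrable M (\<lambda>\<omega>. Z \<omega> * (D \<omega> $ j * D \<omega> $ k))"
    and "expectation (\<lambda>\<omega>. Z \<omega> * (D \<omega> $ j * D \<omega> $ k)) = (if j = k then (t - s) * expectation Z else 0)"
proof -
  have "integrable M (\<lambda>\<omega>. Z \<omega> * D \<omega> $ j) \<and> expectation (\<lambda>\<omega>. Z \<omega> * D \<omega> $ j) = 0 \<and>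
    integrable M (\<lambda>\<omega>. Z \<omega> * (D \<omega> $ j * D \<omega> $ k)) \<and>
    expectation (\<lambda>\<omega>. Z \<omega> * (D \<omega> $ j * D \<omega> $ k)) = (if j = k then (t - s) * expectation Z else 0)"
  \<comment> \<open>The normal law is available only for \<open>s < t\<close>; for
    \<open>s = t\<close> the increment vanishes and so do both sides.\<close>
  proof (cases "s = t")
    case True
    then show ?thesis by (simp add: D_def)
  next
    case False
    with st have st: "s < t" by simp
    have i1: "indep_var borel Z borel (\<lambda>\<omega>. (W t \<omega> - W s \<omega>) $ j)"
      by (rule indep_var_F[OF st Z(1), where h="\<lambda>x. x $ j"]) simp
    have i2: "indep_var borel Z borel (\<lambda>\<omega>. (W t \<omega> - W s \<omega>) $ j * (W t \<omega> - W s \<omega>) $ k)"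
      by (rule indep_var_F[OF st Z(1), where h="\<lambda>x. x $ j * x $ k"]) simp
    note m = incr_moments[OF st]
    show ?thesis
      unfolding D_def
      using indep_var_integrable[OF i1 Z(2) m(1)] indep_var_lebesgue_integral[OF i1 Z(2) m(1)]
        indep_var_integrable[OF i2 Z(2) m(3)] indep_var_lebesgue_integral[OF i2 Z(2) m(3)] m(2,4)
      by simp
  qed
  then show "integrable M (\<lambda>\<omega>. Z \<omega> * D \<omega> $ j)" "expectation (\<lambda>\<omega>. Z \<omega> * D \<omega> $ j) = 0"
    "integrable M (\<lambda>\<omega>. Z \<omega> * (D \<omega> $ j * D \<omega> $ k))"
    "expectation (\<lambda>\<omega>. Z \<omega> * (D \<omega> $ j * D \<omega> $ k)) = (if j = k then (t - s) * expectation Z else 0)"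
    by auto
qed

end

subsection \<open>Simple integrands\<close>

lemma borel_measurable_matrix_vector_mult [measurable (raw)]:
  fixes A :: "'a \<Rightarrow> real ^ 'n ^ 'm"
  assumes "A \<in> borel_measurable N" "x \<in> borel_measurable N"
  shows "(\<lambda>\<omega>. A \<omega> *v x \<omega>) \<in> borel_measurable N"
  using assms
  by (rule borel_measurable_continuous_Pair)
     (auto simp: matrix_vector_mult_def intro!: continuous_intros)

lemma sq_integrable_component:
  fixes Y :: "'w \<Rightarrow> 'b::euclidean_space ^ 'n"
  assumes "sq_integrable M Y"
  shows "sq_integrable M (\<lambda>\<omega>. Y \<omega> $ i)"
proof (rule sq_integrable_bound[OF _ sq_integrable_norm2[OF assms]])
  show "(\<lambda>\<omega>. Y \<omega> $ i) \<in> borel_measurable M"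
    by (rule measurable_compose[OF sq_integrable_measurable[OF assms]])
       (auto intro!: borel_measurable_continuous_onI continuous_intros)
qed (auto intro!: AE_I2 power_mono Finite_Cartesian_Product.norm_nth_le)

lemma inner_matrix_vector_mult:
  fixes G G' :: "real ^ 'n ^ 'm"
  shows "(G *v w) \<bullet> (G' *v w) = (\<Sum>i\<in>UNIV. \<Sum>j\<in>UNIV. \<Sum>k\<in>UNIV. (G $ i $ j * G' $ i $ k) * (w $ j * w $ k))"
  by (simp add: inner_vec_def matrix_vector_mult_def sum_product mult_ac)

context wiener
begin

lemma F_measurable_component:
  fixes Y :: "'w \<Rightarrow> 'b::euclidean_space ^ 'n"
  assumes "Y \<in> borel_measurable (F t)"
  shows "(\<lambda>\<omega>. Y \<omega> $ i) \<in> borel_measurable (F t)"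
  by (rule measurable_compose[OF assms])
     (auto intro!: borel_measurable_continuous_onI continuous_intros)

text \<open>In coordinates each term is a product of entries of \<open>Y\<close> and
  \<open>G\<close>, which is integrable and known at time \<open>s\<close>, and a component of the
  increment, which is independent of it and has mean zero.\<close>

lemma expectation_inner_incr:
  fixes Y :: "'w \<Rightarrow> real ^ 'm" and G :: "'w \<Rightarrow> real ^ 'd ^ 'm"
  assumes st: "s \<le> t"
    and Y: "Y \<in> borel_measurable (F s)" "sq_integrable M Y"
    and G: "G \<in> borel_measurable (F s)" "sq_integrable M G"
  shows "expectation (\<lambda>\<omega>. Y \<omega> \<bullet> (G \<omega> *v (W t \<omega> - W s \<omega>))) = 0"
proof -
  let ?Z = "\<lambda>i j \<omega>. Y \<omega> $ i * G \<omega> $ i $ j"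
  have Z: "?Z i j \<in> borel_measurable (F s)" "integrable M (?Z i j)" for i j
    using Y G by (auto intro!: borel_measurable_times F_measurable_component sq_integrable_mult
        sq_integrable_component)
  have "Y \<omega> \<bullet> (G \<omega> *v (W t \<omega> - W s \<omega>)) = (\<Sum>i\<in>UNIV. \<Sum>j\<in>UNIV. ?Z i j \<omega> * (W t \<omega> - W s \<omega>) $ j)" for \<omega>
    by (simp add: inner_vec_def matrix_vector_mult_def sum_distrib_left mult_ac
        del: vector_minus_component)
  then show ?thesis
    using F_mult_incr(1,2)[OF st Z]
    by (simp add: Bochner_Integration.integral_sum Bochner_Integration.integrable_sum
        del: vector_minus_component)
qed

text \<open>Of the products of two components of the increment only those with equal indices have
  non-zero mean, namely \<open>t - s\<close>; what remains is the Frobenius inner product. Keeping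
  \<open>G\<close> and \<open>G'\<close> apart gives the bilinear form needed for sums of
  integrands.\<close>

lemma inner_incr_incr:
  fixes G G' :: "'w \<Rightarrow> real ^ 'd ^ 'm"
  assumes st: "s \<le> t"
    and G: "G \<in> borel_measurable (F s)" "sq_integrable M G"
    and G': "G' \<in> borel_measurable (F s)" "sq_integrable M G'"
  defines "D \<equiv> \<lambda>\<omega>. W t \<omega> - W s \<omega>"
  shows "integrable M (\<lambda>\<omega>. (G \<omega> *v D \<omega>) \<bullet> (G' \<omega> *v D \<omega>))"
    and "expectation (\<lambda>\<omega>. (G \<omega> *v D \<omega>) \<bullet> (G' \<omega> *v D \<omega>)) = (t - s) * expectation (\<lambda>\<omega>. G \<omega> \<bullet> G' \<omega>)"
proof -
  let ?Z = "\<lambda>i j k \<omega>. G \<omega> $ i $ j * G' \<omega> $ i $ k"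
  have Z: "?Z i j k \<in> borel_measurable (F s)" "integrable M (?Z i j k)" for i j k
    using G G' by (auto intro!: borel_measurable_times F_measurable_component sq_integrable_mult
        sq_integrable_component)
  have hbi: "has_bochner_integral M (\<lambda>\<omega>. (G \<omega> *v D \<omega>) \<bullet> (G' \<omega> *v D \<omega>))
      (\<Sum>i\<in>UNIV. \<Sum>j\<in>UNIV. \<Sum>k\<in>UNIV. if j = k then (t - s) * expectation (?Z i j k) else 0)"
    unfolding inner_matrix_vector_mult D_def
    by (rule has_bochner_integral_sum)+
       (simp only: has_bochner_integral_iff F_mult_incr(3,4)[OF st Z])
  then show "integrable M (\<lambda>\<omega>. (G \<omega> *v D \<omega>) \<bullet> (G' \<omega> *v D \<omega>))"
    by (simp add: has_bochner_integral_iff)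
  have "expectation (\<lambda>\<omega>. (G \<omega> *v D \<omega>) \<bullet> (G' \<omega> *v D \<omega>)) =
      (\<Sum>i\<in>UNIV. \<Sum>j\<in>UNIV. \<Sum>k\<in>UNIV. if j = k then (t - s) * expectation (?Z i j k) else 0)"
    using hbi by (rule has_bochner_integral_integral_eq)
  also have "\<dots> = (t - s) * (\<Sum>i\<in>UNIV. \<Sum>j\<in>UNIV. expectation (?Z i j j))"
    by (simp add: sum_distrib_left)
  also have "(\<Sum>i\<in>UNIV. \<Sum>j\<in>UNIV. expectation (?Z i j j)) = expectation (\<lambda>\<omega>. G \<omega> \<bullet> G' \<omega>)"
    using Z(2) by (simp add: inner_vec_def Bochner_Integration.integral_sum Bochner_Integration.integrable_sum)
  finally show "expectation (\<lambda>\<omega>. (G \<omega> *v D \<omega>) \<bullet> (G' \<omega> *v D \<omega>)) = (t - s) * expectation (\<lambda>\<omega>. G \<omega> \<bullet> G' \<omega>)" .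
qed

lemma F_incr_mult_measurable:
  fixes G :: "'w \<Rightarrow> real ^ 'd ^ 'm"
  assumes "u \<le> v" "v \<le> t" "s \<le> t" "G \<in> borel_measurable (F s)"
  shows "(\<lambda>\<omega>. G \<omega> *v (W v \<omega> - W u \<omega>)) \<in> borel_measurable (F t)"
  by (rule borel_measurable_matrix_vector_mult[OF measurable_F_mono[OF assms(3,4)] incr_measurable[OF assms(1,2)]])

lemma sq_integrable_incr_mult:
  fixes G :: "'w \<Rightarrow> real ^ 'd ^ 'm"
  assumes "s \<le> u" "u \<le> v" "G \<in> borel_measurable (F s)" "sq_integrable M G"
  shows "sq_integrable M (\<lambda>\<omega>. G \<omega> *v (W v \<omega> - W u \<omega>))"
  unfolding sq_integrable_def power2_norm_eq_inner
  using inner_incr_incr(1)[OF assms(2) measurable_F_mono[OF assms(1,3)] assms(4)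
      measurable_F_mono[OF assms(1,3)] assms(4)] sq_integrable_measurable[OF assms(4)]
  by simp

lemmas sq_integrable_incr = sq_integrable_incr_mult[OF order.refl]

text \<open>The isometry for two elementary integrands on arbitrarily overlapping intervals, so that
  sums of step processes over different grids never have to be refined to a common one. Cutting at
  \<open>u'\<close> and at the earlier right endpoint \<open>w\<close>, only the part over the
  overlap \<open>[u', w)\<close> contributes; in every other product the later factor is an
  increment orthogonal to the earlier one.\<close>

lemma incr_cross_le:
  fixes \<phi> \<phi>' :: "'w \<Rightarrow> real ^ 'd ^ 'm"
  assumes uv: "u \<le> v" "u' \<le> v'" "u \<le> u'"
    and \<phi>: "\<phi> \<in> borel_measurable (F u)" "sq_integrable M \<phi>"
    and \<phi>': "\<phi>' \<in> borel_measurable (F u')" "sq_integrable M \<phi>'"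
  shows "expectation (\<lambda>\<omega>. (\<phi> \<omega> *v (W v \<omega> - W u \<omega>)) \<bullet> (\<phi>' \<omega> *v (W v' \<omega> - W u' \<omega>))) =
    measure lborel ({u..<v} \<inter> {u'..<v'}) * expectation (\<lambda>\<omega>. \<phi> \<omega> \<bullet> \<phi>' \<omega>)"
proof (cases "v \<le> u'")
  case True
  then have "{u..<v} \<inter> {u'..<v'} = {}" by auto
  moreover have "expectation (\<lambda>\<omega>. (\<phi> \<omega> *v (W v \<omega> - W u \<omega>)) \<bullet> (\<phi>' \<omega> *v (W v' \<omega> - W u' \<omega>))) = 0"
    using F_incr_mult_measurable[OF uv(1) True _ \<phi>(1)] sq_integrable_incr_mult[OF _ uv(1) \<phi>] uv
    by (intro expectation_inner_incr[OF uv(2)] \<phi>') auto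
  ultimately show ?thesis by (simp only: measure_empty mult_zero_left)
next
  case False
  define w where "w = min v v'"
  have w: "u' \<le> w" "w \<le> v" "w \<le> v'" "u \<le> w" "w = v \<or> w = v'"
    using False uv by (auto simp: w_def)
  have int: "{u..<v} \<inter> {u'..<v'} = {u'..<w}"
    using uv by (auto simp: w_def)
  note \<phi>u' = measurable_F_mono[OF uv(3) \<phi>(1)]
  define P where "P \<omega> = \<phi> \<omega> *v (W u' \<omega> - W u \<omega>)" for \<omega>
  define Q where "Q \<omega> = \<phi> \<omega> *v (W w \<omega> - W u' \<omega>)" for \<omega>
  define R where "R \<omega> = \<phi> \<omega> *v (W v \<omega> - W w \<omega>)" for \<omega>
  define P' where "P' \<omega> = \<phi>' \<omega> *v (W w \<omega> - W u' \<omega>)" for \<omega>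
  define Q' where "Q' \<omega> = \<phi>' \<omega> *v (W v' \<omega> - W w \<omega>)" for \<omega>
  define S' where "S' \<omega> = \<phi>' \<omega> *v (W v' \<omega> - W u' \<omega>)" for \<omega>
  have sq: "sq_integrable M P" "sq_integrable M Q" "sq_integrable M R"
    "sq_integrable M P'" "sq_integrable M Q'" "sq_integrable M S'"
    unfolding P_def Q_def R_def P'_def Q'_def S'_def using uv w
    by (simp_all add: sq_integrable_incr_mult[OF _ _ \<phi>] sq_integrable_incr_mult[OF _ _ \<phi>'])
  have F: "P \<in> borel_measurable (F u')" "P' \<in> borel_measurable (F w)" "Q \<in> borel_measurable (F w)"
    unfolding P_def P'_def Q_def using uv w
    by (simp_all add: F_incr_mult_measurable[OF _ _ _ \<phi>(1)] F_incr_mult_measurable[OF _ _ _ \<phi>'(1)])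
  \<comment> \<open>Beyond \<open>w\<close> at most one of the two intervals continues, so one of
    the factors is an increment over an empty interval.\<close>
  have "R \<omega> \<bullet> Q' \<omega> = 0" for \<omega> using w(5) by (auto simp: R_def Q'_def)
  then have eq: "(\<phi> \<omega> *v (W v \<omega> - W u \<omega>)) \<bullet> (\<phi>' \<omega> *v (W v' \<omega> - W u' \<omega>)) =
      P \<omega> \<bullet> S' \<omega> + Q \<omega> \<bullet> P' \<omega> + P' \<omega> \<bullet> R \<omega> + Q \<omega> \<bullet> Q' \<omega>" for \<omega>
  proof -
    have "\<phi> \<omega> *v (W v \<omega> - W u \<omega>) = P \<omega> + (Q \<omega> + R \<omega>)" "S' \<omega> = P' \<omega> + Q' \<omega>"
      by (simp_all add: P_def Q_def R_def P'_def Q'_def S'_def matrix_vector_right_distrib[symmetric])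
    then show ?thesis
      using \<open>R \<omega> \<bullet> Q' \<omega> = 0\<close> unfolding S'_def
      by (simp add: inner_add_left inner_add_right inner_commute)
  qed
  have "expectation (\<lambda>\<omega>. P \<omega> \<bullet> S' \<omega>) = 0"
    unfolding S'_def by (rule expectation_inner_incr[OF uv(2) F(1) sq(1) \<phi>'])
  moreover have "expectation (\<lambda>\<omega>. P' \<omega> \<bullet> R \<omega>) = 0"
    unfolding R_def
    by (rule expectation_inner_incr[OF w(2) F(2) sq(4) measurable_F_mono[OF w(4) \<phi>(1)] \<phi>(2)])
  moreover have "expectation (\<lambda>\<omega>. Q \<omega> \<bullet> Q' \<omega>) = 0"
    unfolding Q'_def
    by (rule expectation_inner_incr[OF w(3) F(3) sq(2) measurable_F_mono[OF w(1) \<phi>'(1)] \<phi>'(2)])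
  moreover have "expectation (\<lambda>\<omega>. Q \<omega> \<bullet> P' \<omega>) = (w - u') * expectation (\<lambda>\<omega>. \<phi> \<omega> \<bullet> \<phi>' \<omega>)"
    unfolding Q_def P'_def by (rule inner_incr_incr(2)[OF w(1) \<phi>u' \<phi>(2) \<phi>'])
  ultimately show ?thesis
    unfolding eq int using sq w(1) by (simp add: sq_integrable_inner)
qed

lemma incr_cross:
  fixes \<phi> \<phi>' :: "'w \<Rightarrow> real ^ 'd ^ 'm"
  assumes uv: "u \<le> v" "u' \<le> v'"
    and \<phi>: "\<phi> \<in> borel_measurable (F u)" "sq_integrable M \<phi>"
    and \<phi>': "\<phi>' \<in> borel_measurable (F u')" "sq_integrable M \<phi>'"
  shows "expectation (\<lambda>\<omega>. (\<phi> \<omega> *v (W v \<omega> - W u \<omega>)) \<bullet> (\<phi>' \<omega> *v (W v' \<omega> - W u' \<omega>))) =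
    measure lborel ({u..<v} \<inter> {u'..<v'}) * expectation (\<lambda>\<omega>. \<phi> \<omega> \<bullet> \<phi>' \<omega>)"
proof (cases "u \<le> u'")
  case True
  then show ?thesis using assms by (intro incr_cross_le)
next
  case False
  then show ?thesis
    using incr_cross_le[OF uv(2,1) _ \<phi>' \<phi>] by (simp add: inner_commute Int_commute)
qed

text \<open>A relation between a simple integrand and its integral, closed under adding one
  elementary term on any subinterval. The intervals may overlap and come in any order, so sums,
  differences and truncations stay in the class, and well-definedness of the integral is not an
  issue.\<close>

inductive simple_ito ::
  "real \<Rightarrow> real \<Rightarrow> (real \<Rightarrow> 'w \<Rightarrow> real ^ 'd ^ 'm) \<Rightarrow> ('w \<Rightarrow> real ^ 'm) \<Rightarrow> bool" for a b where
  zero: "simple_ito a b (\<lambda>r \<omega>. 0) (\<lambda>\<omega>. 0)"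
| incr: "simple_ito a b H J \<Longrightarrow> a \<le> u \<Longrightarrow> u \<le> v \<Longrightarrow> v \<le> b \<Longrightarrow>
    \<phi> \<in> borel_measurable (F u) \<Longrightarrow> sq_integrable M \<phi> \<Longrightarrow>
    simple_ito a b (\<lambda>r \<omega>. H r \<omega> + indicator {u..<v} r *\<^sub>R \<phi> \<omega>)
      (\<lambda>\<omega>. J \<omega> + \<phi> \<omega> *v (W v \<omega> - W u \<omega>))"

lemma simple_ito_add:
  assumes "simple_ito a b H J" "simple_ito a b H' J'"
  shows "simple_ito a b (\<lambda>r \<omega>. H r \<omega> + H' r \<omega>) (\<lambda>\<omega>. J \<omega> + J' \<omega>)"
  using assms(2)
proof induction
  case zero
  then show ?case using assms(1) by simp
next
  case (incr H' J' u v \<phi>)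
  from simple_ito.incr[OF incr.IH incr.hyps(2-)] show ?case
    by (simp add: add.assoc)
qed

lemma simple_ito_minus:
  assumes "simple_ito a b H J"
  shows "simple_ito a b (\<lambda>r \<omega>. - H r \<omega>) (\<lambda>\<omega>. - J \<omega>)"
  using assms
proof induction
  case zero
  then show ?case by (simp add: simple_ito.zero)
next
  case (incr H J u v \<phi>)
  have "(- \<phi> \<omega>) *v x = - (\<phi> \<omega> *v x)" for \<omega> x
    by (simp add: vec_eq_iff matrix_vector_mult_def sum_negf)
  moreover have "(\<lambda>\<omega>. - \<phi> \<omega>) \<in> borel_measurable (F u)" "sq_integrable M (\<lambda>\<omega>. - \<phi> \<omega>)"
    using incr.hyps by (auto intro: sq_integrable_minus)
  note simple_ito.incr[OF incr.IH incr.hyps(2-4) this]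
  ultimately show ?case by simp
qed

lemma simple_ito_diff:
  assumes "simple_ito a b H J" "simple_ito a b H' J'"
  shows "simple_ito a b (\<lambda>r \<omega>. H r \<omega> - H' r \<omega>) (\<lambda>\<omega>. J \<omega> - J' \<omega>)"
  using simple_ito_add[OF assms(1) simple_ito_minus[OF assms(2)]] by simp

lemma simple_ito_sum:
  assumes "\<And>i. i \<in> I \<Longrightarrow> simple_ito a b (H i) (J i)"
  shows "simple_ito a b (\<lambda>r \<omega>. \<Sum>i\<in>I. H i r \<omega>) (\<lambda>\<omega>. \<Sum>i\<in>I. J i \<omega>)"
  using assms
  by (induction I rule: infinite_finite_induct) (simp_all add: simple_ito.zero simple_ito_add)

lemma simple_ito_elem:
  assumes "a \<le> u" "u \<le> v" "v \<le> b" "\<phi> \<in> borel_measurable (F u)" "sq_integrable M \<phi>"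
  shows "simple_ito a b (\<lambda>r \<omega>. indicator {u..<v} r *\<^sub>R \<phi> \<omega>) (\<lambda>\<omega>. \<phi> \<omega> *v (W v \<omega> - W u \<omega>))"
  using simple_ito.incr[OF simple_ito.zero assms] by simp

lemma simple_ito_measurable:
  assumes "simple_ito a b H J"
  shows "(\<lambda>(r, \<omega>). H r \<omega>) \<in> borel_measurable (borel \<Otimes>\<^sub>M M)"
  using assms
proof induction
  case (incr H J u v \<phi>)
  have [measurable]: "\<phi> \<in> borel_measurable M" using incr.hyps by (simp add: sq_integrable_def)
  show ?case using incr.IH by (simp add: split_beta')
qed simp

lemma simple_ito_support:
  assumes "simple_ito a b H J" "r < a \<or> b \<le> r"
  shows "H r \<omega> = 0"
  using assms by induction (auto simp: indicator_def)

lemma simple_ito_sq_integrable: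
  assumes "simple_ito a b H J"
  shows "sq_integrable M (H r)" "sq_integrable M J"
  using assms
  by induction (auto intro!: sq_integrable_add sq_integrable_scaleR sq_integrable_incr)

lemma simple_ito_orth:
  assumes "simple_ito a b H J" "Y \<in> borel_measurable (F a)" "sq_integrable M Y"
  shows "expectation (\<lambda>\<omega>. Y \<omega> \<bullet> J \<omega>) = 0"
  using assms(1)
proof induction
  case (incr H J u v \<phi>)
  have "expectation (\<lambda>\<omega>. Y \<omega> \<bullet> (\<phi> \<omega> *v (W v \<omega> - W u \<omega>))) = 0"
    using incr.hyps assms(2,3) measurable_F_mono[of a u] by (intro expectation_inner_incr) auto
  then show ?case
    using incr simple_ito_sq_integrable(2)[OF incr.hyps(1)] assms
    by (simp add: inner_add_right sq_integrable_inner sq_integrable_incr)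
qed simp

text \<open>The isometry is proved in polarised form because, unlike the squares, both sides are
  additive in the pair \<open>H\<close>, \<open>J\<close>, so that induction over
  \<open>simple_ito\<close> applies to one argument at a time. \<open>has_bochner_integral\<close>
  carries the integrability in time along with the value.\<close>

lemma simple_ito_isometry_elem:
  assumes "simple_ito a b H J" "u \<le> v" "\<phi> \<in> borel_measurable (F u)" "sq_integrable M \<phi>"
  shows "has_bochner_integral lborel
    (\<lambda>r. expectation (\<lambda>\<omega>. H r \<omega> \<bullet> (indicator {u..<v} r *\<^sub>R \<phi> \<omega>)))
    (expectation (\<lambda>\<omega>. J \<omega> \<bullet> (\<phi> \<omega> *v (W v \<omega> - W u \<omega>))))"
  using assms(1)
proof induction
  case (incr H J x y \<psi>)
  have "has_bochner_integral lborel
      (\<lambda>r. expectation (\<lambda>\<omega>. (indicator {x..<y} r *\<^sub>R \<psi> \<omega>) \<bullet> (indicator {u..<v} r *\<^sub>R \<phi> \<omega>)))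
      (expectation (\<lambda>\<omega>. (\<psi> \<omega> *v (W y \<omega> - W x \<omega>)) \<bullet> (\<phi> \<omega> *v (W v \<omega> - W u \<omega>))))"
  proof -
    have "emeasure lborel ({x..<y} \<inter> {u..<v}) < \<infinity>"
      by (rule order_le_less_trans[OF emeasure_mono[of _ "{x..y}"]]) (use incr.hyps(3) in auto)
    then have "has_bochner_integral lborel
        (\<lambda>r. indicator ({x..<y} \<inter> {u..<v}) r *\<^sub>R expectation (\<lambda>\<omega>. \<psi> \<omega> \<bullet> \<phi> \<omega>))
        (measure lborel ({x..<y} \<inter> {u..<v}) *\<^sub>R expectation (\<lambda>\<omega>. \<psi> \<omega> \<bullet> \<phi> \<omega>))"
      by (intro has_bochner_integral_scaleR_left has_bochner_integral_real_indicator) auto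
    moreover have "expectation (\<lambda>\<omega>. (indicator {x..<y} r *\<^sub>R \<psi> \<omega>) \<bullet> (indicator {u..<v} r *\<^sub>R \<phi> \<omega>))
        = indicator ({x..<y} \<inter> {u..<v}) r *\<^sub>R expectation (\<lambda>\<omega>. \<psi> \<omega> \<bullet> \<phi> \<omega>)" for r
      by (auto simp: indicator_def)
    ultimately show ?thesis
      unfolding incr_cross[OF incr.hyps(3) assms(2) incr.hyps(5,6) assms(3,4)]
      by (simp only: real_scaleR_def)
  qed
  from has_bochner_integral_add[OF incr.IH this] show ?case
    using simple_ito_sq_integrable[OF incr.hyps(1)] incr.hyps assms
    by (simp add: inner_add_left sq_integrable_inner sq_integrable_incr sq_integrable_scaleR
        del: inner_scaleR_left inner_scaleR_right)
qed (simp add: has_bochner_integral_zero)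

lemma simple_ito_isometry_inner:
  assumes "simple_ito a b H J" "simple_ito a b H' J'"
  shows "has_bochner_integral lborel (\<lambda>r. expectation (\<lambda>\<omega>. H r \<omega> \<bullet> H' r \<omega>))
    (expectation (\<lambda>\<omega>. J \<omega> \<bullet> J' \<omega>))"
  using assms(2)
proof induction
  case (incr H' J' u v \<phi>)
  from has_bochner_integral_add[OF incr.IH simple_ito_isometry_elem[OF assms(1) incr.hyps(3,5,6)]]
  show ?case
    using simple_ito_sq_integrable[OF incr.hyps(1)] simple_ito_sq_integrable[OF assms(1)] incr.hyps
    by (simp add: inner_add_right sq_integrable_inner sq_integrable_incr sq_integrable_scaleR
        del: inner_scaleR_left inner_scaleR_right)
qed (simp add: has_bochner_integral_zero)

lemma nn_integral_swap:
  assumes "case_prod h \<in> borel_measurable (borel \<Otimes>\<^sub>M M)"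
  shows "(\<integral>\<^sup>+\<omega>. (\<integral>\<^sup>+r. h r \<omega> \<partial>lborel) \<partial>M) = (\<integral>\<^sup>+r. (\<integral>\<^sup>+\<omega>. h r \<omega> \<partial>M) \<partial>lborel)"
proof -
  interpret pair_sigma_finite lborel M
    by (intro pair_sigma_finite.intro) (unfold_locales)
  have "case_prod h \<in> borel_measurable (lborel \<Otimes>\<^sub>M M)"
    using assms by (simp cong: measurable_cong_sets)
  from Fubini'[OF this] show ?thesis by simp
qed

lemma simple_ito_isometry:
  assumes "simple_ito a b H J"
  shows "(\<integral>\<^sup>+\<omega>. (\<integral>\<^sup>+r. ennreal ((norm (H r \<omega>))\<^sup>2) \<partial>lborel) \<partial>M) =
    ennreal (\<integral>\<omega>. (norm (J \<omega>))\<^sup>2 \<partial>M)"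
proof -
  note [measurable] = simple_ito_measurable[OF assms]
  have "(\<integral>\<^sup>+\<omega>. (\<integral>\<^sup>+r. ennreal ((norm (H r \<omega>))\<^sup>2) \<partial>lborel) \<partial>M)
      = (\<integral>\<^sup>+r. (\<integral>\<^sup>+\<omega>. ennreal ((norm (H r \<omega>))\<^sup>2) \<partial>M) \<partial>lborel)"
    by (rule nn_integral_swap) measurable
  also have "\<dots> = (\<integral>\<^sup>+r. ennreal (expectation (\<lambda>\<omega>. H r \<omega> \<bullet> H r \<omega>)) \<partial>lborel)"
    by (intro nn_integral_cong)
       (simp only: sq_integrable_nn[OF simple_ito_sq_integrable(1)[OF assms]], simp only: power2_norm_eq_inner)
  also have "\<dots> = ennreal (expectation (\<lambda>\<omega>. J \<omega> \<bullet> J \<omega>))"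
    using simple_ito_isometry_inner[OF assms assms]
    by (subst nn_integral_eq_integral)
       (auto simp: has_bochner_integral_iff intro!: integral_nonneg_AE)
  finally show ?thesis by (simp add: power2_norm_eq_inner)
qed

end

subsection \<open>The Ito integral over a subinterval\<close>

lemma ennreal_norm_add_sq_le2:
  fixes x y :: "'b::real_inner"
  shows "ennreal ((norm (x + y))\<^sup>2) \<le> 2 * ennreal ((norm x)\<^sup>2) + 2 * ennreal ((norm y)\<^sup>2)"
proof -
  have "ennreal ((norm (x + y))\<^sup>2) \<le> ennreal (2 * (norm x)\<^sup>2 + 2 * (norm y)\<^sup>2)"
    by (intro ennreal_leI norm_add_sq_le2)
  then show ?thesis by (simp add: ennreal_mult)
qed

context wiener
begin

text \<open>The squared norm of L2(dt x P), with the order of integration used in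
  \<open>has_ito_integral\<close>. Values in \<open>ennreal\<close> allow comparison before
  finiteness is known.\<close>

definition sq_int :: "real \<Rightarrow> real \<Rightarrow> (real \<Rightarrow> 'w \<Rightarrow> 'b::euclidean_space) \<Rightarrow> ennreal" where
  "sq_int a b H = (\<integral>\<^sup>+\<omega>. (\<integral>\<^sup>+r\<in>{a..b}. ennreal ((norm (H r \<omega>))\<^sup>2) \<partial>lborel) \<partial>M)"

lemma sq_int_mono:
  assumes "\<And>r \<omega>. a \<le> r \<Longrightarrow> r \<le> b \<Longrightarrow> norm (H r \<omega>) \<le> norm (H' r \<omega>)" "a' \<le> a" "b \<le> b'"
  shows "sq_int a b H \<le> sq_int a' b' H'"
  unfolding sq_int_def using assms
  by (intro nn_integral_mono) (auto simp: indicator_def intro!: power_mono ennreal_leI)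

lemma sq_int_measurable:
  fixes H :: "real \<Rightarrow> 'w \<Rightarrow> 'b::euclidean_space"
  assumes [measurable]: "case_prod H \<in> borel_measurable (borel \<Otimes>\<^sub>M M)"
  shows "(\<lambda>\<omega>. \<integral>\<^sup>+r\<in>{a..b}. ennreal ((norm (H r \<omega>))\<^sup>2) \<partial>lborel) \<in> borel_measurable M"
    and "\<omega> \<in> space M \<Longrightarrow> (\<lambda>r. ennreal ((norm (H r \<omega>))\<^sup>2) * indicator {a..b} r) \<in> borel_measurable lborel"
proof -
  have "(\<lambda>x. (snd x, fst x)) \<in> measurable (M \<Otimes>\<^sub>M lborel) (borel \<Otimes>\<^sub>M M)"
    by measurable
  from measurable_compose[OF this assms]
  have "(\<lambda>x. H (snd x) (fst x)) \<in> borel_measurable (M \<Otimes>\<^sub>M lborel)"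
    by simp
  then have h: "(\<lambda>x. ennreal ((norm (H (snd x) (fst x)))\<^sup>2) * indicator {a..b} (snd x)) \<in> borel_measurable (M \<Otimes>\<^sub>M lborel)"
    by (intro borel_measurable_times_ennreal measurable_compose[OF measurable_snd borel_measurable_indicator]) auto
  then show "(\<lambda>\<omega>. \<integral>\<^sup>+r\<in>{a..b}. ennreal ((norm (H r \<omega>))\<^sup>2) \<partial>lborel) \<in> borel_measurable M"
    by (intro lborel.borel_measurable_nn_integral) (simp add: split_beta')
  show "(\<lambda>r. ennreal ((norm (H r \<omega>))\<^sup>2) * indicator {a..b} r) \<in> borel_measurable lborel" if "\<omega> \<in> space M"
    using measurable_compose[OF measurable_Pair1'[OF that] h] by simp
qed

text \<open>\<open>K\<close> is only dominated pointwise, which absorbs the right endpoint: there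
  simple integrands, built on half-open intervals, vanish, whereas the integrand on the closed
  interval need not.\<close>

lemma sq_int_le2:
  assumes [measurable]: "case_prod H \<in> borel_measurable (borel \<Otimes>\<^sub>M M)"
      "case_prod H' \<in> borel_measurable (borel \<Otimes>\<^sub>M M)"
    and le: "\<And>r \<omega>. a \<le> r \<Longrightarrow> r \<le> b \<Longrightarrow> norm (K r \<omega>) \<le> norm (H r \<omega> + H' r \<omega>)"
  shows "sq_int a b K \<le> 2 * sq_int a b H + 2 * sq_int a b H'"
proof -
  have "sq_int a b K \<le> (\<integral>\<^sup>+\<omega>. (\<integral>\<^sup>+r. (2 * (ennreal ((norm (H r \<omega>))\<^sup>2) * indicator {a..b} r)
      + 2 * (ennreal ((norm (H' r \<omega>))\<^sup>2) * indicator {a..b} r)) \<partial>lborel) \<partial>M)"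
    unfolding sq_int_def
  proof (intro nn_integral_mono)
    fix \<omega> r
    show "ennreal ((norm (K r \<omega>))\<^sup>2) * indicator {a..b} r \<le>
      2 * (ennreal ((norm (H r \<omega>))\<^sup>2) * indicator {a..b} r) + 2 * (ennreal ((norm (H' r \<omega>))\<^sup>2) * indicator {a..b} r)"
    proof (cases "r \<in> {a..b}")
      case True
      then have "ennreal ((norm (K r \<omega>))\<^sup>2) \<le> ennreal ((norm (H r \<omega> + H' r \<omega>))\<^sup>2)"
        using le[of r \<omega>] by (intro ennreal_leI power_mono) auto
      also note ennreal_norm_add_sq_le2
      finally show ?thesis using True by simp
    qed simp
  qed
  also have "\<dots> = 2 * sq_int a b H + 2 * sq_int a b H'" (is "?lhs = ?rhs")
  proof -
    note m = sq_int_measurable(1)[OF assms(1), of a b] sq_int_measurable(2)[OF assms(1), of _ a b]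
      sq_int_measurable(1)[OF assms(2), of a b] sq_int_measurable(2)[OF assms(2), of _ a b]
    have "(\<integral>\<^sup>+r. (2 * (ennreal ((norm (H r \<omega>))\<^sup>2) * indicator {a..b} r)
        + 2 * (ennreal ((norm (H' r \<omega>))\<^sup>2) * indicator {a..b} r)) \<partial>lborel) =
        2 * (\<integral>\<^sup>+r\<in>{a..b}. ennreal ((norm (H r \<omega>))\<^sup>2) \<partial>lborel) +
        2 * (\<integral>\<^sup>+r\<in>{a..b}. ennreal ((norm (H' r \<omega>))\<^sup>2) \<partial>lborel)"
      if "\<omega> \<in> space M" for \<omega>
      using m(2)[OF that] m(4)[OF that]
      by (subst nn_integral_add) (auto simp: nn_integral_cmult intro!: borel_measurable_times)
    then have "?lhs = (\<integral>\<^sup>+\<omega>. (2 * (\<integral>\<^sup>+r\<in>{a..b}. ennreal ((norm (H r \<omega>))\<^sup>2) \<partial>lborel) +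
        2 * (\<integral>\<^sup>+r\<in>{a..b}. ennreal ((norm (H' r \<omega>))\<^sup>2) \<partial>lborel)) \<partial>M)"
      by (intro nn_integral_cong)
    also have "\<dots> = ?rhs"
      unfolding sq_int_def using m(1,3)
      by (subst nn_integral_add) (auto simp: nn_integral_cmult intro!: borel_measurable_times)
    finally show ?thesis .
  qed
  finally show ?thesis .
qed

lemma simple_ito_sq_int:
  assumes "simple_ito a b H J"
  shows "sq_int a b H = ennreal ((L2_norm M J)\<^sup>2)"
proof -
  have "(\<integral>\<^sup>+r\<in>{a..b}. ennreal ((norm (H r \<omega>))\<^sup>2) \<partial>lborel) = (\<integral>\<^sup>+r. ennreal ((norm (H r \<omega>))\<^sup>2) \<partial>lborel)" for \<omega>
    using simple_ito_support[OF assms, of _ \<omega>]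
    by (intro nn_integral_cong) (auto simp: indicator_def not_le)
  then show ?thesis
    using simple_ito_isometry[OF assms] by (simp add: sq_int_def L2_norm_sq)
qed

lemma adapted_step_bounds:
  assumes "adapted_step M W a b n p \<phi>" "i < n"
  shows "a \<le> p i" "p i \<le> p (Suc i)" "p (Suc i) \<le> b"
    "\<phi> i \<in> borel_measurable (F (p i))" "sq_integrable M (\<phi> i)"
  using assms mono_onD[of "{..n}" p 0 i] mono_onD[of "{..n}" p i "Suc i"]
    mono_onD[of "{..n}" p "Suc i" n]
  by (auto simp: adapted_step_def)

lemma adapted_step_simple:
  assumes "adapted_step M W a b n p \<phi>"
  shows "simple_ito a b (step_process n p \<phi>) (step_integral W n p \<phi>)"
proof -
  have "simple_ito a b (\<lambda>r \<omega>. \<Sum>i<n. indicator {p i..<p (Suc i)} r *\<^sub>R \<phi> i \<omega>)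
      (\<lambda>\<omega>. \<Sum>i<n. \<phi> i \<omega> *v (W (p (Suc i)) \<omega> - W (p i) \<omega>))"
    by (intro simple_ito_sum simple_ito_elem) (auto dest: adapted_step_bounds[OF assms])
  then show ?thesis by (simp add: step_process_def[abs_def] step_integral_def[abs_def])
qed

text \<open>The grid is truncated at \<open>s\<close> by \<open>min\<close> and \<open>max\<close>
  instead of being refined: intervals on the wrong side collapse to empty ones, and the one
  containing \<open>s\<close> is cut there.\<close>

lemma adapted_step_split:
  assumes step: "adapted_step M W a t n p \<phi>" and s: "a \<le> s" "s \<le> t"
  obtains HL JL HR JR where "simple_ito a s HL JL" "simple_ito s t HR JR"
    "\<And>\<omega>. step_integral W n p \<phi> \<omega> = JL \<omega> + JR \<omega>"
    "\<And>r \<omega>. r < s \<Longrightarrow> HL r \<omega> = step_process n p \<phi> r \<omega>"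
    "\<And>r \<omega>. s \<le> r \<Longrightarrow> HR r \<omega> = step_process n p \<phi> r \<omega>"
proof
  note b = adapted_step_bounds[OF step]
  show "simple_ito a s (\<lambda>r \<omega>. \<Sum>i<n. indicator {min (p i) s..<min (p (Suc i)) s} r *\<^sub>R \<phi> i \<omega>)
    (\<lambda>\<omega>. \<Sum>i<n. \<phi> i \<omega> *v (W (min (p (Suc i)) s) \<omega> - W (min (p i) s) \<omega>))"
  proof (rule simple_ito_sum)
    fix i assume "i \<in> {..<n}"
    then have i: "i < n" by simp
    show "simple_ito a s (\<lambda>r \<omega>. indicator {min (p i) s..<min (p (Suc i)) s} r *\<^sub>R \<phi> i \<omega>)
      (\<lambda>\<omega>. \<phi> i \<omega> *v (W (min (p (Suc i)) s) \<omega> - W (min (p i) s) \<omega>))"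
    proof (cases "p i \<le> s")
      case True
      then show ?thesis using b[OF i] s by (intro simple_ito_elem) (auto simp: min_def)
    next
      \<comment> \<open>Here \<open>\<phi> i\<close> need not be known at time \<open>s\<close>, but
        both truncated endpoints equal \<open>s\<close>, so the term is zero and can be replaced by
        the zero integrand.\<close>
      case False
      then show ?thesis using b[OF i] by (simp add: min_def simple_ito.zero)
    qed
  qed
  show "simple_ito s t (\<lambda>r \<omega>. \<Sum>i<n. indicator {max (p i) s..<max (p (Suc i)) s} r *\<^sub>R \<phi> i \<omega>)
    (\<lambda>\<omega>. \<Sum>i<n. \<phi> i \<omega> *v (W (max (p (Suc i)) s) \<omega> - W (max (p i) s) \<omega>))"
  proof (rule simple_ito_sum)
    fix i assume "i \<in> {..<n}"
    then have i: "i < n" by simp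
    show "simple_ito s t (\<lambda>r \<omega>. indicator {max (p i) s..<max (p (Suc i)) s} r *\<^sub>R \<phi> i \<omega>)
      (\<lambda>\<omega>. \<phi> i \<omega> *v (W (max (p (Suc i)) s) \<omega> - W (max (p i) s) \<omega>))"
      using b[OF i] s by (intro simple_ito_elem measurable_F_mono[OF _ b(4)[OF i]]) (auto simp: max_def)
  qed
  fix \<omega>
  \<comment> \<open>Hence the increments over the two truncated intervals add up to the original
    increment.\<close>
  have mm: "W (max x s) \<omega> = W x \<omega> + W s \<omega> - W (min x s) \<omega>" for x
    by (auto simp: max_def min_def)
  show "step_integral W n p \<phi> \<omega> =
      (\<Sum>i<n. \<phi> i \<omega> *v (W (min (p (Suc i)) s) \<omega> - W (min (p i) s) \<omega>)) +
      (\<Sum>i<n. \<phi> i \<omega> *v (W (max (p (Suc i)) s) \<omega> - W (max (p i) s) \<omega>))"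
    unfolding step_integral_def sum.distrib[symmetric] matrix_vector_right_distrib[symmetric] mm
    by simp
  fix r
  show "(\<Sum>i<n. indicator {min (p i) s..<min (p (Suc i)) s} r *\<^sub>R \<phi> i \<omega>) = step_process n p \<phi> r \<omega>"
    if "r < s"
    unfolding step_process_def using that by (intro sum.cong) (auto simp: indicator_def)
  show "(\<Sum>i<n. indicator {max (p i) s..<max (p (Suc i)) s} r *\<^sub>R \<phi> i \<omega>) = step_process n p \<phi> r \<omega>"
    if "s \<le> r"
    unfolding step_process_def using that by (intro sum.cong) (auto simp: indicator_def)
qed

text \<open>What is left of \<open>has_ito_integral\<close> on a subinterval: arbitrary simple
  integrands may approximate, so no adapted grid on \<open>[s, t]\<close> has to be rebuilt.
  Orthogonality and the L2 bound follow from this alone.\<close>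

definition ito_on ::
  "real \<Rightarrow> real \<Rightarrow> (real \<Rightarrow> 'w \<Rightarrow> real ^ 'd ^ 'm) \<Rightarrow> ('w \<Rightarrow> real ^ 'm) \<Rightarrow> bool" where
  "ito_on a b H J \<longleftrightarrow> sq_integrable M J \<and> (\<exists>Hj Jj. (\<forall>j. simple_ito a b (Hj j) (Jj j)) \<and>
     (\<lambda>j. sq_int a b (\<lambda>r \<omega>. Hj j r \<omega> - H r \<omega>)) \<longlonglongrightarrow> 0 \<and>
     (\<lambda>j::nat. L2_norm M (\<lambda>\<omega>. Jj j \<omega> - J \<omega>)) \<longlonglongrightarrow> 0)"

text \<open>
  The approximations of \<open>I0\<close> and \<open>I1\<close> are unrelated, but their parts on \<open>[a, s]\<close> are close by the
  isometry, since both approximate the same integrand there.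
\<close>

lemma has_ito_integral_diff:
  fixes H K :: "real \<Rightarrow> 'w \<Rightarrow> real ^ 'd ^ 'm"
  assumes s: "a \<le> s" "s \<le> t"
    and I0: "has_ito_integral M W a s H I0" and I1: "has_ito_integral M W a t H I1"
    and K: "case_prod K \<in> borel_measurable (borel \<Otimes>\<^sub>M M)" "\<And>r \<omega>. a \<le> r \<Longrightarrow> K r \<omega> = H r \<omega>"
  shows "ito_on s t K (\<lambda>\<omega>. I1 \<omega> - I0 \<omega>)"
proof -
  obtain n p \<phi> where step: "\<And>j. adapted_step M W a t (n j) (p j) (\<phi> j)"
    and conv: "(\<lambda>j. sq_int a t (\<lambda>r \<omega>. step_process (n j) (p j) (\<phi> j) r \<omega> - H r \<omega>)) \<longlonglongrightarrow> 0"
    and lim: "L2_limit M (\<lambda>j. step_integral W (n j) (p j) (\<phi> j)) I1"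
    using I1 unfolding has_ito_integral_def sq_int_def by blast
  obtain n0 p0 \<phi>0 where step0: "\<And>j. adapted_step M W a s (n0 j) (p0 j) (\<phi>0 j)"
    and conv0: "(\<lambda>j. sq_int a s (\<lambda>r \<omega>. step_process (n0 j) (p0 j) (\<phi>0 j) r \<omega> - H r \<omega>)) \<longlonglongrightarrow> 0"
    and lim0: "L2_limit M (\<lambda>j. step_integral W (n0 j) (p0 j) (\<phi>0 j)) I0"
    using I0 unfolding has_ito_integral_def sq_int_def by blast
  define S where "S j = step_process (n j) (p j) (\<phi> j)" for j
  define J where "J j = step_integral W (n j) (p j) (\<phi> j)" for j
  define S0 where "S0 j = step_process (n0 j) (p0 j) (\<phi>0 j)" for j
  define J0 where "J0 j = step_integral W (n0 j) (p0 j) (\<phi>0 j)" for j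
  have sim: "simple_ito a t (S j) (J j)" and sim0: "simple_ito a s (S0 j) (J0 j)" for j
    unfolding S_def J_def S0_def J0_def using step step0 by (auto intro: adapted_step_simple)
  have "\<exists>HL JL HR JR. simple_ito a s HL JL \<and> simple_ito s t HR JR \<and>
      (\<forall>\<omega>. J j \<omega> = JL \<omega> + JR \<omega>) \<and> (\<forall>r \<omega>. r < s \<longrightarrow> HL r \<omega> = S j r \<omega>) \<and> (\<forall>r \<omega>. s \<le> r \<longrightarrow> HR r \<omega> = S j r \<omega>)" for j
    unfolding S_def J_def by (rule adapted_step_split[OF step s, of j]) blast
  then obtain HL JL HR JR where simL: "\<And>j. simple_ito a s (HL j) (JL j)"
    and simR: "\<And>j. simple_ito s t (HR j) (JR j)" and J_eq: "\<And>j \<omega>. J j \<omega> = JL j \<omega> + JR j \<omega>"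
    and HL: "\<And>j r \<omega>. r < s \<Longrightarrow> HL j r \<omega> = S j r \<omega>"
    and HR: "\<And>j r \<omega>. s \<le> r \<Longrightarrow> HR j r \<omega> = S j r \<omega>"
    by metis
  have meas: "case_prod (\<lambda>r \<omega>. S j r \<omega> - K r \<omega>) \<in> borel_measurable (borel \<Otimes>\<^sub>M M)"
    "case_prod (\<lambda>r \<omega>. K r \<omega> - S0 j r \<omega>) \<in> borel_measurable (borel \<Otimes>\<^sub>M M)" for j
    using borel_measurable_diff[OF simple_ito_measurable[OF sim, of j] K(1)]
      borel_measurable_diff[OF K(1) simple_ito_measurable[OF sim0, of j]]
    by (simp_all only: split_beta')
  let ?e = "\<lambda>j. sq_int a t (\<lambda>r \<omega>. S j r \<omega> - K r \<omega>)"
  let ?d = "\<lambda>j. sq_int a s (\<lambda>r \<omega>. K r \<omega> - S0 j r \<omega>)"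
  \<comment> \<open>\<open>H\<close> is jointly measurable only over the closed time interval;
    \<open>K\<close> extends it to the whole line and leaves all distances on \<open>[a, t]\<close>
    unchanged.\<close>
  have e: "?e \<longlonglongrightarrow> 0"
  proof -
    have "?e j = sq_int a t (\<lambda>r \<omega>. S j r \<omega> - H r \<omega>)" for j
      by (intro antisym sq_int_mono) (auto simp: K(2))
    then show ?thesis using conv by (simp add: S_def)
  qed
  have e0: "?d \<longlonglongrightarrow> 0"
  proof -
    have "?d j = sq_int a s (\<lambda>r \<omega>. S0 j r \<omega> - H r \<omega>)" for j
      by (intro antisym sq_int_mono) (auto simp: K(2) norm_minus_commute)
    then show ?thesis using conv0 by (simp add: S0_def)
  qed
  have L: "(\<lambda>j. L2_norm M (\<lambda>\<omega>. JL j \<omega> - J0 j \<omega>)) \<longlonglongrightarrow> 0"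
  proof -
    have le: "ennreal ((L2_norm M (\<lambda>\<omega>. JL j \<omega> - J0 j \<omega>))\<^sup>2) \<le> 2 * ?e j + 2 * ?d j" for j
    proof -
      have "ennreal ((L2_norm M (\<lambda>\<omega>. JL j \<omega> - J0 j \<omega>))\<^sup>2) = sq_int a s (\<lambda>r \<omega>. HL j r \<omega> - S0 j r \<omega>)"
        by (rule simple_ito_sq_int[OF simple_ito_diff[OF simL sim0], symmetric])
      also have "\<dots> \<le> 2 * sq_int a s (\<lambda>r \<omega>. S j r \<omega> - K r \<omega>) + 2 * ?d j"
      proof (rule sq_int_le2)
        fix r \<omega> assume "a \<le> r" "r \<le> s"
        show "norm (HL j r \<omega> - S0 j r \<omega>) \<le> norm (S j r \<omega> - K r \<omega> + (K r \<omega> - S0 j r \<omega>))"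
          using HL[of r j \<omega>] simple_ito_support[OF simL, of r j \<omega>]
            simple_ito_support[OF sim0, of r j \<omega>] by (cases "r < s") auto
      qed (rule meas)+
      also have "\<dots> \<le> 2 * ?e j + 2 * ?d j"
        using s by (intro add_mono mult_left_mono sq_int_mono) auto
      finally show ?thesis .
    qed
    have "(\<lambda>j. 2 * ?e j + 2 * ?d j) \<longlonglongrightarrow> 2 * 0 + 2 * 0"
      by (intro tendsto_add ennreal_tendsto_cmult e e0) auto
    then have "(\<lambda>j. ennreal ((L2_norm M (\<lambda>\<omega>. JL j \<omega> - J0 j \<omega>))\<^sup>2)) \<longlonglongrightarrow> 0"
      by (intro tendsto_sandwich[OF always_eventually always_eventually[OF allI[OF le]] tendsto_const])
         simp_all
    then have "(\<lambda>j. (L2_norm M (\<lambda>\<omega>. JL j \<omega> - J0 j \<omega>))\<^sup>2) \<longlonglongrightarrow> 0"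
      by (subst (asm) tendsto_ennreal_iff[of _ _ 0, simplified]) auto
    from tendsto_real_sqrt[OF this] show ?thesis by simp
  qed
  have sq: "sq_integrable M (J j)" "sq_integrable M I1" "sq_integrable M (J0 j)" "sq_integrable M I0"
    "sq_integrable M (JL j)" for j
    using lim lim0 simple_ito_sq_integrable(2)[OF simL] by (auto simp: L2_limit_def J_def J0_def)
  have "(\<lambda>j. L2_norm M (\<lambda>\<omega>. JR j \<omega> - (I1 \<omega> - I0 \<omega>))) \<longlonglongrightarrow> 0"
  proof (rule tendsto_sandwich[OF _ _ tendsto_const])
    show "\<forall>\<^sub>F j in sequentially. L2_norm M (\<lambda>\<omega>. JR j \<omega> - (I1 \<omega> - I0 \<omega>)) \<le>
      L2_norm M (\<lambda>\<omega>. J j \<omega> - I1 \<omega>) + (L2_norm M (\<lambda>\<omega>. JL j \<omega> - J0 j \<omega>) + L2_norm M (\<lambda>\<omega>. J0 j \<omega> - I0 \<omega>))"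
    proof (rule always_eventually, rule allI)
      fix j
      have "L2_norm M (\<lambda>\<omega>. JR j \<omega> - (I1 \<omega> - I0 \<omega>)) =
        L2_norm M (\<lambda>\<omega>. (J j \<omega> - I1 \<omega>) + ((J0 j \<omega> - JL j \<omega>) + (I0 \<omega> - J0 j \<omega>)))"
        by (simp add: J_eq algebra_simps)
      also have "\<dots> \<le> L2_norm M (\<lambda>\<omega>. J j \<omega> - I1 \<omega>) +
          L2_norm M (\<lambda>\<omega>. (J0 j \<omega> - JL j \<omega>) + (I0 \<omega> - J0 j \<omega>))"
        by (intro L2_norm_triangle sq_integrable_diff sq_integrable_add sq)
      also have "L2_norm M (\<lambda>\<omega>. (J0 j \<omega> - JL j \<omega>) + (I0 \<omega> - J0 j \<omega>)) \<le>
          L2_norm M (\<lambda>\<omega>. JL j \<omega> - J0 j \<omega>) + L2_norm M (\<lambda>\<omega>. J0 j \<omega> - I0 \<omega>)"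
        unfolding L2_norm_minus_commute[of M "JL j"] L2_norm_minus_commute[of M "J0 j" I0]
        by (intro L2_norm_triangle sq_integrable_diff sq)
      finally show "L2_norm M (\<lambda>\<omega>. JR j \<omega> - (I1 \<omega> - I0 \<omega>)) \<le>
        L2_norm M (\<lambda>\<omega>. J j \<omega> - I1 \<omega>) + (L2_norm M (\<lambda>\<omega>. JL j \<omega> - J0 j \<omega>) + L2_norm M (\<lambda>\<omega>. J0 j \<omega> - I0 \<omega>))"
        by simp
    qed
    show "(\<lambda>j. L2_norm M (\<lambda>\<omega>. J j \<omega> - I1 \<omega>) + (L2_norm M (\<lambda>\<omega>. JL j \<omega> - J0 j \<omega>) +
        L2_norm M (\<lambda>\<omega>. J0 j \<omega> - I0 \<omega>))) \<longlonglongrightarrow> 0"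
      using lim lim0 L unfolding L2_limit_def J_def[symmetric] J0_def[symmetric]
      by (auto intro!: tendsto_add_zero)
  qed auto
  moreover have "(\<lambda>j. sq_int s t (\<lambda>r \<omega>. HR j r \<omega> - K r \<omega>)) \<longlonglongrightarrow> 0"
  proof (rule tendsto_sandwich[OF _ _ _ e])
    show "\<forall>\<^sub>F j in sequentially. sq_int s t (\<lambda>r \<omega>. HR j r \<omega> - K r \<omega>) \<le> ?e j"
      using s by (intro always_eventually allI sq_int_mono) (auto simp: HR)
  qed auto
  ultimately show ?thesis
    unfolding ito_on_def using simR sq by (blast intro: sq_integrable_diff)
qed

text \<open>Orthogonality holds for the simple approximations and passes to their L2 limit by
  Cauchy-Schwarz.\<close>

lemma ito_on_orth:
  assumes "ito_on a b H J" "Y \<in> borel_measurable (F a)" "sq_integrable M Y"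
  shows "expectation (\<lambda>\<omega>. Y \<omega> \<bullet> J \<omega>) = 0"
proof -
  from assms(1) obtain Hj Jj where J: "sq_integrable M J" and sim: "\<And>j. simple_ito a b (Hj j) (Jj j)"
    and lim: "(\<lambda>j::nat. L2_norm M (\<lambda>\<omega>. Jj j \<omega> - J \<omega>)) \<longlonglongrightarrow> 0"
    unfolding ito_on_def by blast
  have "\<bar>expectation (\<lambda>\<omega>. Y \<omega> \<bullet> J \<omega>)\<bar> \<le> L2_norm M Y * L2_norm M (\<lambda>\<omega>. Jj j \<omega> - J \<omega>)" for j
  proof -
    note sq = simple_ito_sq_integrable(2)[OF sim]
    have "expectation (\<lambda>\<omega>. Y \<omega> \<bullet> (Jj j \<omega> - J \<omega>)) = - expectation (\<lambda>\<omega>. Y \<omega> \<bullet> J \<omega>)"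
      using simple_ito_orth[OF sim assms(2,3), of j] sq J assms(3)
      by (simp add: inner_diff_right sq_integrable_inner)
    with L2_Cauchy_Schwarz[OF assms(3) sq_integrable_diff[OF sq J], of j] show ?thesis by simp
  qed
  moreover have "(\<lambda>j. L2_norm M Y * L2_norm M (\<lambda>\<omega>. Jj j \<omega> - J \<omega>)) \<longlonglongrightarrow> 0"
    using tendsto_mult_left[OF lim, of "L2_norm M Y"] by simp
  ultimately have "\<bar>expectation (\<lambda>\<omega>. Y \<omega> \<bullet> J \<omega>)\<bar> \<le> 0"
    by (intro LIMSEQ_le_const) auto
  then show ?thesis by simp
qed

text \<open>\<open>G \<omega> *v (W b \<omega> - W a \<omega>)\<close> is the integral of the simple
  integrand frozen at \<open>G\<close>, so the isometry applies to its difference from the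
  approximations. The factor 4 is the price of using the estimate of a squared sum twice, once for
  the integrals and once for the integrands; only the order in \<open>b - a\<close> matters
  later.\<close>

lemma ito_on_dist_le:
  assumes ito: "ito_on a b H J" and ab: "a \<le> b"
    and H: "case_prod H \<in> borel_measurable (borel \<Otimes>\<^sub>M M)"
    and G: "G \<in> borel_measurable (F a)" "sq_integrable M G"
  shows "ennreal (\<integral>\<omega>. (norm (J \<omega> - G \<omega> *v (W b \<omega> - W a \<omega>)))\<^sup>2 \<partial>M) \<le> 4 * sq_int a b (\<lambda>r \<omega>. H r \<omega> - G \<omega>)"
proof -
  from ito obtain Hj Jj where J: "sq_integrable M J" and sim: "\<And>j. simple_ito a b (Hj j) (Jj j)"
    and conv: "(\<lambda>j::nat. sq_int a b (\<lambda>r \<omega>. Hj j r \<omega> - H r \<omega>)) \<longlonglongrightarrow> 0"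
    and lim: "(\<lambda>j. L2_norm M (\<lambda>\<omega>. Jj j \<omega> - J \<omega>)) \<longlonglongrightarrow> 0"
    unfolding ito_on_def by blast
  define Z where "Z \<omega> = G \<omega> *v (W b \<omega> - W a \<omega>)" for \<omega>
  have simZ: "simple_ito a b (\<lambda>r \<omega>. indicator {a..<b} r *\<^sub>R G \<omega>) Z"
    unfolding Z_def by (rule simple_ito_elem) (use ab G in auto)
  note Z = simple_ito_sq_integrable(2)[OF simZ]
  have "case_prod (\<lambda>r. G) \<in> borel_measurable (borel \<Otimes>\<^sub>M M)"
    using measurable_compose[OF measurable_snd sq_integrable_measurable[OF G(2)]]
    by (simp add: split_beta')
  then have meas: "case_prod (\<lambda>r \<omega>. Hj j r \<omega> - H r \<omega>) \<in> borel_measurable (borel \<Otimes>\<^sub>M M)"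
    "case_prod (\<lambda>r \<omega>. H r \<omega> - G \<omega>) \<in> borel_measurable (borel \<Otimes>\<^sub>M M)" for j
    using borel_measurable_diff[OF simple_ito_measurable[OF sim, of j] H] borel_measurable_diff[OF H]
    by (simp_all only: split_beta')
  have le: "ennreal (\<integral>\<omega>. (norm (J \<omega> - Z \<omega>))\<^sup>2 \<partial>M) \<le> 4 * sq_int a b (\<lambda>r \<omega>. H r \<omega> - G \<omega>)
      + (4 * sq_int a b (\<lambda>r \<omega>. Hj j r \<omega> - H r \<omega>) + ennreal (2 * (L2_norm M (\<lambda>\<omega>. Jj j \<omega> - J \<omega>))\<^sup>2))" for j
  proof -
    note sq = simple_ito_sq_integrable(2)[OF sim, of j]
    have "(\<integral>\<omega>. (norm (J \<omega> - Z \<omega>))\<^sup>2 \<partial>M) = (\<integral>\<omega>. (norm ((Jj j \<omega> - Z \<omega>) + (J \<omega> - Jj j \<omega>)))\<^sup>2 \<partial>M)"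
      by simp
    also have "\<dots> \<le> 2 * (L2_norm M (\<lambda>\<omega>. Jj j \<omega> - Z \<omega>))\<^sup>2 + 2 * (L2_norm M (\<lambda>\<omega>. Jj j \<omega> - J \<omega>))\<^sup>2"
      unfolding L2_norm_minus_commute[of M "Jj j" J] unfolding L2_norm_sq
      by (intro integral_norm_add_sq_le2 sq_integrable_diff sq Z J)
    finally have "ennreal (\<integral>\<omega>. (norm (J \<omega> - Z \<omega>))\<^sup>2 \<partial>M) \<le>
        2 * ennreal ((L2_norm M (\<lambda>\<omega>. Jj j \<omega> - Z \<omega>))\<^sup>2) + ennreal (2 * (L2_norm M (\<lambda>\<omega>. Jj j \<omega> - J \<omega>))\<^sup>2)"
      by (subst (asm) ennreal_le_iff[symmetric]) (simp_all add: ennreal_mult)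
    also have "2 * ennreal ((L2_norm M (\<lambda>\<omega>. Jj j \<omega> - Z \<omega>))\<^sup>2) \<le>
        2 * (2 * sq_int a b (\<lambda>r \<omega>. Hj j r \<omega> - H r \<omega>) + 2 * sq_int a b (\<lambda>r \<omega>. H r \<omega> - G \<omega>))"
    proof (rule mult_left_mono)
      have "ennreal ((L2_norm M (\<lambda>\<omega>. Jj j \<omega> - Z \<omega>))\<^sup>2) =
          sq_int a b (\<lambda>r \<omega>. Hj j r \<omega> - indicator {a..<b} r *\<^sub>R G \<omega>)"
        by (rule simple_ito_sq_int[OF simple_ito_diff[OF sim simZ], symmetric])
      also have "\<dots> \<le> 2 * sq_int a b (\<lambda>r \<omega>. Hj j r \<omega> - H r \<omega>) + 2 * sq_int a b (\<lambda>r \<omega>. H r \<omega> - G \<omega>)"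
      proof (rule sq_int_le2)
        fix r \<omega> assume "a \<le> r" "r \<le> b"
        show "norm (Hj j r \<omega> - indicator {a..<b} r *\<^sub>R G \<omega>) \<le> norm (Hj j r \<omega> - H r \<omega> + (H r \<omega> - G \<omega>))"
          using \<open>a \<le> r\<close> simple_ito_support[OF sim, of r j \<omega>] by (cases "r < b") auto
      qed (rule meas)+
      finally show "ennreal ((L2_norm M (\<lambda>\<omega>. Jj j \<omega> - Z \<omega>))\<^sup>2) \<le>
        2 * sq_int a b (\<lambda>r \<omega>. Hj j r \<omega> - H r \<omega>) + 2 * sq_int a b (\<lambda>r \<omega>. H r \<omega> - G \<omega>)" .
    qed simp
    finally show ?thesis
      by (simp add: distrib_left mult.assoc[symmetric] ac_simps)
  qed
  have "(\<lambda>j. 4 * sq_int a b (\<lambda>r \<omega>. H r \<omega> - G \<omega>) + (4 * sq_int a b (\<lambda>r \<omega>. Hj j r \<omega> - H r \<omega>) +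
      ennreal (2 * (L2_norm M (\<lambda>\<omega>. Jj j \<omega> - J \<omega>))\<^sup>2))) \<longlonglongrightarrow>
      4 * sq_int a b (\<lambda>r \<omega>. H r \<omega> - G \<omega>) + (4 * 0 + ennreal (2 * 0\<^sup>2))"
    by (intro tendsto_add ennreal_tendsto_cmult tendsto_const conv tendsto_ennrealI tendsto_mult
        tendsto_power lim) auto
  then have "(\<lambda>j. 4 * sq_int a b (\<lambda>r \<omega>. H r \<omega> - G \<omega>) + (4 * sq_int a b (\<lambda>r \<omega>. Hj j r \<omega> - H r \<omega>) +
      ennreal (2 * (L2_norm M (\<lambda>\<omega>. Jj j \<omega> - J \<omega>))\<^sup>2))) \<longlonglongrightarrow> 4 * sq_int a b (\<lambda>r \<omega>. H r \<omega> - G \<omega>)"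
    by simp
  then show ?thesis
    unfolding Z_def[symmetric] using le by (intro LIMSEQ_le_const) auto
qed

end

subsection \<open>Increments of solutions\<close>

text \<open>Joint continuity is the source of measurability of the coefficients along a
  process.\<close>

lemma continuous_on_Holder_Lipschitz:
  fixes F :: "real \<Rightarrow> 'a::real_normed_vector \<Rightarrow> 'b::real_normed_vector"
  assumes "\<And>s t x y. norm (F s x - F t y) \<le> C * sqrt \<bar>s - t\<bar> + L * norm (x - y)"
  shows "continuous_on UNIV (\<lambda>p. F (fst p) (snd p))"
proof (rule continuous_at_imp_continuous_on, rule ballI)
  fix p :: "real \<times> 'a"
  have "((\<lambda>q. F (fst q) (snd q) - F (fst p) (snd p)) \<longlongrightarrow> 0) (at p)"
  proof (rule Lim_null_comparison)
    show "\<forall>\<^sub>F q in at p. norm (F (fst q) (snd q) - F (fst p) (snd p)) \<le>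
        C * sqrt \<bar>fst q - fst p\<bar> + L * norm (snd q - snd p)"
      using assms by (auto intro: always_eventually)
    have "((\<lambda>q. C * sqrt \<bar>fst q - fst p\<bar> + L * norm (snd q - snd p)) \<longlongrightarrow>
        C * sqrt \<bar>fst p - fst p\<bar> + L * norm (snd p - snd p)) (at p)"
      by (intro tendsto_intros)
    then show "((\<lambda>q. C * sqrt \<bar>fst q - fst p\<bar> + L * norm (snd q - snd p)) \<longlongrightarrow> 0) (at p)"
      by simp
  qed
  then show "isCont (\<lambda>p. F (fst p) (snd p)) p"
    by (simp add: isCont_def LIM_zero_iff)
qed

lemma norm_set_integral_sq_le:
  fixes u :: "real \<Rightarrow> 'b::euclidean_space"
  assumes [measurable]: "u \<in> borel_measurable borel" and st: "s \<le> t"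
  shows "ennreal ((norm (LINT r:{s..t}|lborel. u r))\<^sup>2)
    \<le> ennreal (t - s) * (\<integral>\<^sup>+r\<in>{s..t}. ennreal ((norm (u r))\<^sup>2) \<partial>lborel)"
proof (cases "set_integrable lborel {s..t} u")
  case True
  have "ennreal (norm (LINT r:{s..t}|lborel. u r)) \<le> (\<integral>\<^sup>+r. ennreal (norm (indicator {s..t} r *\<^sub>R u r)) \<partial>lborel)"
    using integral_norm_bound_ennreal[OF True[unfolded set_integrable_def]]
    by (simp add: set_lebesgue_integral_def)
  also have "\<dots> = (\<integral>\<^sup>+r. (ennreal (norm (u r)) * indicator {s..t} r) * indicator {s..t} r \<partial>lborel)"
    by (intro nn_integral_cong) (auto simp: indicator_def)
  finally have "(ennreal (norm (LINT r:{s..t}|lborel. u r)))\<^sup>2 \<le>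
      (\<integral>\<^sup>+r. (ennreal (norm (u r)) * indicator {s..t} r) * indicator {s..t} r \<partial>lborel)\<^sup>2"
    by (rule power_mono) simp
  also have "\<dots> \<le> (\<integral>\<^sup>+r. (ennreal (norm (u r)) * indicator {s..t} r)\<^sup>2 \<partial>lborel) *
      (\<integral>\<^sup>+r. (indicator {s..t} r)\<^sup>2 \<partial>lborel)"
    by (rule Cauchy_Schwarz_nn_integral) auto
  also have "(\<integral>\<^sup>+r. (ennreal (norm (u r)) * indicator {s..t} r)\<^sup>2 \<partial>lborel) =
      (\<integral>\<^sup>+r\<in>{s..t}. ennreal ((norm (u r))\<^sup>2) \<partial>lborel)"
    by (intro nn_integral_cong) (auto simp: indicator_def ennreal_power)
  also have "(\<integral>\<^sup>+r. (indicator {s..t} r :: ennreal)\<^sup>2 \<partial>lborel) = (\<integral>\<^sup>+r. indicator {s..t} r \<partial>lborel)"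
    by (intro nn_integral_cong) (auto simp: indicator_def)
  also have "\<dots> = ennreal (t - s)"
    using st by simp
  finally show ?thesis by (simp add: ennreal_power mult.commute)
next
  \<comment> \<open>The Bochner integral of a non-integrable function is 0, so the bound holds
    trivially.\<close>
  case False
  then have "(LINT r:{s..t}|lborel. u r) = 0"
    by (simp add: set_lebesgue_integral_def set_integrable_def not_integrable_integral_eq)
  then show ?thesis by simp
qed

lemma norm_add4_sq_le:
  fixes w x y z :: "'b::real_inner"
  shows "(norm (w + x + y + z))\<^sup>2 \<le> 4 * (norm w)\<^sup>2 + 4 * (norm x)\<^sup>2 + 4 * (norm y)\<^sup>2 + 4 * (norm z)\<^sup>2"
  using norm_add_sq_le2[of "w + x" "y + z"] norm_add_sq_le2[of w x] norm_add_sq_le2[of y z]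
  by (simp add: add.assoc)

lemma integral_norm_add4_sq_le:
  assumes "sq_integrable M w" "sq_integrable M x" "sq_integrable M y" "sq_integrable M z"
  shows "(\<integral>\<omega>. (norm (w \<omega> + x \<omega> + y \<omega> + z \<omega>))\<^sup>2 \<partial>M) \<le>
    4 * (\<integral>\<omega>. (norm (w \<omega>))\<^sup>2 \<partial>M) + 4 * (\<integral>\<omega>. (norm (x \<omega>))\<^sup>2 \<partial>M) +
    4 * (\<integral>\<omega>. (norm (y \<omega>))\<^sup>2 \<partial>M) + 4 * (\<integral>\<omega>. (norm (z \<omega>))\<^sup>2 \<partial>M)"
proof -
  have "(\<integral>\<omega>. (norm (w \<omega> + x \<omega> + y \<omega> + z \<omega>))\<^sup>2 \<partial>M) \<le>
    (\<integral>\<omega>. 4 * (norm (w \<omega>))\<^sup>2 + 4 * (norm (x \<omega>))\<^sup>2 + 4 * (norm (y \<omega>))\<^sup>2 + 4 * (norm (z \<omega>))\<^sup>2 \<partial>M)"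
    using assms
    by (intro integral_mono sq_integrable_norm2 sq_integrable_add norm_add4_sq_le)
       (auto simp: sq_integrable_def)
  also have "\<dots> = 4 * (\<integral>\<omega>. (norm (w \<omega>))\<^sup>2 \<partial>M) + 4 * (\<integral>\<omega>. (norm (x \<omega>))\<^sup>2 \<partial>M) +
    4 * (\<integral>\<omega>. (norm (y \<omega>))\<^sup>2 \<partial>M) + 4 * (\<integral>\<omega>. (norm (z \<omega>))\<^sup>2 \<partial>M)"
    using assms by (simp add: sq_integrable_def)
  finally show ?thesis .
qed

lemma (in prob_space) integral_norm_growth_le:
  fixes Y :: "'a \<Rightarrow> 'b::euclidean_space" and Z :: "'a \<Rightarrow> 'c::euclidean_space"
  assumes Y: "sq_integrable M Y" and Z: "Z \<in> borel_measurable M"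
    and le: "\<And>\<omega>. norm (Z \<omega>) \<le> c + l * norm (Y \<omega>)"
  shows "sq_integrable M Z"
    "(\<integral>\<omega>. (norm (Z \<omega>))\<^sup>2 \<partial>M) \<le> 2 * c\<^sup>2 + 2 * l\<^sup>2 * (\<integral>\<omega>. (norm (Y \<omega>))\<^sup>2 \<partial>M)"
proof -
  show sq: "sq_integrable M Z" by (rule sq_integrable_growth[OF Y Z le])
  have "(\<integral>\<omega>. (norm (Z \<omega>))\<^sup>2 \<partial>M) \<le> (\<integral>\<omega>. 2 * c\<^sup>2 + 2 * l\<^sup>2 * (norm (Y \<omega>))\<^sup>2 \<partial>M)"
  proof (rule integral_mono)
    fix \<omega>
    from power_mono[OF le, of \<omega> 2] sum_sq_le2[of c "l * norm (Y \<omega>)"]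
    show "(norm (Z \<omega>))\<^sup>2 \<le> 2 * c\<^sup>2 + 2 * l\<^sup>2 * (norm (Y \<omega>))\<^sup>2"
      by (simp add: power_mult_distrib)
  qed (use sq Y in \<open>auto simp: sq_integrable_def\<close>)
  also have "\<dots> = 2 * c\<^sup>2 + 2 * l\<^sup>2 * (\<integral>\<omega>. (norm (Y \<omega>))\<^sup>2 \<partial>M)"
    using Y by (simp add: sq_integrable_def prob_space)
  finally show "(\<integral>\<omega>. (norm (Z \<omega>))\<^sup>2 \<partial>M) \<le> 2 * c\<^sup>2 + 2 * l\<^sup>2 * (\<integral>\<omega>. (norm (Y \<omega>))\<^sup>2 \<partial>M)" .
qed

text \<open>By Tonelli, a bound on second moments at each fixed time becomes a bound in L2(dt x P),
  which is the form in which the remainders are estimated.\<close>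

lemma (in wiener) sq_int_le_sup:
  fixes H :: "real \<Rightarrow> 'w \<Rightarrow> 'b::euclidean_space"
  assumes H: "case_prod H \<in> borel_measurable (borel \<Otimes>\<^sub>M M)" and st: "s \<le> t" and B: "0 \<le> B"
    and sq: "\<And>r. s \<le> r \<Longrightarrow> r \<le> t \<Longrightarrow> sq_integrable M (H r)"
    and le: "\<And>r. s \<le> r \<Longrightarrow> r \<le> t \<Longrightarrow> (\<integral>\<omega>. (norm (H r \<omega>))\<^sup>2 \<partial>M) \<le> B"
  shows "sq_int s t H \<le> ennreal ((t - s) * B)"
proof -
  have "(\<lambda>x. ennreal ((norm (case_prod H x))\<^sup>2) * indicator {s..t} (fst x)) \<in> borel_measurable (borel \<Otimes>\<^sub>M M)"
    using H by (intro borel_measurable_times_ennreal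
        measurable_compose[OF measurable_fst borel_measurable_indicator]) auto
  then have "sq_int s t H = (\<integral>\<^sup>+r. (\<integral>\<^sup>+\<omega>. ennreal ((norm (H r \<omega>))\<^sup>2) * indicator {s..t} r \<partial>M) \<partial>lborel)"
    unfolding sq_int_def by (intro nn_integral_swap) (simp add: split_beta')
  also have "\<dots> \<le> (\<integral>\<^sup>+r. ennreal B * indicator {s..t} r \<partial>lborel)"
  proof (rule nn_integral_mono)
    fix r
    show "(\<integral>\<^sup>+\<omega>. ennreal ((norm (H r \<omega>))\<^sup>2) * indicator {s..t} r \<partial>M) \<le> ennreal B * indicator {s..t} r"
      using le[of r] by (auto simp: indicator_def sq_integrable_nn[OF sq] intro: ennreal_leI)
  qed
  also have "\<dots> = ennreal ((t - s) * B)"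
    using st B by (simp add: nn_integral_cmult_indicator ennreal_mult mult.commute)
  finally show ?thesis .
qed

text \<open>The matrix is part of the drift \<open>A *v x + f s x\<close>, and a single triple
  \<open>C\<close>, \<open>L\<close>, \<open>K\<close> serves drift and diffusion. All estimates
  local in time are made with these constants; dissipativity enters only in
  \<open>sde_mono\<close>.\<close>

locale sde = wiener M W for M :: "'w measure" and W :: "real \<Rightarrow> 'w \<Rightarrow> real ^ 'd" +
  fixes A :: "real ^ 'm ^ 'm" and f :: "real \<Rightarrow> real ^ 'm \<Rightarrow> real ^ 'm"
    and g :: "real \<Rightarrow> real ^ 'm \<Rightarrow> real ^ 'd ^ 'm" and C L K :: real
  assumes C: "C \<ge> 0" and L: "L \<ge> 0" and K: "K \<ge> 0"
    and drift_lip: "norm ((A *v x + f s x) - (A *v y + f t y)) \<le> C * sqrt \<bar>s - t\<bar> + L * norm (x - y)"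
    and g_lip: "norm (g s x - g t y) \<le> C * sqrt \<bar>s - t\<bar> + L * norm (x - y)"
    and drift_growth: "norm (A *v x + f s x) \<le> K + L * norm x"
    and g_growth: "norm (g s x) \<le> K + L * norm x"
begin

definition b :: "real \<Rightarrow> real ^ 'm \<Rightarrow> real ^ 'm" where "b s x = A *v x + f s x"

lemma b_lip: "norm (b s x - b t y) \<le> C * sqrt \<bar>s - t\<bar> + L * norm (x - y)"
  unfolding b_def by (rule drift_lip)

lemma b_growth: "norm (b s x) \<le> K + L * norm x"
  unfolding b_def by (rule drift_growth)

lemma b_measurable_pair: "(\<lambda>p. b (fst p) (snd p)) \<in> borel_measurable (borel \<Otimes>\<^sub>M borel)"
  unfolding borel_prod
  by (intro borel_measurable_continuous_onI continuous_on_Holder_Lipschitz[OF b_lip])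

lemma g_measurable_pair: "(\<lambda>p. g (fst p) (snd p)) \<in> borel_measurable (borel \<Otimes>\<^sub>M borel)"
  unfolding borel_prod
  by (intro borel_measurable_continuous_onI continuous_on_Holder_Lipschitz[OF g_lip])

lemma b_measurable: "b s \<in> borel_measurable borel"
proof -
  have "(\<lambda>x. (s, x)) \<in> measurable borel (borel \<Otimes>\<^sub>M borel)"
    by (rule measurable_Pair1') simp
  from measurable_compose[OF this b_measurable_pair] show ?thesis by simp
qed

lemma g_measurable: "g s \<in> borel_measurable borel"
proof -
  have "(\<lambda>x. (s, x)) \<in> measurable borel (borel \<Otimes>\<^sub>M borel)"
    by (rule measurable_Pair1') simp
  from measurable_compose[OF this g_measurable_pair] show ?thesis by simp
qed

lemma b_F:
  assumes "Y \<in> borel_measurable (F t)" "sq_integrable M Y"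
  shows "(\<lambda>\<omega>. b s (Y \<omega>)) \<in> borel_measurable (F t)" "sq_integrable M (\<lambda>\<omega>. b s (Y \<omega>))"
    "(\<integral>\<omega>. (norm (b s (Y \<omega>)))\<^sup>2 \<partial>M) \<le> 2 * K\<^sup>2 + 2 * L\<^sup>2 * (\<integral>\<omega>. (norm (Y \<omega>))\<^sup>2 \<partial>M)"
proof -
  note m = measurable_compose[OF sq_integrable_measurable[OF assms(2)] b_measurable, of s]
  show "(\<lambda>\<omega>. b s (Y \<omega>)) \<in> borel_measurable (F t)"
    by (rule measurable_compose[OF assms(1) b_measurable])
  show "sq_integrable M (\<lambda>\<omega>. b s (Y \<omega>))"
    by (rule integral_norm_growth_le(1)[OF assms(2) m b_growth])
  show "(\<integral>\<omega>. (norm (b s (Y \<omega>)))\<^sup>2 \<partial>M) \<le> 2 * K\<^sup>2 + 2 * L\<^sup>2 * (\<integral>\<omega>. (norm (Y \<omega>))\<^sup>2 \<partial>M)"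
    by (rule integral_norm_growth_le(2)[OF assms(2) m b_growth])
qed

lemma g_F:
  assumes "Y \<in> borel_measurable (F t)" "sq_integrable M Y"
  shows "(\<lambda>\<omega>. g s (Y \<omega>)) \<in> borel_measurable (F t)" "sq_integrable M (\<lambda>\<omega>. g s (Y \<omega>))"
    "(\<integral>\<omega>. (norm (g s (Y \<omega>)))\<^sup>2 \<partial>M) \<le> 2 * K\<^sup>2 + 2 * L\<^sup>2 * (\<integral>\<omega>. (norm (Y \<omega>))\<^sup>2 \<partial>M)"
proof -
  note m = measurable_compose[OF sq_integrable_measurable[OF assms(2)] g_measurable, of s]
  show "(\<lambda>\<omega>. g s (Y \<omega>)) \<in> borel_measurable (F t)"
    by (rule measurable_compose[OF assms(1) g_measurable])
  show "sq_integrable M (\<lambda>\<omega>. g s (Y \<omega>))"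
    by (rule integral_norm_growth_le(1)[OF assms(2) m g_growth])
  show "(\<integral>\<omega>. (norm (g s (Y \<omega>)))\<^sup>2 \<partial>M) \<le> 2 * K\<^sup>2 + 2 * L\<^sup>2 * (\<integral>\<omega>. (norm (Y \<omega>))\<^sup>2 \<partial>M)"
    by (rule integral_norm_growth_le(2)[OF assms(2) m g_growth])
qed

end

locale sde_sol = sde +
  fixes a :: real and \<xi> :: "'a \<Rightarrow> real ^ 'c" and X :: "real \<Rightarrow> 'a \<Rightarrow> real ^ 'c"
  assumes sol: "sde_solution M W A f g a \<xi> X" and xi: "sq_integrable M \<xi>"
begin

lemma X_F: "t \<ge> a \<Longrightarrow> X t \<in> borel_measurable (F t)"
  using sol by (simp add: sde_solution_def)

text \<open>
  The solution only lives on \<open>[a, \<infinity>)\<close>; freezing it to the left of \<open>a\<close> makes it jointly measurable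
  on the whole line.
\<close>

definition X' :: "real \<Rightarrow> 'a \<Rightarrow> real ^ 'c" where "X' r = X (max a r)"

lemma X'_eq: "a \<le> r \<Longrightarrow> X' r = X r" by (simp add: X'_def max_def)

lemma X'_measurable: "case_prod X' \<in> borel_measurable (borel \<Otimes>\<^sub>M M)"
proof -
  have "(\<lambda>p. max a (fst p)) \<in> borel_measurable (borel \<Otimes>\<^sub>M M)"
    by measurable
  then have "(\<lambda>p. max a (fst p)) \<in> measurable (borel \<Otimes>\<^sub>M M) (restrict_space borel {a..})"
    by (rule measurable_restrict_space2[rotated]) simp
  then have "(\<lambda>p. (max a (fst p), snd p)) \<in> measurable (borel \<Otimes>\<^sub>M M) (restrict_space borel {a..} \<Otimes>\<^sub>M M)"
    by (rule measurable_Pair) (rule measurable_snd)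
  moreover have "(\<lambda>(s, \<omega>). X s \<omega>) \<in> borel_measurable (restrict_space borel {a..} \<Otimes>\<^sub>M M)"
    using sol unfolding sde_solution_def by (elim conjE)
  ultimately have "(\<lambda>p. (\<lambda>(s, \<omega>). X s \<omega>) (max a (fst p), snd p)) \<in> borel_measurable (borel \<Otimes>\<^sub>M M)"
    by (rule measurable_compose)
  then show ?thesis
    by (simp only: split_beta' X'_def fst_conv snd_conv)
qed

lemma coeff_X'_measurable:
  "case_prod (\<lambda>r \<omega>. b r (X' r \<omega>)) \<in> borel_measurable (borel \<Otimes>\<^sub>M M)"
  "case_prod (\<lambda>r \<omega>. g r (X' r \<omega>)) \<in> borel_measurable (borel \<Otimes>\<^sub>M M)"
  using measurable_compose[OF measurable_Pair[OF measurable_fst X'_measurable] b_measurable_pair]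
    measurable_compose[OF measurable_Pair[OF measurable_fst X'_measurable] g_measurable_pair]
  by (simp_all only: split_beta' fst_conv snd_conv)

lemma path_measurable: "\<omega> \<in> space M \<Longrightarrow> (\<lambda>r. b r (X' r \<omega>)) \<in> borel_measurable borel"
  using measurable_compose[OF measurable_Pair2' coeff_X'_measurable(1)] by simp

lemma sq_int_X': "t \<ge> a \<Longrightarrow> sq_int a t X' < \<infinity>"
proof -
  assume "t \<ge> a"
  then have "sq_int a t X < \<infinity>"
    using sol by (simp add: sde_solution_def sq_int_def)
  then show ?thesis
    by (rule order_le_less_trans[rotated]) (auto intro!: sq_int_mono simp: X'_eq)
qed

text \<open>Needed to split the drift integral at an intermediate time. Finite second moments make
  almost every path square-integrable in time; linear growth together with n \<le> 1 + n^2 then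
  makes the drift integrable along it.\<close>

lemma AE_drift_integrable:
  assumes "t \<ge> a"
  shows "AE \<omega> in M. set_integrable lborel {a..t} (\<lambda>r. b r (X' r \<omega>))"
proof -
  have "AE \<omega> in M. (\<integral>\<^sup>+r\<in>{a..t}. ennreal ((norm (X' r \<omega>))\<^sup>2) \<partial>lborel) \<noteq> \<infinity>"
    using sq_int_X'[OF assms] unfolding sq_int_def
    by (intro nn_integral_noteq_infinite sq_int_measurable(1)[OF X'_measurable]) auto
  then show ?thesis
    using AE_space
  proof eventually_elim
    case (elim \<omega>)
    have m: "(\<lambda>r. ennreal ((norm (X' r \<omega>))\<^sup>2) * indicator {a..t} r) \<in> borel_measurable lborel"
      by (rule sq_int_measurable(2)[OF X'_measurable elim(2)])
    have "(\<integral>\<^sup>+r. ennreal (norm (indicator {a..t} r *\<^sub>R b r (X' r \<omega>))) \<partial>lborel) \<le>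
      (\<integral>\<^sup>+r. ennreal (K + L) * indicator {a..t} r + ennreal L * (ennreal ((norm (X' r \<omega>))\<^sup>2) * indicator {a..t} r) \<partial>lborel)"
    proof (rule nn_integral_mono)
      fix r
      have "norm (X' r \<omega>) \<le> 1 + (norm (X' r \<omega>))\<^sup>2"
        using sum_squares_bound[of 1 "norm (X' r \<omega>)"] norm_ge_zero[of "X' r \<omega>"]
        unfolding one_power2 mult_1_right by linarith
      then have "L * norm (X' r \<omega>) \<le> L * (1 + (norm (X' r \<omega>))\<^sup>2)"
        by (rule mult_left_mono[OF _ L])
      then have "norm (b r (X' r \<omega>)) \<le> (K + L) + L * (norm (X' r \<omega>))\<^sup>2"
        using b_growth[of r "X' r \<omega>"] by (simp add: distrib_left)
      then have "ennreal (norm (b r (X' r \<omega>))) \<le> ennreal ((K + L) + L * (norm (X' r \<omega>))\<^sup>2)"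
        by (rule ennreal_leI)
      also have "\<dots> = ennreal (K + L) + ennreal L * ennreal ((norm (X' r \<omega>))\<^sup>2)"
        using K L by (subst ennreal_plus) (simp_all add: ennreal_mult)
      finally show "ennreal (norm (indicator {a..t} r *\<^sub>R b r (X' r \<omega>))) \<le>
          ennreal (K + L) * indicator {a..t} r + ennreal L * (ennreal ((norm (X' r \<omega>))\<^sup>2) * indicator {a..t} r)"
        by (cases "r \<in> {a..t}") simp_all
    qed
    also have "\<dots> = ennreal (K + L) * ennreal (t - a) +
        ennreal L * (\<integral>\<^sup>+r\<in>{a..t}. ennreal ((norm (X' r \<omega>))\<^sup>2) \<partial>lborel)"
      using m assms
      by (subst nn_integral_add)
         (simp_all add: nn_integral_cmult nn_integral_cmult_indicator borel_measurable_times_ennreal)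
    also have "\<dots> < \<infinity>"
      using elim(1) by (simp add: ennreal_mult_less_top less_top)
    finally have fin: "(\<integral>\<^sup>+r. ennreal (norm (indicator {a..t} r *\<^sub>R b r (X' r \<omega>))) \<partial>lborel) < \<infinity>" .
    have "(\<lambda>r. indicator {a..t} r *\<^sub>R b r (X' r \<omega>)) \<in> borel_measurable lborel"
      using path_measurable[OF elim(2)]
      by (intro borel_measurable_scaleR borel_measurable_indicator) simp_all
    from integrableI_bounded[OF this fin] show ?case
      unfolding set_integrable_def .
  qed
qed

text \<open>The drift is replaced by \<open>Y\<close> and the diffusion by \<open>G\<close>, both
  left open: zero for both yields the crude moment bound, the coefficients at time \<open>s\<close>
  yield one Euler step. \<open>R\<close> is bounded by a nonnegative integral because the right-hand
  side may still be infinite.\<close>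

lemma increment_expansion:
  assumes st: "a \<le> s" "s \<le> t"
    and Y: "sq_integrable M Y" and G: "G \<in> borel_measurable (F s)" "sq_integrable M G"
  obtains R S where "R \<in> borel_measurable M" "sq_integrable M S"
    "\<And>\<omega>. X t \<omega> = X s \<omega> + (t - s) *\<^sub>R Y \<omega> + G \<omega> *v (W t \<omega> - W s \<omega>) + R \<omega> + S \<omega>"
    "(\<integral>\<^sup>+\<omega>. ennreal ((norm (R \<omega>))\<^sup>2) \<partial>M) \<le> ennreal (t - s) * sq_int s t (\<lambda>r \<omega>. b r (X' r \<omega>) - Y \<omega>)"
    "ennreal (\<integral>\<omega>. (norm (S \<omega>))\<^sup>2 \<partial>M) \<le> 4 * sq_int s t (\<lambda>r \<omega>. g r (X' r \<omega>) - G \<omega>)"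
    "\<And>Z. Z \<in> borel_measurable (F s) \<Longrightarrow> sq_integrable M Z \<Longrightarrow> expectation (\<lambda>\<omega>. Z \<omega> \<bullet> S \<omega>) = 0"
proof -
  from sol st obtain I0 I1
    where I0: "has_ito_integral M W a s (\<lambda>r \<omega>. g r (X r \<omega>)) I0"
      "AE \<omega> in M. X s \<omega> = \<xi> \<omega> + (LINT r:{a..s}|lborel. b r (X r \<omega>)) + I0 \<omega>"
    and I1: "has_ito_integral M W a t (\<lambda>r \<omega>. g r (X r \<omega>)) I1"
      "AE \<omega> in M. X t \<omega> = \<xi> \<omega> + (LINT r:{a..t}|lborel. b r (X r \<omega>)) + I1 \<omega>"
    unfolding sde_solution_def b_def by (meson order_trans)
  define J where "J \<omega> = I1 \<omega> - I0 \<omega>" for \<omega>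
  have ito: "ito_on s t (\<lambda>r \<omega>. g r (X' r \<omega>)) J"
    unfolding J_def
    by (rule has_ito_integral_diff[OF st I0(1) I1(1) coeff_X'_measurable(2)]) (simp add: X'_eq)
  then have J: "sq_integrable M J" by (simp add: ito_on_def)
  define S where "S \<omega> = J \<omega> - G \<omega> *v (W t \<omega> - W s \<omega>)" for \<omega>
  \<comment> \<open>Defining \<open>R\<close> as the defect makes the expansion hold at every
    \<open>\<omega>\<close>; that \<open>R\<close> is the integral of the drift minus
    \<open>Y\<close> holds only almost surely, which is enough for its moment.\<close>
  define R where "R \<omega> = X t \<omega> - X s \<omega> - (t - s) *\<^sub>R Y \<omega> - J \<omega>" for \<omega>
  have GD: "sq_integrable M (\<lambda>\<omega>. G \<omega> *v (W t \<omega> - W s \<omega>))"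
    by (rule sq_integrable_incr[OF st(2) G])
  show thesis
  proof
    show "R \<in> borel_measurable M"
      unfolding R_def using measurable_FD[OF X_F] st Y J by (auto simp: sq_integrable_def)
    show "sq_integrable M S"
      unfolding S_def by (intro sq_integrable_diff J GD)
    show "X t \<omega> = X s \<omega> + (t - s) *\<^sub>R Y \<omega> + G \<omega> *v (W t \<omega> - W s \<omega>) + R \<omega> + S \<omega>" for \<omega>
      by (simp add: R_def S_def)
    show "ennreal (\<integral>\<omega>. (norm (S \<omega>))\<^sup>2 \<partial>M) \<le> 4 * sq_int s t (\<lambda>r \<omega>. g r (X' r \<omega>) - G \<omega>)"
      unfolding S_def by (rule ito_on_dist_le[OF ito st(2) coeff_X'_measurable(2) G])
    show "expectation (\<lambda>\<omega>. Z \<omega> \<bullet> S \<omega>) = 0" if "Z \<in> borel_measurable (F s)" "sq_integrable M Z" for Z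
      unfolding S_def inner_diff_right
      using ito_on_orth[OF ito that] expectation_inner_incr[OF st(2) that G] J GD that
      by (simp add: sq_integrable_inner)
    have "AE \<omega> in M. R \<omega> = (LINT r:{s..t}|lborel. b r (X' r \<omega>) - Y \<omega>)"
      using AE_drift_integrable[OF order_trans[OF st]] I0(2) I1(2)
    proof eventually_elim
      case (elim \<omega>)
      have int: "set_integrable lborel {a..s} (\<lambda>r. b r (X' r \<omega>))" "set_integrable lborel {s..t} (\<lambda>r. b r (X' r \<omega>))"
        using st by (auto intro: set_integrable_subset[OF elim(1)])
      have eqs: "(LINT r:{a..u}|lborel. b r (X r \<omega>)) = (LINT r:{a..u}|lborel. b r (X' r \<omega>))" for u
        by (intro set_lebesgue_integral_cong) (auto simp: X'_eq)
      have "(LINT r:{a..t}|lborel. b r (X' r \<omega>)) = (LINT r:{a..s} \<union> {s..t}|lborel. b r (X' r \<omega>))"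
        using st by (simp add: ivl_disj_un_two_touch)
      also have "\<dots> = (LINT r:{a..s}|lborel. b r (X' r \<omega>)) + (LINT r:{s..t}|lborel. b r (X' r \<omega>))"
        using AE_lborel_singleton[of s] by (intro set_integral_Un_AE int) (auto elim: eventually_mono)
      finally have "R \<omega> = (LINT r:{s..t}|lborel. b r (X' r \<omega>)) - (t - s) *\<^sub>R Y \<omega>"
        using elim(2,3) by (simp add: R_def J_def eqs)
      also have "(t - s) *\<^sub>R Y \<omega> = (LINT r:{s..t}|lborel. Y \<omega>)"
        using st by (simp add: set_lebesgue_integral_def)
      also have "(LINT r:{s..t}|lborel. b r (X' r \<omega>)) - (LINT r:{s..t}|lborel. Y \<omega>) =
          (LINT r:{s..t}|lborel. b r (X' r \<omega>) - Y \<omega>)"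
      proof (intro set_integral_diff(2)[symmetric] int)
        show "set_integrable lborel {s..t} (\<lambda>r. Y \<omega>)"
          unfolding set_integrable_def
          by (intro integrable_scaleR_left integrable_real_indicator) (use st in auto)
      qed
      finally show ?case .
    qed
    then have "(\<integral>\<^sup>+\<omega>. ennreal ((norm (R \<omega>))\<^sup>2) \<partial>M) =
        (\<integral>\<^sup>+\<omega>. ennreal ((norm (LINT r:{s..t}|lborel. b r (X' r \<omega>) - Y \<omega>))\<^sup>2) \<partial>M)"
      by (intro nn_integral_cong_AE) auto
    also have "\<dots> \<le> (\<integral>\<^sup>+\<omega>. ennreal (t - s) * (\<integral>\<^sup>+r\<in>{s..t}. ennreal ((norm (b r (X' r \<omega>) - Y \<omega>))\<^sup>2) \<partial>lborel) \<partial>M)"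
      using path_measurable st
      by (intro nn_integral_mono norm_set_integral_sq_le borel_measurable_diff) auto
    also have "\<dots> = ennreal (t - s) * sq_int s t (\<lambda>r \<omega>. b r (X' r \<omega>) - Y \<omega>)"
    proof -
      have "case_prod (\<lambda>r \<omega>. b r (X' r \<omega>) - Y \<omega>) \<in> borel_measurable (borel \<Otimes>\<^sub>M M)"
        using borel_measurable_diff[OF coeff_X'_measurable(1)
            measurable_compose[OF measurable_snd sq_integrable_measurable[OF Y]]]
        by (simp add: split_beta')
      from sq_int_measurable(1)[OF this] show ?thesis
        unfolding sq_int_def by (rule nn_integral_cmult)
    qed
    finally show "(\<integral>\<^sup>+\<omega>. ennreal ((norm (R \<omega>))\<^sup>2) \<partial>M) \<le>
      ennreal (t - s) * sq_int s t (\<lambda>r \<omega>. b r (X' r \<omega>) - Y \<omega>)" .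
  qed
qed

end

section \<open>Mean square of one step\<close>

abbreviation (in prob_space) msq :: "('a \<Rightarrow> 'e::euclidean_space) \<Rightarrow> real" where
  "msq Y \<equiv> (\<integral>\<omega>. (norm (Y \<omega>))\<^sup>2 \<partial>M)"

text \<open>\<open>Y\<close> is orthogonal to the noise term and to \<open>S\<close>, so the only
  cross terms left are those of \<open>R\<close> with the main part and of \<open>S\<close> with the
  noise term. The former is split with weight \<open>\<epsilon> * h\<close>, which keeps the leading
  factor at \<open>1 + \<epsilon> * h\<close>; the latter can afford weight
  \<open>\<epsilon>\<close>, since the noise term already carries a factor \<open>h\<close>.\<close>

lemma (in wiener) one_step_quadratic:
  fixes Y R S :: "'w \<Rightarrow> real ^ 'm" and G :: "'w \<Rightarrow> real ^ 'd ^ 'm"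
  assumes h: "h > 0" and \<epsilon>: "\<epsilon> > 0"
    and Y: "Y \<in> borel_measurable (F s)" "sq_integrable M Y"
    and G: "G \<in> borel_measurable (F s)" "sq_integrable M G"
    and R: "sq_integrable M R" and S: "sq_integrable M S"
    and orth: "\<And>Z. Z \<in> borel_measurable (F s) \<Longrightarrow> sq_integrable M Z \<Longrightarrow> expectation (\<lambda>\<omega>. Z \<omega> \<bullet> S \<omega>) = 0"
  shows "(\<integral>\<omega>. (norm (Y \<omega> + G \<omega> *v (W (s + h) \<omega> - W s \<omega>) + R \<omega> + S \<omega>))\<^sup>2 \<partial>M) \<le>
    (1 + \<epsilon> * h) * (msq Y + h * msq G) +
    \<epsilon> * h * msq G +
    (1 / (\<epsilon> * h) + 2) * msq R + (1 / \<epsilon> + 2) * msq S"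
proof -
  define V where "V \<omega> = G \<omega> *v (W (s + h) \<omega> - W s \<omega>)" for \<omega>
  have ss: "s \<le> s + h" using h by simp
  have V: "sq_integrable M V"
    unfolding V_def by (rule sq_integrable_incr[OF ss G])
  have V2: "msq V = h * msq G"
    using inner_incr_incr(2)[OF ss G G] by (simp add: V_def power2_norm_eq_inner)
  have YV: "expectation (\<lambda>\<omega>. Y \<omega> \<bullet> V \<omega>) = 0"
    unfolding V_def by (rule expectation_inner_incr[OF ss Y G])
  define P where "P \<omega> = Y \<omega> + V \<omega>" for \<omega>
  have P: "sq_integrable M P" unfolding P_def by (intro sq_integrable_add Y V)
  have P2: "msq P = msq Y + h * msq G"
    unfolding P_def integral_norm_add_sq[OF Y(2) V] YV V2 by simp
  \<comment> \<open>\<open>S\<close> is orthogonal to what is known at time \<open>s\<close>, which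
    covers \<open>Y\<close> but not the noise \<open>V\<close> of the step itself.\<close>
  have PS: "expectation (\<lambda>\<omega>. P \<omega> \<bullet> S \<omega>) = expectation (\<lambda>\<omega>. V \<omega> \<bullet> S \<omega>)"
    using orth[OF Y] Y V S by (simp add: P_def inner_add_left sq_integrable_inner)
  have half: "2 * expectation (\<lambda>\<omega>. U \<omega> \<bullet> T \<omega>) \<le>
      d * msq U + msq T / d"
    if "d > 0" "sq_integrable M U" "sq_integrable M T" for d and U T :: "'w \<Rightarrow> real ^ 'm"
  proof -
    have "(\<integral>\<omega>. 2 * (U \<omega> \<bullet> T \<omega>) \<partial>M) \<le> (\<integral>\<omega>. d * (norm (U \<omega>))\<^sup>2 + (norm (T \<omega>))\<^sup>2 / d \<partial>M)"
      using that two_inner_le[OF that(1)]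
      by (intro integral_mono) (auto simp: sq_integrable_inner sq_integrable_norm2)
    then show ?thesis using that by (simp add: sq_integrable_norm2 sq_integrable_inner)
  qed
  have "msq (\<lambda>\<omega>. P \<omega> + (R \<omega> + S \<omega>)) =
      msq P + 2 * expectation (\<lambda>\<omega>. P \<omega> \<bullet> (R \<omega> + S \<omega>)) + msq (\<lambda>\<omega>. R \<omega> + S \<omega>)"
    by (rule integral_norm_add_sq[OF P sq_integrable_add[OF R S]])
  also have "expectation (\<lambda>\<omega>. P \<omega> \<bullet> (R \<omega> + S \<omega>)) = expectation (\<lambda>\<omega>. P \<omega> \<bullet> R \<omega>) + expectation (\<lambda>\<omega>. V \<omega> \<bullet> S \<omega>)"
    using PS P R S by (simp add: inner_add_right sq_integrable_inner)
  finally have "msq (\<lambda>\<omega>. P \<omega> + (R \<omega> + S \<omega>)) \<le>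
      msq P +
      (\<epsilon> * h * msq P + msq R / (\<epsilon> * h)) +
      (\<epsilon> * msq V + msq S / \<epsilon>) +
      (2 * msq R + 2 * msq S)"
    using half[of "\<epsilon> * h", OF _ P R] half[OF \<epsilon> V S] integral_norm_add_sq_le2[OF R S] h \<epsilon>
    by simp
  also have "\<dots> = (1 + \<epsilon> * h) * msq P + \<epsilon> * msq V +
    (1 / (\<epsilon> * h) + 2) * msq R + (1 / \<epsilon> + 2) * msq S"
    by (simp add: algebra_simps)
  finally show ?thesis
    unfolding P2 V2 by (simp add: P_def V_def add.assoc mult.assoc)
qed

lemma (in wiener) sq_int_scaleR:
  assumes "case_prod H \<in> borel_measurable (borel \<Otimes>\<^sub>M M)"
  shows "sq_int s t (\<lambda>r \<omega>. c *\<^sub>R H r \<omega>) = ennreal (c\<^sup>2) * sq_int s t H"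
proof -
  have "sq_int s t (\<lambda>r \<omega>. c *\<^sub>R H r \<omega>) =
      (\<integral>\<^sup>+\<omega>. (\<integral>\<^sup>+r. ennreal (c\<^sup>2) * (ennreal ((norm (H r \<omega>))\<^sup>2) * indicator {s..t} r) \<partial>lborel) \<partial>M)"
    unfolding sq_int_def
    by (intro nn_integral_cong) (simp add: power_mult_distrib ennreal_mult mult.assoc)
  also have "\<dots> = (\<integral>\<^sup>+\<omega>. ennreal (c\<^sup>2) * (\<integral>\<^sup>+r\<in>{s..t}. ennreal ((norm (H r \<omega>))\<^sup>2) \<partial>lborel) \<partial>M)"
    by (intro nn_integral_cong nn_integral_cmult sq_int_measurable(2)[OF assms])
  also have "\<dots> = ennreal (c\<^sup>2) * sq_int s t H"
    unfolding sq_int_def by (rule nn_integral_cmult[OF sq_int_measurable(1)[OF assms]])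
  finally show ?thesis .
qed

context sde
begin

text \<open>The constant of \<open>local_moment\<close>: a factor 8 in front of a bracket that is at
  most \<open>10 * (K\<^sup>2 + L\<^sup>2 + C\<^sup>2)\<close> times one plus the second
  moment.\<close>

definition cloc :: real where "cloc = 80 * (K\<^sup>2 + L\<^sup>2 + C\<^sup>2)"

text \<open>The bound on \<open>S\<close> in \<open>increment_expansion_bounded\<close> after
  inserting the local increment bound, which is \<open>cloc * h\<close> times one plus the second
  moment.\<close>

definition cstep :: real where "cstep = 8 * (C\<^sup>2 + L\<^sup>2 * cloc)"

lemma cloc_nonneg: "cloc \<ge> 0" and cstep_nonneg: "cstep \<ge> 0"
  by (simp_all add: cloc_def cstep_def)

end

section \<open>Second moments and local increments of the solution\<close>

context sde_sol
begin

lemma X_initial: "sq_integrable M (X a)" "msq (X a) = msq \<xi>"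
proof -
  have AE: "AE \<omega> in M. \<xi> \<omega> = X a \<omega>"
    using sol by (auto simp: sde_solution_def)
  have m: "X a \<in> borel_measurable M" "\<xi> \<in> borel_measurable M"
    using measurable_FD[OF X_F] xi by (auto simp: sq_integrable_def)
  show "sq_integrable M (X a)"
    by (rule sq_integrable_cong_AE[OF xi m(1) AE])
  show "msq (X a) = msq \<xi>"
    using AE m by (intro integral_cong_AE) auto
qed

lemma sq_int_coeff_finite:
  fixes u :: "real \<Rightarrow> real ^ 'c \<Rightarrow> 'e::euclidean_space"
  assumes "T \<ge> a" "\<And>s x. norm (u s x) \<le> K + L * norm x"
  shows "sq_int a T (\<lambda>r \<omega>. u r (X' r \<omega>)) < \<infinity>"
proof -
  have m: "case_prod (\<lambda>r \<omega>. norm (X' r \<omega>)) \<in> borel_measurable (borel \<Otimes>\<^sub>M M)"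
    using measurable_compose[OF X'_measurable borel_measurable_norm] by (simp only: split_beta')
  have m': "case_prod (\<lambda>r \<omega>. L *\<^sub>R norm (X' r \<omega>)) \<in> borel_measurable (borel \<Otimes>\<^sub>M M)"
    using borel_measurable_scaleR[OF borel_measurable_const m, of L] by (simp only: split_beta')
  have "sq_int a T (\<lambda>r \<omega>. u r (X' r \<omega>)) \<le>
      2 * sq_int a T (\<lambda>r \<omega>. K) + 2 * sq_int a T (\<lambda>r \<omega>. L *\<^sub>R norm (X' r \<omega>))"
    using assms(2) K L by (intro sq_int_le2[OF _ m']) (simp_all add: split_beta')
  also have "sq_int a T (\<lambda>r \<omega>. L *\<^sub>R norm (X' r \<omega>)) = ennreal (L\<^sup>2) * sq_int a T (\<lambda>r \<omega>. norm (X' r \<omega>))"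
    by (rule sq_int_scaleR[OF m])
  also have "sq_int a T (\<lambda>r \<omega>. norm (X' r \<omega>)) = sq_int a T X'"
    by (simp add: sq_int_def)
  also have "sq_int a T (\<lambda>r \<omega>. K) \<le> ennreal ((T - a) * K\<^sup>2)"
    using assms(1) by (intro sq_int_le_sup) (simp_all add: split_beta' sq_integrable_def prob_space)
  finally have "sq_int a T (\<lambda>r \<omega>. u r (X' r \<omega>)) \<le>
      2 * ennreal ((T - a) * K\<^sup>2) + 2 * (ennreal (L\<^sup>2) * sq_int a T X')"
    by (simp add: add_right_mono mult_left_mono)
  also have "\<dots> < \<infinity>"
    using sq_int_X'[OF assms(1)] by (simp add: ennreal_mult_less_top)
  finally show ?thesis .
qed

text \<open>A qualitative statement whose bound depends on \<open>T\<close>: it turns moments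
  integrated over time into moments at each time, and makes the supremum in
  \<open>local_moment\<close> finite. Expanding from \<open>a\<close> with zero \<open>Y\<close> and
  \<open>G\<close>, the remainders are the full drift and noise integrals.\<close>

lemma moment_locally_bounded:
  assumes T: "T \<ge> a"
  shows "\<exists>B\<ge>0. \<forall>t. a \<le> t \<and> t \<le> T \<longrightarrow> sq_integrable M (X t) \<and> msq (X t) \<le> B"
proof -
  obtain cb where cb: "sq_int a T (\<lambda>r \<omega>. b r (X' r \<omega>)) = ennreal cb" "cb \<ge> 0"
    using sq_int_coeff_finite[OF T, of b, OF b_growth] by (cases "sq_int a T (\<lambda>r \<omega>. b r (X' r \<omega>))") auto
  obtain cg where cg: "sq_int a T (\<lambda>r \<omega>. g r (X' r \<omega>)) = ennreal cg" "cg \<ge> 0"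
    using sq_int_coeff_finite[OF T, of g, OF g_growth] by (cases "sq_int a T (\<lambda>r \<omega>. g r (X' r \<omega>))") auto
  show ?thesis
  proof (intro exI conjI allI impI)
    show "0 \<le> 4 * msq \<xi> + 4 * ((T - a) * cb) + 4 * (4 * cg)"
      using T cb cg by (intro add_nonneg_nonneg mult_nonneg_nonneg) auto
    fix t assume "a \<le> t \<and> t \<le> T"
    then have t: "a \<le> t" "t \<le> T" by auto
    have zero: "sq_integrable M (\<lambda>\<omega>. 0 :: real ^ 'c)" "(\<lambda>\<omega>. 0 :: real ^ 'b ^ 'c) \<in> borel_measurable (F a)"
      "sq_integrable M (\<lambda>\<omega>. 0 :: real ^ 'b ^ 'c)" by auto
    obtain R S where RS: "R \<in> borel_measurable M" "sq_integrable M S"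
      "\<And>\<omega>. X t \<omega> = X a \<omega> + (t - a) *\<^sub>R 0 + 0 *v (W t \<omega> - W a \<omega>) + R \<omega> + S \<omega>"
      "(\<integral>\<^sup>+\<omega>. ennreal ((norm (R \<omega>))\<^sup>2) \<partial>M) \<le> ennreal (t - a) * sq_int a t (\<lambda>r \<omega>. b r (X' r \<omega>) - 0)"
      "ennreal (msq S) \<le> 4 * sq_int a t (\<lambda>r \<omega>. g r (X' r \<omega>) - 0)"
      by (rule increment_expansion[OF order.refl t(1) zero]) blast
    have "ennreal (t - a) * sq_int a t (\<lambda>r \<omega>. b r (X' r \<omega>) - 0) \<le> ennreal (T - a) * ennreal cb"
      unfolding cb(1)[symmetric] using t by (intro mult_mono sq_int_mono ennreal_leI) auto
    also have "\<dots> = ennreal ((T - a) * cb)" using T cb by (simp add: ennreal_mult)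
    finally have "(\<integral>\<^sup>+\<omega>. ennreal ((norm (R \<omega>))\<^sup>2) \<partial>M) \<le> ennreal ((T - a) * cb)"
      using RS(4) by (rule order_trans[rotated])
    note R = sq_integrable_nn_bound[OF RS(1) this mult_nonneg_nonneg]
    have "4 * sq_int a t (\<lambda>r \<omega>. g r (X' r \<omega>) - 0) \<le> 4 * ennreal cg"
      unfolding cg(1)[symmetric] using t by (intro mult_left_mono sq_int_mono) auto
    with RS(5) have "ennreal (msq S) \<le> ennreal (4 * cg)"
      using cg by (simp add: ennreal_mult)
    then have S: "msq S \<le> 4 * cg" using cg by simp
    have X: "X t = (\<lambda>\<omega>. X a \<omega> + 0 + R \<omega> + S \<omega>)"
      by (rule ext) (simp add: RS(3))
    have R': "sq_integrable M R" "msq R \<le> (T - a) * cb" using R T cb by auto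
    show "sq_integrable M (X t)"
      unfolding X by (intro sq_integrable_add X_initial R' RS) simp
    have "msq (X t) \<le> 4 * msq (X a) + 4 * msq (\<lambda>\<omega>. 0 :: real ^ 'c) + 4 * msq R + 4 * msq S"
      unfolding X by (intro integral_norm_add4_sq_le X_initial R' RS) simp
    also have "\<dots> \<le> 4 * msq \<xi> + 4 * ((T - a) * cb) + 4 * (4 * cg)"
      using X_initial(2) R'(2) S by simp
    finally show "msq (X t) \<le> 4 * msq \<xi> + 4 * ((T - a) * cb) + 4 * (4 * cg)" .
  qed
qed

lemma X_sq_integrable: "t \<ge> a \<Longrightarrow> sq_integrable M (X t)"
  using moment_locally_bounded[of t] by auto

text \<open>Stated for a coefficient \<open>u\<close> to serve drift and diffusion alike. The square
  root in time contributes order \<open>t - s\<close> to the mean square, the same order as the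
  increments of \<open>X\<close>.\<close>

lemma coeff_increment:
  fixes u :: "real \<Rightarrow> real ^ 'c \<Rightarrow> 'e::euclidean_space"
  assumes u: "\<And>r s x y. norm (u r x - u s y) \<le> C * sqrt \<bar>r - s\<bar> + L * norm (x - y)"
    and um: "case_prod (\<lambda>r \<omega>. u r (X' r \<omega>)) \<in> borel_measurable (borel \<Otimes>\<^sub>M M)"
      "\<And>r. u r \<in> borel_measurable borel"
    and st: "a \<le> s" "s \<le> t" and B: "B \<ge> 0"
    and le: "\<And>r. s \<le> r \<Longrightarrow> r \<le> t \<Longrightarrow> msq (\<lambda>\<omega>. X r \<omega> - X s \<omega>) \<le> B"
  shows "sq_int s t (\<lambda>r \<omega>. u r (X' r \<omega>) - u s (X s \<omega>)) \<le> ennreal ((t - s) * (2 * C\<^sup>2 * (t - s) + 2 * L\<^sup>2 * B))"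
proof (rule sq_int_le_sup[OF _ st(2)])
  have ms: "(\<lambda>\<omega>. u r (X r' \<omega>)) \<in> borel_measurable M" if "r' \<ge> a" for r r'
    using measurable_compose[OF sq_integrable_measurable[OF X_sq_integrable[OF that]] um(2)] .
  show "case_prod (\<lambda>r \<omega>. u r (X' r \<omega>) - u s (X s \<omega>)) \<in> borel_measurable (borel \<Otimes>\<^sub>M M)"
    using borel_measurable_diff[OF um(1) measurable_compose[OF measurable_snd ms[OF st(1), of s]]]
    by (simp only: split_beta')
  show "0 \<le> 2 * C\<^sup>2 * (t - s) + 2 * L\<^sup>2 * B" using st B by simp
  fix r assume r: "s \<le> r" "r \<le> t"
  then have ar: "a \<le> r" using st by simp
  have D: "sq_integrable M (\<lambda>\<omega>. X r \<omega> - X s \<omega>)"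
    using X_sq_integrable ar st by (intro sq_integrable_diff) auto
  have m: "(\<lambda>\<omega>. u r (X' r \<omega>) - u s (X s \<omega>)) \<in> borel_measurable M"
    unfolding X'_eq[OF ar] by (intro borel_measurable_diff ms ar st)
  have n: "norm (u r (X' r \<omega>) - u s (X s \<omega>)) \<le> C * sqrt \<bar>r - s\<bar> + L * norm (X r \<omega> - X s \<omega>)" for \<omega>
    unfolding X'_eq[OF ar] by (rule u)
  show "sq_integrable M (\<lambda>\<omega>. u r (X' r \<omega>) - u s (X s \<omega>))"
    by (rule integral_norm_growth_le(1)[OF D m n])
  have "msq (\<lambda>\<omega>. u r (X' r \<omega>) - u s (X s \<omega>)) \<le>
      2 * (C * sqrt \<bar>r - s\<bar>)\<^sup>2 + 2 * L\<^sup>2 * msq (\<lambda>\<omega>. X r \<omega> - X s \<omega>)"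
    by (rule integral_norm_growth_le(2)[OF D m n])
  also have "\<dots> \<le> 2 * C\<^sup>2 * (t - s) + 2 * L\<^sup>2 * B"
    using r le[OF r] by (intro add_mono mult_left_mono) (simp_all add: power_mult_distrib mult_left_mono)
  finally show "msq (\<lambda>\<omega>. u r (X' r \<omega>) - u s (X s \<omega>)) \<le> 2 * C\<^sup>2 * (t - s) + 2 * L\<^sup>2 * B" .
qed

text \<open>\<open>B\<close> stays a parameter since it is used twice: with the unknown supremum of
  the increments in \<open>local_moment\<close>, and with the explicit bound obtained there in
  \<open>step_expansion\<close>.\<close>

lemma increment_expansion_bounded:
  assumes st: "a \<le> s" "s \<le> t" and B: "B \<ge> 0"
    and le: "\<And>r. s \<le> r \<Longrightarrow> r \<le> t \<Longrightarrow> msq (\<lambda>\<omega>. X r \<omega> - X s \<omega>) \<le> B"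
  obtains R S where "sq_integrable M R" "sq_integrable M S"
    "\<And>\<omega>. X t \<omega> = X s \<omega> + (t - s) *\<^sub>R b s (X s \<omega>) + g s (X s \<omega>) *v (W t \<omega> - W s \<omega>) + R \<omega> + S \<omega>"
    "msq R \<le> 2 * (t - s)\<^sup>2 * (C\<^sup>2 * (t - s) + L\<^sup>2 * B)"
    "msq S \<le> 8 * (t - s) * (C\<^sup>2 * (t - s) + L\<^sup>2 * B)"
    "\<And>Z. Z \<in> borel_measurable (F s) \<Longrightarrow> sq_integrable M Z \<Longrightarrow> expectation (\<lambda>\<omega>. Z \<omega> \<bullet> S \<omega>) = 0"
proof -
  note Xs = X_F[OF st(1)] X_sq_integrable[OF st(1)]
  obtain R S where RS: "R \<in> borel_measurable M" "sq_integrable M S"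
    "\<And>\<omega>. X t \<omega> = X s \<omega> + (t - s) *\<^sub>R b s (X s \<omega>) + g s (X s \<omega>) *v (W t \<omega> - W s \<omega>) + R \<omega> + S \<omega>"
    "(\<integral>\<^sup>+\<omega>. ennreal ((norm (R \<omega>))\<^sup>2) \<partial>M) \<le> ennreal (t - s) * sq_int s t (\<lambda>r \<omega>. b r (X' r \<omega>) - b s (X s \<omega>))"
    "ennreal (msq S) \<le> 4 * sq_int s t (\<lambda>r \<omega>. g r (X' r \<omega>) - g s (X s \<omega>))"
    "\<And>Z. Z \<in> borel_measurable (F s) \<Longrightarrow> sq_integrable M Z \<Longrightarrow> expectation (\<lambda>\<omega>. Z \<omega> \<bullet> S \<omega>) = 0"
    by (rule increment_expansion[OF st b_F(2)[OF Xs] g_F(1,2)[OF Xs]]) blast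
  let ?c = "(t - s) * (2 * C\<^sup>2 * (t - s) + 2 * L\<^sup>2 * B)"
  have c: "0 \<le> ?c" using st B by simp
  have "(\<integral>\<^sup>+\<omega>. ennreal ((norm (R \<omega>))\<^sup>2) \<partial>M) \<le> ennreal (t - s) * ennreal ?c"
    using coeff_increment[OF b_lip coeff_X'_measurable(1) b_measurable st B le]
    by (intro order_trans[OF RS(4)] mult_left_mono) auto
  also have "\<dots> = ennreal ((t - s) * ?c)"
    using st c by (simp add: ennreal_mult)
  finally have "(\<integral>\<^sup>+\<omega>. ennreal ((norm (R \<omega>))\<^sup>2) \<partial>M) \<le> ennreal ((t - s) * ?c)" .
  note R = sq_integrable_nn_bound[OF RS(1) this]
  have "ennreal (msq S) \<le> 4 * ennreal ?c"
    using coeff_increment[OF g_lip coeff_X'_measurable(2) g_measurable st B le]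
    by (intro order_trans[OF RS(5)] mult_left_mono) auto
  also have "\<dots> = ennreal (4 * ?c)"
    using c by (simp add: ennreal_mult)
  finally have S: "msq S \<le> 4 * ?c" using c by (subst (asm) ennreal_le_iff) simp_all
  have "0 \<le> (t - s) * ?c" using st c by simp
  with R have "sq_integrable M R" "msq R \<le> (t - s) * ?c" by auto
  then show thesis
    using S RS by (intro that[of R S]) (simp_all add: power2_eq_square algebra_simps)
qed

text \<open>
  The supremum \<open>B\<close> of the left-hand side over one step bounds the remainders in
  \<open>increment_expansion_bounded\<close>, which gives \<open>B \<le> c h + B / 2\<close> for small \<open>h\<close>.
\<close>

lemma local_moment:
  assumes s: "a \<le> s" and h: "0 < h" "h \<le> 1" "80 * h * L\<^sup>2 \<le> 1" and t: "s \<le> t" "t \<le> s + h"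
  shows "msq (\<lambda>\<omega>. X t \<omega> - X s \<omega>) \<le> cloc * h * (1 + msq (X s))"
proof -
  let ?m = "msq (X s)"
  let ?v = "\<lambda>t. msq (\<lambda>\<omega>. X t \<omega> - X s \<omega>)"
  note Xs = X_F[OF s] X_sq_integrable[OF s]
  define B where "B = (SUP t\<in>{s..s+h}. ?v t)"
  obtain B0 where B0: "\<And>t. a \<le> t \<Longrightarrow> t \<le> s + h \<Longrightarrow> msq (X t) \<le> B0"
    using moment_locally_bounded[of "s + h"] s h by auto
  \<comment> \<open>Finiteness of the supremum is what later permits subtracting
    \<open>B / 2\<close> from both sides.\<close>
  have bdd: "bdd_above (?v ` {s..s+h})"
  proof (rule bdd_aboveI2)
    fix t assume t: "t \<in> {s..s+h}"
    then have "?v t \<le> 2 * msq (X t) + 2 * msq (\<lambda>\<omega>. - X s \<omega>)"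
      using integral_norm_add_sq_le2[of M "X t" "\<lambda>\<omega>. - X s \<omega>"] X_sq_integrable s
      by (simp add: sq_integrable_minus)
    also have "\<dots> \<le> 4 * B0" using B0[of t] B0[of s] t s h by simp
    finally show "?v t \<le> 4 * B0" .
  qed
  have le_B: "?v t \<le> B" if "s \<le> t" "t \<le> s + h" for t
    unfolding B_def using that by (intro cSUP_upper bdd) auto
  have B: "B \<ge> 0" using le_B[of s] h by simp
  let ?c = "4 * h * (4 * K\<^sup>2 + 4 * L\<^sup>2 * ?m + 10 * C\<^sup>2)"
  have "?v t \<le> ?c + B / 2" if t: "s \<le> t" "t \<le> s + h" for t
  proof -
    have le: "?v r \<le> B" if "s \<le> r" "r \<le> t" for r
      using le_B[of r] that t by simp
    obtain R S where RS: "sq_integrable M R" "sq_integrable M S"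
      "\<And>\<omega>. X t \<omega> = X s \<omega> + (t - s) *\<^sub>R b s (X s \<omega>) + g s (X s \<omega>) *v (W t \<omega> - W s \<omega>) + R \<omega> + S \<omega>"
      "msq R \<le> 2 * (t - s)\<^sup>2 * (C\<^sup>2 * (t - s) + L\<^sup>2 * B)"
      "msq S \<le> 8 * (t - s) * (C\<^sup>2 * (t - s) + L\<^sup>2 * B)"
      "\<And>Z. Z \<in> borel_measurable (F s) \<Longrightarrow> sq_integrable M Z \<Longrightarrow> expectation (\<lambda>\<omega>. Z \<omega> \<bullet> S \<omega>) = 0"
      by (rule increment_expansion_bounded[OF s t(1) B le], assumption, assumption, rule that)
    let ?Y = "\<lambda>\<omega>. (t - s) *\<^sub>R b s (X s \<omega>)" and ?V = "\<lambda>\<omega>. g s (X s \<omega>) *v (W t \<omega> - W s \<omega>)"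
    have V2: "msq ?V = (t - s) * msq (\<lambda>\<omega>. g s (X s \<omega>))"
      using inner_incr_incr(2)[OF t(1) g_F(1,2)[OF Xs] g_F(1,2)[OF Xs]] by (simp add: power2_norm_eq_inner)
    have Y2: "msq ?Y = (t - s)\<^sup>2 * msq (\<lambda>\<omega>. b s (X s \<omega>))"
      by (simp add: power_mult_distrib)
    have d: "0 \<le> t - s" "t - s \<le> h" "(t - s)\<^sup>2 \<le> h" "t - s \<le> 1"
      using t h power2_le_iff_abs_le[of 1 "t - s"] mult_mono[of "t - s" h "t - s" 1]
      by (auto simp: power2_eq_square)
    have "?v t = msq (\<lambda>\<omega>. ?Y \<omega> + ?V \<omega> + R \<omega> + S \<omega>)"
      by (simp add: RS(3) add.assoc)
    also have "\<dots> \<le> 4 * msq ?Y + 4 * msq ?V + 4 * msq R + 4 * msq S"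
      by (intro integral_norm_add4_sq_le sq_integrable_scaleR sq_integrable_incr[OF t(1)] RS b_F(2)[OF Xs] g_F(1,2)[OF Xs])
    also have "\<dots> \<le> 4 * (h * (2 * K\<^sup>2 + 2 * L\<^sup>2 * ?m)) + 4 * (h * (2 * K\<^sup>2 + 2 * L\<^sup>2 * ?m)) +
        4 * (2 * h * (C\<^sup>2 * 1 + L\<^sup>2 * B)) + 4 * (8 * h * (C\<^sup>2 * 1 + L\<^sup>2 * B))"
      unfolding Y2 V2
    proof (intro add_mono mult_left_mono)
      show "(t - s)\<^sup>2 * msq (\<lambda>\<omega>. b s (X s \<omega>)) \<le> h * (2 * K\<^sup>2 + 2 * L\<^sup>2 * ?m)"
        using d h by (intro mult_mono b_F(3)[OF Xs]) auto
      show "(t - s) * msq (\<lambda>\<omega>. g s (X s \<omega>)) \<le> h * (2 * K\<^sup>2 + 2 * L\<^sup>2 * ?m)"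
        using d h by (intro mult_mono g_F(3)[OF Xs]) auto
      have "2 * (t - s)\<^sup>2 * (C\<^sup>2 * (t - s) + L\<^sup>2 * B) \<le> 2 * h * (C\<^sup>2 * 1 + L\<^sup>2 * B)"
        using d h B by (intro mult_mono add_mono) auto
      with RS(4) show "msq R \<le> 2 * h * (C\<^sup>2 * 1 + L\<^sup>2 * B)" by simp
      have "8 * (t - s) * (C\<^sup>2 * (t - s) + L\<^sup>2 * B) \<le> 8 * h * (C\<^sup>2 * 1 + L\<^sup>2 * B)"
        using d h B by (intro mult_mono add_mono) auto
      with RS(5) show "msq S \<le> 8 * h * (C\<^sup>2 * 1 + L\<^sup>2 * B)" by simp
    qed auto
    \<comment> \<open>\<open>B\<close> occurs with coefficient \<open>40 * h * L\<^sup>2\<close>, 8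
      from \<open>R\<close> and 32 from \<open>S\<close>; the step restriction makes this at most
      one half.\<close>
    also have "\<dots> = ?c + (80 * h * L\<^sup>2) * B / 2"
      by (simp add: algebra_simps)
    also have "\<dots> \<le> ?c + 1 * B / 2"
      using h(1,3) B by (intro add_mono divide_right_mono mult_right_mono) auto
    finally show ?thesis by simp
  qed
  then have "B \<le> ?c + B / 2"
    unfolding B_def using h by (intro cSUP_least) auto
  then have "B \<le> 2 * ?c" by simp
  also have "\<dots> \<le> cloc * h * (1 + ?m)"
  proof -
    have m0: "0 \<le> ?m" by simp
    have "4 * K\<^sup>2 + 4 * L\<^sup>2 * ?m + 10 * C\<^sup>2 \<le> 10 * (K\<^sup>2 + L\<^sup>2 + C\<^sup>2) * (1 + ?m)"
      using m0 by (simp add: algebra_simps)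
    from mult_left_mono[OF this, of "8 * h"] have
      "8 * h * (4 * K\<^sup>2 + 4 * L\<^sup>2 * ?m + 10 * C\<^sup>2) \<le> 8 * h * (10 * (K\<^sup>2 + L\<^sup>2 + C\<^sup>2) * (1 + ?m))"
      using h by simp
    moreover have "8 * h * (10 * (K\<^sup>2 + L\<^sup>2 + C\<^sup>2) * (1 + ?m)) = cloc * h * (1 + ?m)"
      by (simp add: cloc_def algebra_simps)
    moreover have "2 * ?c = 8 * h * (4 * K\<^sup>2 + 4 * L\<^sup>2 * ?m + 10 * C\<^sup>2)"
      by simp
    ultimately show ?thesis by (simp only:)
  qed
  finally show ?thesis using le_B[OF t] by simp
qed

text \<open>\<open>R\<close> is one order in \<open>h\<close> smaller than \<open>S\<close>:
  Cauchy-Schwarz in time gives an ordinary integral a factor \<open>h\<close> that the isometry does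
  not give a stochastic integral. Orthogonality compensates for this in \<open>S\<close>.\<close>

lemma step_expansion:
  assumes s: "a \<le> s" and h: "0 < h" "h \<le> 1" "80 * h * L\<^sup>2 \<le> 1"
  obtains R S where "sq_integrable M R" "sq_integrable M S"
    "\<And>\<omega>. X (s + h) \<omega> = X s \<omega> + h *\<^sub>R b s (X s \<omega>) + g s (X s \<omega>) *v (W (s + h) \<omega> - W s \<omega>) + R \<omega> + S \<omega>"
    "msq R \<le> cstep * h ^ 3 * (1 + msq (X s))"
    "msq S \<le> cstep * h\<^sup>2 * (1 + msq (X s))"
    "\<And>Z. Z \<in> borel_measurable (F s) \<Longrightarrow> sq_integrable M Z \<Longrightarrow> expectation (\<lambda>\<omega>. Z \<omega> \<bullet> S \<omega>) = 0"
proof -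
  let ?m = "msq (X s)"
  define B where "B = cloc * h * (1 + ?m)"
  have m0: "0 \<le> ?m" by simp
  have B: "B \<ge> 0" using h cloc_nonneg m0 by (simp add: B_def)
  obtain R S where RS: "sq_integrable M R" "sq_integrable M S"
    "\<And>\<omega>. X (s + h) \<omega> = X s \<omega> + h *\<^sub>R b s (X s \<omega>) + g s (X s \<omega>) *v (W (s + h) \<omega> - W s \<omega>) + R \<omega> + S \<omega>"
    "msq R \<le> 2 * h\<^sup>2 * (C\<^sup>2 * h + L\<^sup>2 * B)" "msq S \<le> 8 * h * (C\<^sup>2 * h + L\<^sup>2 * B)"
    "\<And>Z. Z \<in> borel_measurable (F s) \<Longrightarrow> sq_integrable M Z \<Longrightarrow> expectation (\<lambda>\<omega>. Z \<omega> \<bullet> S \<omega>) = 0"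
  proof (rule increment_expansion_bounded[OF s _ B, of "s + h"])
    show "s \<le> s + h" using h by simp
    show "msq (\<lambda>\<omega>. X r \<omega> - X s \<omega>) \<le> B" if "s \<le> r" "r \<le> s + h" for r
      unfolding B_def by (rule local_moment[OF s h that])
  qed (simp only: add_diff_cancel_left')
  have "C\<^sup>2 * h + L\<^sup>2 * B \<le> h * (C\<^sup>2 + L\<^sup>2 * cloc) * (1 + ?m)"
    using h m0 by (simp add: B_def algebra_simps)
  moreover have "8 * (C\<^sup>2 * h + L\<^sup>2 * B) \<le> cstep * h * (1 + ?m)"
    if "C\<^sup>2 * h + L\<^sup>2 * B \<le> h * (C\<^sup>2 + L\<^sup>2 * cloc) * (1 + ?m)"
  proof -
    have "8 * (C\<^sup>2 + L\<^sup>2 * cloc) * h * (1 + ?m) = 8 * (h * (C\<^sup>2 + L\<^sup>2 * cloc) * (1 + ?m))"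
      by (simp only: mult_ac)
    then show ?thesis
      using mult_left_mono[OF that, of 8] unfolding cstep_def by linarith
  qed
  ultimately have *: "8 * (C\<^sup>2 * h + L\<^sup>2 * B) \<le> cstep * h * (1 + ?m)" by blast
  have **: "0 \<le> C\<^sup>2 * h + L\<^sup>2 * B" using h B by simp
  show thesis
  proof (rule that[OF RS(1,2,3)])
    have "2 * h\<^sup>2 * (C\<^sup>2 * h + L\<^sup>2 * B) \<le> h\<^sup>2 * (8 * (C\<^sup>2 * h + L\<^sup>2 * B))"
    proof -
      have "h\<^sup>2 * (2 * (C\<^sup>2 * h + L\<^sup>2 * B)) \<le> h\<^sup>2 * (8 * (C\<^sup>2 * h + L\<^sup>2 * B))"
        using ** by (intro mult_left_mono mult_right_mono) auto
      then show ?thesis by (simp only: mult_ac)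
    qed
    also have "\<dots> \<le> h\<^sup>2 * (cstep * h * (1 + ?m))"
      using * by (rule mult_left_mono) simp
    finally show "msq R \<le> cstep * h ^ 3 * (1 + ?m)"
      using RS(4) by (simp add: power2_eq_square power3_eq_cube mult_ac)
    have "h * (8 * (C\<^sup>2 * h + L\<^sup>2 * B)) \<le> h * (cstep * h * (1 + ?m))"
      using * h by (intro mult_left_mono) auto
    then show "msq S \<le> cstep * h\<^sup>2 * (1 + ?m)"
      using RS(5) by (simp add: power2_eq_square mult_ac)
  qed (rule RS(6))
qed

end

subsection \<open>Dissipative coefficients\<close>

text \<open>\<open>D / \<theta>\<close> is the fixed point of the recursion. It is free of
  \<open>h\<close> when \<open>\<theta>\<close> and \<open>D\<close> are both proportional to
  \<open>h\<close>, as for the moments, and of order \<open>h\<close> when \<open>D\<close> is of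
  order \<open>h^2\<close>, as for the error.\<close>

lemma affine_recurrence_bound:
  fixes y :: "nat \<Rightarrow> real"
  assumes step: "\<And>i. y (Suc i) \<le> (1 - \<theta>) * y i + D"
    and \<theta>: "0 < \<theta>" "\<theta> \<le> 1" and y0: "0 \<le> y 0" and D: "0 \<le> D"
  shows "y i \<le> y 0 + D / \<theta>"
proof (induction i)
  case (Suc i)
  have "y (Suc i) \<le> (1 - \<theta>) * (y 0 + D / \<theta>) + D"
    using step[of i] mult_left_mono[OF Suc, of "1 - \<theta>"] \<theta> by simp
  also have "\<dots> = y 0 + D / \<theta> - \<theta> * y 0"
    using \<theta> by (simp add: field_simps)
  also have "\<dots> \<le> y 0 + D / \<theta>"
    using \<theta> y0 by simp
  finally show ?case .
qed (use \<theta> D in simp)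

lemma (in prob_space) integral_norm_sq_pair_le:
  fixes P :: "'a \<Rightarrow> 'b::euclidean_space" and Q :: "'a \<Rightarrow> 'c::euclidean_space"
    and Z :: "'a \<Rightarrow> 'd::euclidean_space"
  assumes "sq_integrable M P" "sq_integrable M Q" "sq_integrable M Z"
    and "\<And>\<omega>. (norm (P \<omega>))\<^sup>2 + h * (norm (Q \<omega>))\<^sup>2 \<le> q * (norm (Z \<omega>))\<^sup>2 + c"
  shows "(\<integral>\<omega>. (norm (P \<omega>))\<^sup>2 \<partial>M) + h * (\<integral>\<omega>. (norm (Q \<omega>))\<^sup>2 \<partial>M) \<le> q * (\<integral>\<omega>. (norm (Z \<omega>))\<^sup>2 \<partial>M) + c"
proof -
  note i = assms(1-3)[THEN sq_integrable_norm2]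
  have "(\<integral>\<omega>. (norm (P \<omega>))\<^sup>2 + h * (norm (Q \<omega>))\<^sup>2 \<partial>M) \<le> (\<integral>\<omega>. q * (norm (Z \<omega>))\<^sup>2 + c \<partial>M)"
    using i by (intro integral_mono assms(4)) auto
  then show ?thesis using i by (simp add: prob_space)
qed

lemma norm_sq_add_scaleR:
  fixes u v :: "'b::real_inner"
  shows "(norm (u + h *\<^sub>R v))\<^sup>2 = (norm u)\<^sup>2 + 2 * h * (u \<bullet> v) + h\<^sup>2 * (norm v)\<^sup>2"
  unfolding power2_norm_eq_inner by (simp add: algebra_simps inner_commute power2_eq_square)

text \<open>\<open>\<beta>\<close> is kept apart from \<open>L\<close> although both are Lipschitz
  constants of \<open>g\<close>: \<open>\<beta>\<close> competes with \<open>\<alpha>\<close> at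
  leading order and must be sharp, while \<open>L\<close> also bounds the drift and appears only in
  terms that a small step or a small \<open>\<epsilon>\<close> absorbs.\<close>

locale sde_mono = sde M W A f g C L K
  for M :: "'w measure" and W :: "real \<Rightarrow> 'w \<Rightarrow> real ^ 'd" and A :: "real ^ 'm ^ 'm" and f g C L K +
  fixes \<alpha> \<beta> :: real
  assumes \<beta>: "\<beta> \<ge> 0" and gap: "\<beta>\<^sup>2 < 2 * \<alpha>"
    and drift_mono: "(x - y) \<bullet> ((A *v x + f s x) - (A *v y + f s y)) \<le> - \<alpha> * (norm (x - y))\<^sup>2"
    and g_lip_space: "norm (g s x - g s y) \<le> \<beta> * norm (x - y)"
begin

lemma b_mono: "(x - y) \<bullet> (b s x - b s y) \<le> - \<alpha> * (norm (x - y))\<^sup>2"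
  unfolding b_def by (rule drift_mono)

text \<open>The leading rate at which one Euler step contracts mean squares: twice the dissipation
  of the drift minus the spread caused by the noise.\<close>

definition \<kappa> :: real where "\<kappa> = 2 * \<alpha> - \<beta>\<^sup>2"
text \<open>The Young weight of \<open>one_step_quadratic\<close>, chosen such that all losses
  caused by it amount to at most \<open>h * \<kappa> / 8\<close>, in \<open>moment_step\<close> as
  well as in \<open>error_step\<close>.\<close>

definition \<epsilon> :: real where "\<epsilon> = \<kappa> / (8 * (1 + 4 * L\<^sup>2 + \<beta>\<^sup>2))"
text \<open>Two equal contributions \<open>(1 / \<epsilon> + 2) * cstep\<close>, one for
  \<open>R\<close> and one for \<open>S\<close>.\<close>

definition cerr :: real where "cerr = (2 / \<epsilon> + 4) * cstep"
text \<open>The inhomogeneity due to the coefficients at the origin: the first summand from Young's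
  inequality for the terms linear in \<open>norm x\<close>, then \<open>2 * K\<^sup>2\<close> from
  the drift and \<open>K\<^sup>2\<close> from the diffusion.\<close>

definition cgr :: real where "cgr = 4 * K\<^sup>2 * (1 + \<beta>)\<^sup>2 / \<kappa> + 3 * K\<^sup>2"
definition cmom :: real where "cmom = (1 + \<epsilon>) * cgr + 2 * \<epsilon> * K\<^sup>2 + \<kappa> / 16"

text \<open>The bound with 80 closes the supremum argument in \<open>local_moment\<close>;
  \<open>16 * h * L\<^sup>2 \<le> \<kappa>\<close> controls the squared drift;
  \<open>16 * h * cerr \<le> \<kappa>\<close> lets the moment recursion absorb its own remainder;
  \<open>h * \<kappa> \<le> 1\<close> keeps the recursion factor nonnegative.\<close>

definition small_step :: "real \<Rightarrow> bool" where
  "small_step h \<longleftrightarrow> 0 < h \<and> h \<le> 1 \<and> 80 * h * L\<^sup>2 \<le> 1 \<and> 16 * h * L\<^sup>2 \<le> \<kappa> \<and> 16 * h * cerr \<le> \<kappa> \<and> h * \<kappa> \<le> 1"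

lemma \<kappa>_pos: "\<kappa> > 0"
  using gap by (simp add: \<kappa>_def)

lemma eps_denominator: "0 < 1 + 4 * L\<^sup>2 + \<beta>\<^sup>2"
  by (smt (verit) zero_le_power2)

lemma \<epsilon>_pos: "\<epsilon> > 0"
  using \<kappa>_pos eps_denominator by (simp add: \<epsilon>_def)

lemma \<epsilon>_bound: "\<epsilon> * (1 + 4 * L\<^sup>2 + \<beta>\<^sup>2) = \<kappa> / 8"
proof -
  have "\<kappa> / (8 * D) * D = \<kappa> / 8" if "0 < D" for D :: real
    using that by simp
  from this[OF eps_denominator] show ?thesis unfolding \<epsilon>_def .
qed

lemma cerr_nonneg: "cerr \<ge> 0"
  using \<epsilon>_pos cstep_nonneg by (simp add: cerr_def)

lemma cgr_nonneg: "cgr \<ge> 0"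
  using \<kappa>_pos by (simp add: cgr_def)

lemma cmom_nonneg: "cmom \<ge> 0"
  using \<epsilon>_pos \<kappa>_pos cgr_nonneg by (simp add: cmom_def)

lemma small_stepD:
  assumes "small_step h"
  shows "0 < h" "h \<le> 1" "80 * h * L\<^sup>2 \<le> 1" "16 * h * L\<^sup>2 \<le> \<kappa>" "16 * h * cerr \<le> \<kappa>" "h * \<kappa> \<le> 1"
  using assms by (auto simp: small_step_def)

lemma eventually_small_step: "\<exists>\<delta>>0. \<forall>h. 0 < h \<and> h \<le> \<delta> \<longrightarrow> small_step h"
proof -
  have bound: "h * c \<le> d" if "0 < h" "h \<le> d / (1 + c)" "0 \<le> c" "0 < d" for h c d :: real
  proof -
    have "h * c \<le> h * (1 + c)" using that by simp
    also have "\<dots> \<le> d" using that by (simp add: field_simps)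
    finally show ?thesis .
  qed
  \<comment> \<open>Quotients with \<open>1 + c\<close> instead of \<open>c\<close> as denominator,
    because \<open>L\<close> and \<open>cerr\<close> may vanish.\<close>
  define \<delta> where "\<delta> = Min {1, 1 / (1 + 80 * L\<^sup>2), \<kappa> / (1 + 16 * L\<^sup>2), \<kappa> / (1 + 16 * cerr), 1 / (1 + \<kappa>)}"
  have "\<delta> > 0"
    using \<kappa>_pos cerr_nonneg by (simp add: \<delta>_def add_pos_nonneg)
  moreover have "small_step h" if h: "0 < h" "h \<le> \<delta>" for h
  proof -
    from h(2) have "h \<le> 1" "h \<le> 1 / (1 + 80 * L\<^sup>2)" "h \<le> \<kappa> / (1 + 16 * L\<^sup>2)" "h \<le> \<kappa> / (1 + 16 * cerr)" "h \<le> 1 / (1 + \<kappa>)"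
      by (simp_all add: \<delta>_def)
    then show ?thesis
      using bound[OF h(1), of 1 "80 * L\<^sup>2"] bound[OF h(1), of \<kappa> "16 * L\<^sup>2"] bound[OF h(1), of \<kappa> "16 * cerr"]
        bound[OF h(1), of 1 \<kappa>] \<kappa>_pos cerr_nonneg h
      unfolding small_step_def by (simp add: mult_ac)
  qed
  ultimately show ?thesis by blast
qed

text \<open>Expanding the square, the mixed term gives \<open>- 2 * \<alpha> * h\<close> and the
  diffusion gives \<open>\<beta>\<^sup>2 * h\<close>, together \<open>- \<kappa> * h\<close>; the
  squared drift is of second order in \<open>h\<close>.\<close>

lemma contraction:
  assumes h: "h \<ge> 0"
  shows "(norm (x - y + h *\<^sub>R (b s x - b s y)))\<^sup>2 + h * (norm (g s x - g s y))\<^sup>2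
    \<le> (1 - \<kappa> * h + L\<^sup>2 * h\<^sup>2) * (norm (x - y))\<^sup>2"
proof -
  let ?u = "x - y" and ?v = "b s x - b s y"
  have "norm ?v \<le> L * norm ?u"
    using b_lip[of s x s y] by simp
  then have "(norm ?v)\<^sup>2 \<le> L\<^sup>2 * (norm ?u)\<^sup>2"
    using power_mono[of "norm ?v" "L * norm ?u" 2] by (simp add: power_mult_distrib)
  then have v: "h\<^sup>2 * (norm ?v)\<^sup>2 \<le> h\<^sup>2 * (L\<^sup>2 * (norm ?u)\<^sup>2)"
    by (rule mult_left_mono) simp
  have "(norm (g s x - g s y))\<^sup>2 \<le> \<beta>\<^sup>2 * (norm ?u)\<^sup>2"
    using power_mono[OF g_lip_space[of s x y], of 2] by (simp add: power_mult_distrib)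
  then have w: "h * (norm (g s x - g s y))\<^sup>2 \<le> h * (\<beta>\<^sup>2 * (norm ?u)\<^sup>2)"
    by (rule mult_left_mono[OF _ h])
  have "2 * h * (?u \<bullet> ?v) \<le> 2 * h * (- \<alpha> * (norm ?u)\<^sup>2)"
    using h by (intro mult_left_mono b_mono) auto
  with v w show ?thesis
    unfolding norm_sq_add_scaleR \<kappa>_def by (simp add: algebra_simps)
qed

text \<open>The counterpart of \<open>contraction\<close> for a single state compared with the
  origin, where the coefficients need not vanish. The resulting linear terms cost a quarter of the
  rate \<open>\<kappa>\<close>.\<close>

lemma dissipation:
  assumes h: "0 \<le> h" "h \<le> 1"
  shows "(norm (x + h *\<^sub>R b s x))\<^sup>2 + h * (norm (g s x))\<^sup>2
    \<le> (1 - 3 / 4 * \<kappa> * h + 2 * L\<^sup>2 * h\<^sup>2) * (norm x)\<^sup>2 + h * cgr"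
proof -
  let ?n = "norm x"
  have "x \<bullet> b s x = x \<bullet> (b s x - b s 0) + x \<bullet> b s 0"
    by (simp add: inner_diff_right)
  also have "\<dots> \<le> - \<alpha> * ?n\<^sup>2 + ?n * K"
  proof (rule add_mono)
    show "x \<bullet> (b s x - b s 0) \<le> - \<alpha> * ?n\<^sup>2"
      using b_mono[of x 0 s] by simp
    have "x \<bullet> b s 0 \<le> ?n * norm (b s 0)" by (rule norm_cauchy_schwarz)
    also have "\<dots> \<le> ?n * K" using b_growth[of s 0] by (intro mult_left_mono) auto
    finally show "x \<bullet> b s 0 \<le> ?n * K" .
  qed
  finally have i: "2 * h * (x \<bullet> b s x) \<le> 2 * h * (- \<alpha> * ?n\<^sup>2 + ?n * K)"
    using h by (intro mult_left_mono) auto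
  have "(norm (b s x))\<^sup>2 \<le> (K + L * ?n)\<^sup>2"
    by (rule power_mono[OF b_growth]) simp
  also have "\<dots> \<le> 2 * K\<^sup>2 + 2 * L\<^sup>2 * ?n\<^sup>2"
    using sum_sq_le2[of K "L * ?n"] by (simp add: power_mult_distrib)
  finally have "h\<^sup>2 * (norm (b s x))\<^sup>2 \<le> h\<^sup>2 * (2 * K\<^sup>2) + h\<^sup>2 * (2 * L\<^sup>2 * ?n\<^sup>2)"
    unfolding distrib_left[symmetric] by (rule mult_left_mono) simp
  also have "h\<^sup>2 * (2 * K\<^sup>2) \<le> h * (2 * K\<^sup>2)"
    using h by (intro mult_right_mono) (auto simp: power2_eq_square mult_left_le)
  finally have v: "h\<^sup>2 * (norm (b s x))\<^sup>2 \<le> h * (2 * K\<^sup>2) + h\<^sup>2 * (2 * L\<^sup>2 * ?n\<^sup>2)"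
    by simp
  have "norm (g s x) \<le> norm (g s x - g s 0) + norm (g s 0)"
    by (metis diff_add_cancel norm_triangle_ineq)
  also have "\<dots> \<le> \<beta> * ?n + K"
    using g_lip_space[of s x 0] g_growth[of s 0] by simp
  finally have "(norm (g s x))\<^sup>2 \<le> (\<beta> * ?n + K)\<^sup>2"
    by (rule power_mono) simp
  then have w: "h * (norm (g s x))\<^sup>2 \<le> h * (\<beta> * ?n + K)\<^sup>2"
    using h by (intro mult_left_mono) auto
  \<comment> \<open>Applied to \<open>p = 2 * K * (1 + \<beta>)\<close>, which collects the linear
    terms of the drift product and of the squared diffusion bound.\<close>
  have young: "p * ?n \<le> p\<^sup>2 / \<kappa> + \<kappa> / 4 * ?n\<^sup>2" for p
  proof -
    have "0 \<le> (p - \<kappa> / 2 * ?n)\<^sup>2 / \<kappa>" using \<kappa>_pos by simp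
    also have "\<dots> = p\<^sup>2 / \<kappa> + \<kappa> / 4 * ?n\<^sup>2 - p * ?n"
      using \<kappa>_pos by (simp add: power2_eq_square field_simps)
    finally show ?thesis by simp
  qed
  have "(2 * K * (1 + \<beta>))\<^sup>2 = 4 * K\<^sup>2 * (1 + \<beta>)\<^sup>2"
    by (simp only: power_mult_distrib) simp
  with young[of "2 * K * (1 + \<beta>)"] have
    "2 * K * (1 + \<beta>) * ?n \<le> 4 * K\<^sup>2 * (1 + \<beta>)\<^sup>2 / \<kappa> + \<kappa> / 4 * ?n\<^sup>2"
    by (simp only:)
  then have y: "h * (2 * K * (1 + \<beta>) * ?n) \<le> h * (4 * K\<^sup>2 * (1 + \<beta>)\<^sup>2 / \<kappa> + \<kappa> / 4 * ?n\<^sup>2)"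
    using h by (intro mult_left_mono) auto
  define q where "q = 4 * K\<^sup>2 * (1 + \<beta>)\<^sup>2 / \<kappa>"
  have "(norm (x + h *\<^sub>R b s x))\<^sup>2 + h * (norm (g s x))\<^sup>2 \<le>
      ?n\<^sup>2 + 2 * h * (- \<alpha> * ?n\<^sup>2 + ?n * K) + (h * (2 * K\<^sup>2) + h\<^sup>2 * (2 * L\<^sup>2 * ?n\<^sup>2)) + h * (\<beta> * ?n + K)\<^sup>2"
    unfolding norm_sq_add_scaleR using i v w by linarith
  also have "\<dots> = (1 - \<kappa> * h + 2 * L\<^sup>2 * h\<^sup>2) * ?n\<^sup>2 + h * (2 * K * (1 + \<beta>) * ?n) + h * (3 * K\<^sup>2)"
    unfolding \<kappa>_def by (simp add: algebra_simps power2_eq_square)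
  also have "\<dots> \<le> (1 - \<kappa> * h + 2 * L\<^sup>2 * h\<^sup>2) * ?n\<^sup>2 + h * (q + \<kappa> / 4 * ?n\<^sup>2) + h * (3 * K\<^sup>2)"
    using y unfolding q_def by linarith
  also have "\<dots> = (1 - 3 / 4 * \<kappa> * h + 2 * L\<^sup>2 * h\<^sup>2) * ?n\<^sup>2 + h * cgr"
    unfolding cgr_def q_def[symmetric] by (simp add: algebra_simps)
  finally show ?thesis .
qed

text \<open>The weight \<open>1 / (\<epsilon> * h)\<close> on \<open>R\<close> uses up its extra
  power of \<open>h\<close>, so both remainders end at order \<open>h^2\<close>.\<close>

lemma remainder_bound:
  assumes h: "small_step h" and R: "r \<le> cstep * h ^ 3 * m" and S: "s \<le> cstep * h\<^sup>2 * m" and m: "0 \<le> m"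
  shows "(1 / (\<epsilon> * h) + 2) * r + (1 / \<epsilon> + 2) * s \<le> cerr * h\<^sup>2 * m"
proof -
  note hD = small_stepD[OF h]
  have "(1 / (\<epsilon> * h) + 2) * r \<le> (1 / (\<epsilon> * h) + 2) * (cstep * h ^ 3 * m)"
    using R \<epsilon>_pos hD by (intro mult_left_mono) auto
  also have "\<dots> = (1 / \<epsilon> + 2 * h) * (cstep * h\<^sup>2 * m)"
    using \<epsilon>_pos hD by (simp add: field_simps power2_eq_square power3_eq_cube)
  also have "\<dots> \<le> (1 / \<epsilon> + 2) * (cstep * h\<^sup>2 * m)"
    using hD cstep_nonneg m by (intro mult_right_mono) auto
  finally have "(1 / (\<epsilon> * h) + 2) * r \<le> (1 / \<epsilon> + 2) * (cstep * h\<^sup>2 * m)" .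
  moreover have "(1 / \<epsilon> + 2) * s \<le> (1 / \<epsilon> + 2) * (cstep * h\<^sup>2 * m)"
    using S \<epsilon>_pos by (intro mult_left_mono) auto
  moreover have "cerr * h\<^sup>2 * m = (1 / \<epsilon> + 2) * (cstep * h\<^sup>2 * m) + (1 / \<epsilon> + 2) * (cstep * h\<^sup>2 * m)"
  proof -
    have "cerr = ((1 / \<epsilon> + 2) + (1 / \<epsilon> + 2)) * cstep" by (simp add: cerr_def)
    then show ?thesis by (simp only: distrib_right mult.assoc)
  qed
  ultimately show ?thesis by linarith
qed

end

section \<open>Moment and error recursions along the grid\<close>

locale sde_mono_sol = sde_mono M W A f g C L K \<alpha> \<beta> + sde_sol M W A f g C L K a \<xi> X
  for M :: "'w measure" and W :: "real \<Rightarrow> 'w \<Rightarrow> real ^ 'd" and A :: "real ^ 'm ^ 'm" and f g C L K \<alpha> \<beta> a \<xi> X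
begin

text \<open>The solution is read as an Euler step from its own value plus remainders. These
  remainders are proportional to the very moment being estimated, with a factor \<open>h^2\<close>;
  for small \<open>h\<close> the dissipation of order \<open>h\<close> absorbs them, so no prior
  uniform bound is needed.\<close>

lemma moment_step:
  assumes h: "small_step h" and s: "a \<le> s"
  shows "msq (X (s + h)) \<le> (1 - h * \<kappa> / 4) * msq (X s) + h * cmom"
proof -
  note hD = small_stepD[OF h]
  note Xs = X_F[OF s] X_sq_integrable[OF s]
  let ?m = "msq (X s)"
  obtain R S where RS: "sq_integrable M R" "sq_integrable M S"
    "\<And>\<omega>. X (s + h) \<omega> = X s \<omega> + h *\<^sub>R b s (X s \<omega>) + g s (X s \<omega>) *v (W (s + h) \<omega> - W s \<omega>) + R \<omega> + S \<omega>"
    "msq R \<le> cstep * h ^ 3 * (1 + ?m)" "msq S \<le> cstep * h\<^sup>2 * (1 + ?m)"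
    "\<And>Z. Z \<in> borel_measurable (F s) \<Longrightarrow> sq_integrable M Z \<Longrightarrow> expectation (\<lambda>\<omega>. Z \<omega> \<bullet> S \<omega>) = 0"
    by (rule step_expansion[OF s hD(1,2,3)], rule that)
  define Y where "Y \<omega> = X s \<omega> + h *\<^sub>R b s (X s \<omega>)" for \<omega>
  define G where "G \<omega> = g s (X s \<omega>)" for \<omega>
  have Y: "Y \<in> borel_measurable (F s)" "sq_integrable M Y"
    unfolding Y_def
    by (intro borel_measurable_add borel_measurable_scaleR borel_measurable_const Xs b_F(1)[OF Xs])
       (intro sq_integrable_add sq_integrable_scaleR Xs b_F(2)[OF Xs])
  have G: "G \<in> borel_measurable (F s)" "sq_integrable M G" "msq G \<le> 2 * K\<^sup>2 + 2 * L\<^sup>2 * ?m"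
    unfolding G_def by (rule g_F[OF Xs])+
  have m0: "0 \<le> ?m" by simp
  let ?q = "1 - 3 / 4 * \<kappa> * h + 2 * L\<^sup>2 * h\<^sup>2"
  have YG: "msq Y + h * msq G \<le> ?q * ?m + h * cgr"
    by (rule integral_norm_sq_pair_le[OF Y(2) G(2) Xs(2)])
       (unfold Y_def G_def, rule dissipation, use hD in auto)
  have "msq (X (s + h)) = msq (\<lambda>\<omega>. Y \<omega> + G \<omega> *v (W (s + h) \<omega> - W s \<omega>) + R \<omega> + S \<omega>)"
    by (simp only: RS(3) Y_def G_def)
  also have "\<dots> \<le> (1 + \<epsilon> * h) * (msq Y + h * msq G) + \<epsilon> * h * msq G +
      (1 / (\<epsilon> * h) + 2) * msq R + (1 / \<epsilon> + 2) * msq S"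
    by (rule one_step_quadratic[OF hD(1) \<epsilon>_pos Y G(1,2) RS(1,2,6)])
  also have "\<dots> \<le> (1 + \<epsilon> * h) * (?q * ?m + h * cgr) + \<epsilon> * h * (2 * K\<^sup>2 + 2 * L\<^sup>2 * ?m) + h * (\<kappa> / 16) * (1 + ?m)"
  proof -
    have "(1 / (\<epsilon> * h) + 2) * msq R + (1 / \<epsilon> + 2) * msq S \<le> cerr * h\<^sup>2 * (1 + ?m)"
      using RS(4,5) m0 by (intro remainder_bound[OF h]) auto
    also have "\<dots> = h * (h * cerr) * (1 + ?m)" by (simp add: power2_eq_square)
    also have "\<dots> \<le> h * (\<kappa> / 16) * (1 + ?m)"
      using hD m0 by (intro mult_right_mono mult_left_mono) auto
    finally have "(1 / (\<epsilon> * h) + 2) * msq R + (1 / \<epsilon> + 2) * msq S \<le> h * (\<kappa> / 16) * (1 + ?m)" .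
    moreover have "(1 + \<epsilon> * h) * (msq Y + h * msq G) \<le> (1 + \<epsilon> * h) * (?q * ?m + h * cgr)"
      using YG \<epsilon>_pos hD by (intro mult_left_mono) auto
    moreover have "\<epsilon> * h * msq G \<le> \<epsilon> * h * (2 * K\<^sup>2 + 2 * L\<^sup>2 * ?m)"
      using G(3) \<epsilon>_pos hD by (intro mult_left_mono) auto
    ultimately show ?thesis by linarith
  qed
  also have "\<dots> = ((1 + \<epsilon> * h) * ?q + \<epsilon> * h * (2 * L\<^sup>2) + h * (\<kappa> / 16)) * ?m +
      h * ((1 + \<epsilon> * h) * cgr + 2 * \<epsilon> * K\<^sup>2 + \<kappa> / 16)"
    by (simp add: algebra_simps)
  also have "\<dots> \<le> (1 - h * \<kappa> / 4) * ?m + h * cmom"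
  proof (intro add_mono mult_right_mono mult_left_mono)
    have L2: "2 * L\<^sup>2 * h\<^sup>2 \<le> h * \<kappa> / 8"
      using mult_left_mono[OF hD(4), of "h / 8"] hD(1) by (simp add: power2_eq_square mult_ac)
    have "?q \<le> 1 + 2 * L\<^sup>2"
    proof -
      have "L\<^sup>2 * h\<^sup>2 \<le> L\<^sup>2 * 1" using hD by (intro mult_left_mono) (auto simp: power_le_one)
      moreover have "0 \<le> 3 / 4 * \<kappa> * h" using \<kappa>_pos hD by simp
      ultimately show ?thesis by linarith
    qed
    then have "\<epsilon> * h * ?q \<le> \<epsilon> * h * (1 + 2 * L\<^sup>2)"
      using \<epsilon>_pos hD by (intro mult_left_mono) auto
    then have "\<epsilon> * h * ?q + \<epsilon> * h * (2 * L\<^sup>2) \<le> h * (\<epsilon> * (1 + 4 * L\<^sup>2))"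
      by (simp add: algebra_simps)
    also have "\<dots> \<le> h * (\<kappa> / 8)"
      unfolding \<epsilon>_bound[symmetric] using \<epsilon>_pos hD by (intro mult_left_mono) auto
    finally have e: "\<epsilon> * h * ?q + \<epsilon> * h * (2 * L\<^sup>2) \<le> h * \<kappa> / 8" by simp
    have "(1 + \<epsilon> * h) * ?q + \<epsilon> * h * (2 * L\<^sup>2) + h * (\<kappa> / 16) = ?q + (\<epsilon> * h * ?q + \<epsilon> * h * (2 * L\<^sup>2)) + h * \<kappa> / 16"
      by (simp add: algebra_simps)
    \<comment> \<open>Of the rate 3/4 available, 1/8 goes to the squared drift, 1/8 to the Young
      weight and 1/16 to the remainder; 7/16 is left and 1/4 is claimed.\<close>
    also have "\<dots> \<le> 1 - 3 / 4 * (h * \<kappa>) + h * \<kappa> / 8 + h * \<kappa> / 8 + h * \<kappa> / 16" (is "_ \<le> ?r")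
    proof -
      have "?q + z + h * \<kappa> / 16 \<le> ?r" if "z \<le> h * \<kappa> / 8" for z
        using that L2 mult_pos_pos[OF hD(1) \<kappa>_pos] by (simp add: algebra_simps)
      from this[OF e] show ?thesis .
    qed
    also have "\<dots> \<le> 1 - h * \<kappa> / 4"
      using \<kappa>_pos hD mult_pos_pos[of h \<kappa>] by linarith
    finally show "(1 + \<epsilon> * h) * ?q + \<epsilon> * h * (2 * L\<^sup>2) + h * (\<kappa> / 16) \<le> 1 - h * \<kappa> / 4" .
    have "(1 + \<epsilon> * h) * cgr \<le> (1 + \<epsilon>) * cgr"
      using \<epsilon>_pos hD cgr_nonneg by (intro mult_right_mono) auto
    then show "(1 + \<epsilon> * h) * cgr + 2 * \<epsilon> * K\<^sup>2 + \<kappa> / 16 \<le> cmom"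
      by (simp add: cmom_def)
  qed (use hD in auto)
  finally show ?thesis .
qed

text \<open>In the recursion \<open>\<theta> = h * \<kappa> / 4\<close> and
  \<open>D = h * cmom\<close>, so \<open>h\<close> cancels and neither the number of steps nor the
  starting time enters.\<close>

lemma moment_bound:
  assumes h: "small_step h"
  shows "msq (X (a + real i * h)) \<le> msq \<xi> + 4 * cmom / \<kappa>"
proof -
  note hD = small_stepD[OF h]
  have "msq (X (a + real i * h)) \<le> msq (X (a + real 0 * h)) + h * cmom / (h * \<kappa> / 4)"
  proof (rule affine_recurrence_bound)
    fix i
    show "msq (X (a + real (Suc i) * h)) \<le> (1 - h * \<kappa> / 4) * msq (X (a + real i * h)) + h * cmom"
      using moment_step[OF h, of "a + real i * h"] hD by (simp add: algebra_simps)
  qed (use hD \<kappa>_pos cmom_nonneg in auto)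
  also have "\<dots> = msq \<xi> + 4 * cmom / \<kappa>"
    using hD by (simp add: X_initial(2))
  finally show ?thesis .
qed

text \<open>Subtracting an Euler step from the expansion of \<open>X\<close> leaves the same
  quadratic form, now with differences of states and coefficients in \<open>Y\<close> and
  \<open>G\<close>, to which \<open>contraction\<close> applies. The remainder depends on the moment
  of \<open>X\<close> alone, not on the error.\<close>

lemma error_step:
  assumes h: "small_step h" and s: "a \<le> s"
    and x: "x \<in> borel_measurable (F s)" "sq_integrable M x"
  shows "msq (\<lambda>\<omega>. X (s + h) \<omega> - (x \<omega> + h *\<^sub>R b s (x \<omega>) + g s (x \<omega>) *v (W (s + h) \<omega> - W s \<omega>)))
    \<le> (1 - h * \<kappa> / 4) * msq (\<lambda>\<omega>. X s \<omega> - x \<omega>) + cerr * h\<^sup>2 * (1 + msq (X s))"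
proof -
  note hD = small_stepD[OF h]
  note Xs = X_F[OF s] X_sq_integrable[OF s]
  let ?m = "msq (X s)" and ?e = "msq (\<lambda>\<omega>. X s \<omega> - x \<omega>)"
  obtain R S where RS: "sq_integrable M R" "sq_integrable M S"
    "\<And>\<omega>. X (s + h) \<omega> = X s \<omega> + h *\<^sub>R b s (X s \<omega>) + g s (X s \<omega>) *v (W (s + h) \<omega> - W s \<omega>) + R \<omega> + S \<omega>"
    "msq R \<le> cstep * h ^ 3 * (1 + ?m)" "msq S \<le> cstep * h\<^sup>2 * (1 + ?m)"
    "\<And>Z. Z \<in> borel_measurable (F s) \<Longrightarrow> sq_integrable M Z \<Longrightarrow> expectation (\<lambda>\<omega>. Z \<omega> \<bullet> S \<omega>) = 0"
    by (rule step_expansion[OF s hD(1,2,3)], rule that)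
  define Y where "Y \<omega> = X s \<omega> - x \<omega> + h *\<^sub>R (b s (X s \<omega>) - b s (x \<omega>))" for \<omega>
  define G where "G \<omega> = g s (X s \<omega>) - g s (x \<omega>)" for \<omega>
  have Y: "Y \<in> borel_measurable (F s)" "sq_integrable M Y"
    unfolding Y_def
    by (intro borel_measurable_add borel_measurable_diff borel_measurable_scaleR borel_measurable_const
          Xs x b_F(1)[OF Xs] b_F(1)[OF x])
       (intro sq_integrable_add sq_integrable_diff sq_integrable_scaleR Xs x b_F(2)[OF Xs] b_F(2)[OF x])
  have G: "G \<in> borel_measurable (F s)" "sq_integrable M G"
    unfolding G_def
    by (intro borel_measurable_diff g_F(1)[OF Xs] g_F(1)[OF x])
       (intro sq_integrable_diff g_F(2)[OF Xs] g_F(2)[OF x])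
  have E: "sq_integrable M (\<lambda>\<omega>. X s \<omega> - x \<omega>)" by (intro sq_integrable_diff Xs x)
  have e0: "0 \<le> ?e" by simp
  let ?q = "1 - \<kappa> * h + L\<^sup>2 * h\<^sup>2"
  have "msq Y + h * msq G \<le> ?q * ?e + 0"
  proof (rule integral_norm_sq_pair_le[OF Y(2) G(2) E])
    fix \<omega>
    show "(norm (Y \<omega>))\<^sup>2 + h * (norm (G \<omega>))\<^sup>2 \<le> ?q * (norm (X s \<omega> - x \<omega>))\<^sup>2 + 0"
      unfolding Y_def G_def add_0_right using hD by (intro contraction) simp
  qed
  then have YG: "msq Y + h * msq G \<le> ?q * ?e" by simp
  \<comment> \<open>The pair estimate with first entry 0 and weight 1 gives the Lipschitz bound for
    \<open>G\<close> alone.\<close>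
  have "msq (\<lambda>\<omega>. 0 :: real) + 1 * msq G \<le> \<beta>\<^sup>2 * ?e + 0"
  proof (rule integral_norm_sq_pair_le[OF _ G(2) E])
    fix \<omega>
    show "(norm (0::real))\<^sup>2 + 1 * (norm (G \<omega>))\<^sup>2 \<le> \<beta>\<^sup>2 * (norm (X s \<omega> - x \<omega>))\<^sup>2 + 0"
      using power_mono[OF g_lip_space[of s "X s \<omega>" "x \<omega>"], of 2] by (simp add: G_def power_mult_distrib)
  qed simp
  then have G2: "msq G \<le> \<beta>\<^sup>2 * ?e" by simp
  have eq: "X (s + h) \<omega> - (x \<omega> + h *\<^sub>R b s (x \<omega>) + g s (x \<omega>) *v (W (s + h) \<omega> - W s \<omega>)) =
      Y \<omega> + G \<omega> *v (W (s + h) \<omega> - W s \<omega>) + R \<omega> + S \<omega>" for \<omega>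
    unfolding RS(3) Y_def G_def
    by (simp add: algebra_simps matrix_vector_mult_diff_rdistrib scaleR_diff_right)
  have "msq (\<lambda>\<omega>. Y \<omega> + G \<omega> *v (W (s + h) \<omega> - W s \<omega>) + R \<omega> + S \<omega>)
      \<le> (1 + \<epsilon> * h) * (msq Y + h * msq G) + \<epsilon> * h * msq G +
      (1 / (\<epsilon> * h) + 2) * msq R + (1 / \<epsilon> + 2) * msq S"
    by (rule one_step_quadratic[OF hD(1) \<epsilon>_pos Y G(1,2) RS(1,2,6)])
  also have "\<dots> \<le> (1 + \<epsilon> * h) * (?q * ?e) + \<epsilon> * h * (\<beta>\<^sup>2 * ?e) + cerr * h\<^sup>2 * (1 + ?m)"
  proof -
    have "(1 / (\<epsilon> * h) + 2) * msq R + (1 / \<epsilon> + 2) * msq S \<le> cerr * h\<^sup>2 * (1 + ?m)"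
      using RS(4,5) by (intro remainder_bound[OF h]) auto
    moreover have "(1 + \<epsilon> * h) * (msq Y + h * msq G) \<le> (1 + \<epsilon> * h) * (?q * ?e)"
      using YG \<epsilon>_pos hD by (intro mult_left_mono) auto
    moreover have "\<epsilon> * h * msq G \<le> \<epsilon> * h * (\<beta>\<^sup>2 * ?e)"
      using G2 \<epsilon>_pos hD by (intro mult_left_mono) auto
    ultimately show ?thesis by linarith
  qed
  also have "\<dots> = ((1 + \<epsilon> * h) * ?q + \<epsilon> * h * \<beta>\<^sup>2) * ?e + cerr * h\<^sup>2 * (1 + ?m)"
    by (simp add: algebra_simps)
  also have "\<dots> \<le> (1 - h * \<kappa> / 4) * ?e + cerr * h\<^sup>2 * (1 + ?m)"
  proof (intro add_right_mono mult_right_mono e0)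
    have L2: "L\<^sup>2 * h\<^sup>2 \<le> h * \<kappa> / 16"
      using mult_left_mono[OF hD(4), of "h / 16"] hD(1) by (simp add: power2_eq_square mult_ac)
    have "?q \<le> 1 + 4 * L\<^sup>2"
    proof -
      have "L\<^sup>2 * h\<^sup>2 \<le> L\<^sup>2 * 1" using hD by (intro mult_left_mono) (auto simp: power_le_one)
      moreover have "0 \<le> \<kappa> * h" using \<kappa>_pos hD by simp
      moreover have "0 \<le> L\<^sup>2" by simp
      ultimately show ?thesis by linarith
    qed
    then have "\<epsilon> * h * ?q \<le> \<epsilon> * h * (1 + 4 * L\<^sup>2)"
      using \<epsilon>_pos hD by (intro mult_left_mono) auto
    then have "\<epsilon> * h * ?q + \<epsilon> * h * \<beta>\<^sup>2 \<le> h * (\<epsilon> * (1 + 4 * L\<^sup>2 + \<beta>\<^sup>2))"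
      by (simp add: algebra_simps)
    then have e: "\<epsilon> * h * ?q + \<epsilon> * h * \<beta>\<^sup>2 \<le> h * \<kappa> / 8"
      unfolding \<epsilon>_bound by simp
    have "(1 + \<epsilon> * h) * ?q + \<epsilon> * h * \<beta>\<^sup>2 = ?q + (\<epsilon> * h * ?q + \<epsilon> * h * \<beta>\<^sup>2)"
      by (simp add: algebra_simps)
    \<comment> \<open>From the full rate 1, the squared drift takes 1/16 and the Young weight 1/8;
      1/4 is claimed so as to share the factor of \<open>moment_step\<close>.\<close>
    also have "\<dots> \<le> 1 - h * \<kappa> + h * \<kappa> / 16 + h * \<kappa> / 8" (is "_ \<le> ?r")
    proof -
      have "?q + z \<le> ?r" if "z \<le> h * \<kappa> / 8" for z
        using that L2 mult_pos_pos[OF hD(1) \<kappa>_pos] by (simp add: algebra_simps)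
      from this[OF e] show ?thesis .
    qed
    also have "\<dots> \<le> 1 - h * \<kappa> / 4"
      using \<kappa>_pos hD mult_pos_pos[of h \<kappa>] by linarith
    finally show "(1 + \<epsilon> * h) * ?q + \<epsilon> * h * \<beta>\<^sup>2 \<le> 1 - h * \<kappa> / 4" .
  qed
  finally show ?thesis unfolding eq .
qed

text \<open>The initial error is zero, almost surely, since scheme and solution start from the same
  \<open>\<xi>\<close>. With the moments bounded, the inhomogeneity is of order \<open>h^2\<close>
  against \<open>\<theta> = h * \<kappa> / 4\<close>, which leaves order \<open>h\<close>. The
  coefficients are taken at the true times \<open>a + real i * h\<close>; periodicity makes this
  agree with \<open>em_iterate\<close>.\<close>

lemma em_error:
  assumes h: "small_step h" and \<xi>F: "\<xi> \<in> borel_measurable (F a)"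
    and x0: "x 0 = \<xi>"
    and xS: "\<And>i \<omega>. x (Suc i) \<omega> = x i \<omega> + h *\<^sub>R b (a + real i * h) (x i \<omega>) +
      g (a + real i * h) (x i \<omega>) *v (W (a + real (Suc i) * h) \<omega> - W (a + real i * h) \<omega>)"
  shows "x i \<in> borel_measurable (F (a + real i * h))" "sq_integrable M (x i)"
    and "msq (\<lambda>\<omega>. X (a + real i * h) \<omega> - x i \<omega>) \<le> h * (4 * cerr * (1 + msq \<xi> + 4 * cmom / \<kappa>) / \<kappa>)"
proof -
  note hD = small_stepD[OF h]
  have xi: "x i \<in> borel_measurable (F (a + real i * h)) \<and> sq_integrable M (x i)" for i
  proof (induction i)
    case 0
    then show ?case using \<xi>F xi x0 by simp
  next
    case (Suc i)
    let ?s = "a + real i * h" and ?t = "a + real (Suc i) * h"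
    have st: "?s \<le> ?t" using hD by (simp add: algebra_simps)
    from Suc have x: "x i \<in> borel_measurable (F ?s)" "sq_integrable M (x i)" by auto
    note m = measurable_F_mono[OF st]
    show ?case
      unfolding xS
      by (intro conjI borel_measurable_add borel_measurable_scaleR borel_measurable_const
          m[OF x(1)] m[OF b_F(1)[OF x]] F_incr_mult_measurable[OF st order.refl st g_F(1)[OF x]]
          sq_integrable_add sq_integrable_scaleR x b_F(2)[OF x] sq_integrable_incr[OF st g_F(1,2)[OF x]])
  qed
  then show "x i \<in> borel_measurable (F (a + real i * h))" "sq_integrable M (x i)" by auto
  let ?c = "1 + msq \<xi> + 4 * cmom / \<kappa>"
  have c: "0 \<le> ?c" using cmom_nonneg \<kappa>_pos by (intro add_nonneg_nonneg) auto
  let ?e = "\<lambda>i. msq (\<lambda>\<omega>. X (a + real i * h) \<omega> - x i \<omega>)"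
  have zero: "?e 0 = 0"
  proof -
    have "AE \<omega> in M. (norm (X (a + real 0 * h) \<omega> - x 0 \<omega>))\<^sup>2 = 0"
      using sol by (auto simp: sde_solution_def x0)
    then show ?thesis by (rule integral_eq_zero_AE)
  qed
  have "?e i \<le> ?e 0 + cerr * h\<^sup>2 * ?c / (h * \<kappa> / 4)"
  proof (rule affine_recurrence_bound)
    fix i
    let ?s = "a + real i * h"
    have s: "a \<le> ?s" using hD by simp
    have t: "a + real (Suc i) * h = ?s + h" by (simp add: algebra_simps)
    have "?e (Suc i) \<le> (1 - h * \<kappa> / 4) * ?e i + cerr * h\<^sup>2 * (1 + msq (X ?s))"
      unfolding xS t using error_step[OF h s, of "x i"] xi[of i] by simp
    also have "\<dots> \<le> (1 - h * \<kappa> / 4) * ?e i + cerr * h\<^sup>2 * ?c"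
      using moment_bound[OF h, of i] cerr_nonneg by (intro add_left_mono mult_left_mono) auto
    finally show "?e (Suc i) \<le> (1 - h * \<kappa> / 4) * ?e i + cerr * h\<^sup>2 * ?c" .
  qed (use hD \<kappa>_pos cerr_nonneg c in auto)
  also have "\<dots> = h * (4 * cerr * ?c / \<kappa>)"
    unfolding zero using hD \<kappa>_pos by (simp add: field_simps power2_eq_square)
  finally show "?e i \<le> h * (4 * cerr * ?c / \<kappa>)" .
qed

text \<open>Between grid points the scheme moves with \<open>f\<close> alone, not with the full
  drift, hence the arbitrary \<open>u\<close> of linear growth: within one step the drift changes
  the mean square by at most \<open>(r - t)\<^sup>2\<close> times a constant, so its exact form does
  not affect the order \<open>h\<close>.\<close>

lemma em_interp_error:
  fixes u :: "real ^ 'm \<Rightarrow> real ^ 'm"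
  assumes h: "small_step h" and \<xi>F: "\<xi> \<in> borel_measurable (F a)"
    and x0: "x 0 = \<xi>"
    and xS: "\<And>i \<omega>. x (Suc i) \<omega> = x i \<omega> + h *\<^sub>R b (a + real i * h) (x i \<omega>) +
      g (a + real i * h) (x i \<omega>) *v (W (a + real (Suc i) * h) \<omega> - W (a + real i * h) \<omega>)"
    and u: "u \<in> borel_measurable borel" "\<And>y. norm (u y) \<le> K + L * norm y"
    and c: "1 + msq \<xi> + 4 * cmom / \<kappa> \<le> c"
    and e: "e = 4 * cerr * c / \<kappa>"
    and r: "a + real i * h \<le> r" "r \<le> a + real i * h + h"
  defines "t \<equiv> a + real i * h"
  shows "msq (\<lambda>\<omega>. X r \<omega> - (x i \<omega> + (r - t) *\<^sub>R u (x i \<omega>) + g t (x i \<omega>) *v (W r \<omega> - W t \<omega>)))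
    \<le> h * (4 * (cloc * c) + 4 * e + 8 * (2 * K\<^sup>2 + 4 * L\<^sup>2 * (c + e)))"
proof -
  note hD = small_stepD[OF h]
  have t: "a \<le> t" "t \<le> r" "r \<le> t + h" using hD r by (simp_all add: t_def)
  have ar: "a \<le> r" using t by simp
  note x = em_error[OF h \<xi>F x0 xS, of i, folded t_def]
  have c0: "0 \<le> c"
    using c cmom_nonneg \<kappa>_pos by (intro order_trans[OF _ c] add_nonneg_nonneg) auto
  have e0: "0 \<le> e" using c0 \<kappa>_pos cerr_nonneg by (simp add: e)
  have he: "msq (\<lambda>\<omega>. X t \<omega> - x i \<omega>) \<le> h * e"
  proof -
    have "h * (4 * cerr * (1 + msq \<xi> + 4 * cmom / \<kappa>) / \<kappa>) \<le> h * e"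
      unfolding e using c hD \<kappa>_pos cerr_nonneg by (intro mult_left_mono divide_right_mono) auto
    with x(3) show ?thesis by simp
  qed
  have mX: "1 + msq (X t) \<le> c"
    using moment_bound[OF h, of i] c by (simp add: t_def)
  have X: "sq_integrable M (X t)" "sq_integrable M (X r)" using X_sq_integrable t by auto
  let ?K = "2 * K\<^sup>2 + 4 * L\<^sup>2 * (c + e)"
  \<comment> \<open>Moments of the scheme come from those of the solution and the error just
    bounded; no recursion of their own is required.\<close>
  have mx: "msq (x i) \<le> 2 * (c + e)"
  proof -
    have "msq (x i) = msq (\<lambda>\<omega>. X t \<omega> + (x i \<omega> - X t \<omega>))" by simp
    also have "\<dots> \<le> 2 * msq (X t) + 2 * msq (\<lambda>\<omega>. x i \<omega> - X t \<omega>)"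
      by (intro integral_norm_add_sq_le2 sq_integrable_diff X x)
    also have "msq (\<lambda>\<omega>. x i \<omega> - X t \<omega>) = msq (\<lambda>\<omega>. X t \<omega> - x i \<omega>)"
      by (simp add: norm_minus_commute)
    also have "2 * msq (X t) + 2 * msq (\<lambda>\<omega>. X t \<omega> - x i \<omega>) \<le> 2 * c + 2 * (1 * e)"
      using mX he hD e0 mult_right_mono[of h 1 e] by simp
    finally show ?thesis by simp
  qed
  have Kle: "2 * K\<^sup>2 + 2 * L\<^sup>2 * msq (x i) \<le> ?K"
    using mult_left_mono[OF mx, of "2 * L\<^sup>2"] by (simp add: algebra_simps)
  have um: "(\<lambda>\<omega>. u (x i \<omega>)) \<in> borel_measurable M"
    by (rule measurable_compose[OF sq_integrable_measurable[OF x(2)] u(1)])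
  note U = integral_norm_growth_le[OF x(2) um u(2)]
  note G = g_F[OF x(1,2), of t]
  let ?U = "\<lambda>\<omega>. (t - r) *\<^sub>R u (x i \<omega>)" and ?V = "\<lambda>\<omega>. - (g t (x i \<omega>) *v (W r \<omega> - W t \<omega>))"
  have Vi: "sq_integrable M ?V"
    by (intro sq_integrable_minus sq_integrable_incr[OF t(2) G(1,2)])
  have d: "0 \<le> r - t" "r - t \<le> h" "(t - r)\<^sup>2 \<le> h"
    using t hD mult_mono[of "r - t" h "r - t" 1] by (auto simp: power2_eq_square algebra_simps)
  have V2: "msq ?V = (r - t) * msq (\<lambda>\<omega>. g t (x i \<omega>))"
    using inner_incr_incr(2)[OF t(2) G(1,2) G(1,2)] by (simp add: power2_norm_eq_inner)
  have "msq ?V \<le> h * ?K"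
    unfolding V2 using d Kle hD by (intro mult_mono order_trans[OF G(3)]) auto
  moreover have "msq ?U \<le> h * ?K"
  proof -
    have "msq ?U = (t - r)\<^sup>2 * msq (\<lambda>\<omega>. u (x i \<omega>))"
      by (simp add: power_mult_distrib)
    also have "\<dots> \<le> h * ?K"
      using d Kle hD by (intro mult_mono order_trans[OF U(2)]) auto
    finally show ?thesis .
  qed
  moreover have "msq (\<lambda>\<omega>. X r \<omega> - X t \<omega>) \<le> h * (cloc * c)"
  proof -
    have "msq (\<lambda>\<omega>. X r \<omega> - X t \<omega>) \<le> cloc * h * (1 + msq (X t))"
      by (rule local_moment[OF t(1) hD(1,2,3) t(2,3)])
    also have "\<dots> \<le> cloc * h * c"
      using mX cloc_nonneg hD by (intro mult_left_mono) auto
    finally show ?thesis by (simp add: mult_ac)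
  qed
  moreover have "msq (\<lambda>\<omega>. (X r \<omega> - X t \<omega>) + (X t \<omega> - x i \<omega>) + ?U \<omega> + ?V \<omega>) \<le>
      4 * msq (\<lambda>\<omega>. X r \<omega> - X t \<omega>) + 4 * msq (\<lambda>\<omega>. X t \<omega> - x i \<omega>) + 4 * msq ?U + 4 * msq ?V"
    by (intro integral_norm_add4_sq_le sq_integrable_diff sq_integrable_scaleR X x U(1) Vi)
  ultimately have "msq (\<lambda>\<omega>. (X r \<omega> - X t \<omega>) + (X t \<omega> - x i \<omega>) + ?U \<omega> + ?V \<omega>) \<le>
      4 * (h * (cloc * c)) + 4 * (h * e) + 4 * (h * ?K) + 4 * (h * ?K)"
    using he by linarith
  also have "\<dots> = h * (4 * (cloc * c) + 4 * e + 8 * ?K)"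
    by (simp add: algebra_simps)
  finally show ?thesis
    by (simp add: algebra_simps)
qed

end

subsection \<open>The largest eigenvalue\<close>

text \<open>The \<open>lam i\<close> are known only as roots of the characteristic polynomial. A
  maximiser \<open>x0\<close> of the quadratic form on the unit sphere is an eigenvector, so the
  maximum \<open>\<mu>\<close> is one of the roots and lies below the first.\<close>

lemma symmetric_quadratic_form_le:
  fixes A :: "real ^ 'm ^ 'm"
  assumes sym: "transpose A = A" and eig: "eigenvalue_list A lam"
  shows "x \<bullet> (A *v x) \<le> lam 1 * (norm x)\<^sup>2"
proof -
  have symm: "x \<bullet> (A *v y) = y \<bullet> (A *v x)" for x y
    by (metis dot_lmul_matrix inner_commute sym transpose_matrix_vector)
  have "compact (sphere (0 :: real ^ 'm) 1)" by simp
  moreover have "(axis undefined 1 :: real ^ 'm) \<in> sphere 0 1" by (simp add: norm_axis_1)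
  then have "sphere (0 :: real ^ 'm) 1 \<noteq> {}" by blast
  moreover have "continuous_on (sphere 0 1) (\<lambda>x. x \<bullet> (A *v x))"
    by (intro continuous_intros linear_continuous_on bounded_linear_intros
        matrix_vector_mul_bounded_linear)
  ultimately obtain x0 where x0: "x0 \<in> sphere 0 1"
    and max: "\<And>y. y \<in> sphere 0 1 \<Longrightarrow> y \<bullet> (A *v y) \<le> x0 \<bullet> (A *v x0)"
    by (meson continuous_attains_sup)
  define \<mu> where "\<mu> = x0 \<bullet> (A *v x0)"
  define q where "q y = \<mu> * (y \<bullet> y) - y \<bullet> (A *v y)" for y
  have nx0: "x0 \<bullet> x0 = 1" using x0 by (simp add: norm_eq_1)
  have q_nonneg: "0 \<le> q y" for y
  proof (cases "y = 0")
    case False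
    have "(inverse (norm y) *\<^sub>R y) \<bullet> (A *v (inverse (norm y) *\<^sub>R y)) \<le> \<mu>"
      unfolding \<mu>_def using False by (intro max) simp
    then have "(y \<bullet> (A *v y)) / (norm y)\<^sup>2 \<le> \<mu>"
      by (simp add: matrix_vector_mult_scaleR power2_eq_square field_simps)
    then show ?thesis
      using False by (simp add: q_def power2_norm_eq_inner[symmetric] divide_le_eq)
  qed (simp add: q_def)
  \<comment> \<open>\<open>z\<close> is the residual of the eigenvalue equation and half the
    gradient at \<open>x0\<close> of the nonnegative form \<open>q\<close>, which vanishes at
    \<open>x0\<close>; moving against it would make \<open>q\<close> negative unless
    \<open>z = 0\<close>.\<close>
  define z where "z = \<mu> *\<^sub>R x0 - A *v x0"
  have q_line: "q (x0 + t *\<^sub>R z) = 2 * t * (z \<bullet> z) + t\<^sup>2 * q z" for t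
  proof -
    have "q (x0 + t *\<^sub>R z) = (\<mu> * (x0 \<bullet> x0) - \<mu>) + 2 * t * (\<mu> * (x0 \<bullet> z) - z \<bullet> (A *v x0)) + t\<^sup>2 * q z"
      using symm[of x0 z]
      by (simp add: q_def \<mu>_def matrix_vector_right_distrib matrix_vector_mult_scaleR inner_add_left
          inner_add_right inner_commute[of z x0] power2_eq_square algebra_simps)
    also have "\<mu> * (x0 \<bullet> z) - z \<bullet> (A *v x0) = z \<bullet> z"
      by (simp add: z_def inner_diff_left inner_diff_right inner_commute algebra_simps)
    finally show ?thesis using nx0 by simp
  qed
  have "z = 0"
  proof (rule ccontr)
    assume "z \<noteq> 0"
    then have n: "0 < z \<bullet> z" by simp
    \<comment> \<open>Short enough for the linear term to beat the quadratic one; the added 1 keeps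
      the denominator positive when \<open>q z = 0\<close>.\<close>
    define t where "t = - (z \<bullet> z) / (q z + 1)"
    have "2 * (z \<bullet> z) + t * q z = (z \<bullet> z) * (2 - q z / (q z + 1))"
      by (simp add: t_def algebra_simps)
    moreover have "q z / (q z + 1) \<le> 1" using q_nonneg[of z] by simp
    ultimately have "0 < 2 * (z \<bullet> z) + t * q z" using n by simp
    moreover have "t < 0" using n q_nonneg[of z] by (simp add: t_def)
    ultimately have "t * (2 * (z \<bullet> z) + t * q z) < 0" by (rule mult_neg_pos[rotated])
    moreover have "t * (2 * (z \<bullet> z) + t * q z) = q (x0 + t *\<^sub>R z)"
      unfolding q_line by (simp add: power2_eq_square algebra_simps)
    ultimately show False using q_nonneg[of "x0 + t *\<^sub>R z"] by simp
  qed
  moreover have "mat \<mu> *v x0 = \<mu> *\<^sub>R x0"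
    by (simp add: mat_def matrix_vector_mult_def vec_eq_iff if_distrib if_distribR cong: if_cong)
  ultimately have "(mat \<mu> - A) *v x0 = 0"
    by (simp add: z_def matrix_vector_mult_diff_rdistrib)
  moreover have "x0 \<noteq> 0" using nx0 by auto
  ultimately have "det (mat \<mu> - A) = 0"
    by (metis invertible_det_nz invertible_left_inverse matrix_left_invertible_ker)
  then have "(\<Prod>i = 1..CARD('m). \<mu> - lam i) = 0"
    using eig by (simp add: eigenvalue_list_def)
  then obtain i where i: "1 \<le> i" "i \<le> CARD('m)" "\<mu> = lam i" by auto
  have "lam i \<le> lam 1"
    using eig i unfolding eigenvalue_list_def by (auto simp: monotone_on_def)
  then have "\<mu> * (x \<bullet> x) \<le> lam 1 * (x \<bullet> x)"
    using i(3) by (intro mult_right_mono) auto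
  then show ?thesis
    using q_nonneg[of x] by (simp add: q_def power2_norm_eq_inner)
qed

section \<open>Periodic coefficients and passage to the limit\<close>

lemma periodic_shift_int:
  fixes p :: "real \<Rightarrow> 'b"
  assumes "\<And>t. p (t + \<tau>) = p t"
  shows "p (t + of_int k * \<tau>) = p t"
proof -
  have nat: "p (t + real n * \<tau>) = p t" for n t
    by (induction n) (use assms in \<open>simp_all add: distrib_right add.assoc[symmetric] add.commute[of \<tau>]\<close>)
  show ?thesis
  proof (cases "k \<ge> 0")
    case True
    then show ?thesis using nat[of t "nat k"] by simp
  next
    case False
    then show ?thesis using nat[of "t + of_int k * \<tau>" "nat (- k)"] by simp
  qed
qed

text \<open>Periodicity moves the time into \<open>[0, \<tau>]\<close>, where the square root term
  is bounded; this makes the growth constant uniform over all times.\<close>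

lemma periodic_Holder_growth:
  fixes u :: "real \<Rightarrow> 'a::real_normed_vector \<Rightarrow> 'b::real_normed_vector"
  assumes "\<And>t x. u (t + \<tau>) x = u t x" "\<tau> > 0" "C \<ge> 0"
    and "\<And>s t x y. norm (u s x - u t y) \<le> C * sqrt \<bar>s - t\<bar> + l * norm (x - y)"
  shows "norm (u t x) \<le> norm (u 0 0) + C * sqrt \<tau> + l * norm x"
proof -
  define s where "s = t + of_int (- \<lfloor>t / \<tau>\<rfloor>) * \<tau>"
  have "u s x = u t x"
    unfolding s_def using periodic_shift_int[of "\<lambda>t. u t x" \<tau>] assms(1) by blast
  moreover have "s = frac (t / \<tau>) * \<tau>"
    using assms(2) by (simp add: s_def frac_def field_simps)
  then have "0 \<le> s" "s \<le> \<tau>"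
    using assms(2) frac_lt_1[of "t / \<tau>"] by (simp_all add: mult_left_le_one_le)
  then have "C * sqrt \<bar>s - 0\<bar> \<le> C * sqrt \<tau>"
    using assms(3) by (intro mult_left_mono) auto
  moreover have "norm (u s x) \<le> norm (u s x - u 0 0) + norm (u 0 0)"
    by (metis diff_add_cancel norm_triangle_ineq)
  ultimately show ?thesis
    using assms(4)[of s x 0 0] by simp
qed

text \<open>For each \<open>k\<close> the scheme and the solution started at time
  \<open>- k \<tau>\<close> differ at time \<open>r\<close> by at most
  \<open>sqrt (\<tau> / real n * B)\<close>, where \<open>B\<close> is free of \<open>k\<close>,
  \<open>n\<close> and \<open>r\<close>. The triangle inequality adds the distances to the two
  limits, which vanish as \<open>k\<close> grows at fixed \<open>n\<close> and
  \<open>r\<close>.\<close>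

theorem corollary4p3:
  fixes M :: "'w measure"
    and W :: "real \<Rightarrow> 'w \<Rightarrow> real ^ 'd"
    and A :: "real ^ 'm ^ 'm"
    and lam :: "nat \<Rightarrow> real"
    and f :: "real \<Rightarrow> real ^ 'm \<Rightarrow> real ^ 'm"
    and g :: "real \<Rightarrow> real ^ 'm \<Rightarrow> real ^ 'd ^ 'm"
    and \<tau> C\<^sub>0 \<beta>\<^sub>1 \<beta>\<^sub>2 Kstar \<delta>\<^sub>0 :: real
    and \<xi> :: "nat \<Rightarrow> 'w \<Rightarrow> real ^ 'm"
    and X :: "nat \<Rightarrow> real \<Rightarrow> 'w \<Rightarrow> real ^ 'm"
    and Xstar :: "real \<Rightarrow> 'w \<Rightarrow> real ^ 'm"
    and Xhatstar :: "nat \<Rightarrow> real \<Rightarrow> 'w \<Rightarrow> real ^ 'm"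
  assumes wiener: "two_sided_wiener M W"
    and tau: "\<tau> > 0"
    and A_sym: "transpose A = A"
    and A_eigenvalues: "eigenvalue_list A lam" "lam 1 < 0"
    and f_periodic: "\<And>t x. f (t + \<tau>) x = f t x"
    and g_periodic: "\<And>t x. g (t + \<tau>) x = g t x"
    and constants: "C\<^sub>0 > 0" "\<beta>\<^sub>1 > 0" "\<beta>\<^sub>2 > 0" "\<beta>\<^sub>1 + \<beta>\<^sub>2\<^sup>2 / 2 < \<bar>lam 1\<bar>"
    and f_bound: "\<And>s t x y. norm (f s x - f t y) \<le> C\<^sub>0 * sqrt \<bar>s - t\<bar> + \<beta>\<^sub>1 * norm (x - y)"
    and g_bound: "\<And>s t x y. norm (g s x - g t y) \<le> C\<^sub>0 * sqrt \<bar>s - t\<bar> + \<beta>\<^sub>2 * norm (x - y)"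
    and Kstar: "Kstar > 0"
    and xi_measurable: "\<And>k. \<xi> k \<in> borel_measurable (incr_filtration M W (- (real k * \<tau>)))"
    and xi_L2: "\<And>k. sq_integrable M (\<xi> k)" "\<And>k. L2_norm M (\<xi> k) \<le> Kstar"
    and X: "\<And>k. sde_solution M W A f g (- (real k * \<tau>)) (\<xi> k) (X k)"
    and Xstar: "\<And>r. r \<ge> 0 \<Longrightarrow> L2_limit M (\<lambda>k. X k r) (Xstar r)"
    and delta0: "\<delta>\<^sub>0 > 0"
    and Xhatstar: "\<And>n r. n > 0 \<Longrightarrow> \<tau> / real n \<le> \<delta>\<^sub>0 \<Longrightarrow> \<tau> / real n \<le> 1 / \<bar>lam CARD('m)\<bar> \<Longrightarrow> r \<ge> 0 \<Longrightarrow>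
        L2_limit M (\<lambda>k. em_interp W \<tau> A f g n k (\<xi> k) r) (Xhatstar n r)"
  shows "\<exists>K>0. \<exists>\<delta>>0. \<forall>n>0. \<tau> / real n \<le> \<delta> \<longrightarrow>
    (\<forall>r\<ge>0. L2_norm M (\<lambda>\<omega>. Xstar r \<omega> - Xhatstar n r \<omega>) \<le> K * sqrt (\<tau> / real n))"
proof -
  obtain a where a: "a > 0" "\<And>x. norm (A *v x) \<le> a * norm x"
    using bounded_linear.pos_bounded[OF matrix_vector_mul_bounded_linear[of A]] by (auto simp: mult.commute)
  define L where "L = a + \<beta>\<^sub>1 + \<beta>\<^sub>2"
  define K where "K = (norm (f 0 0) + C\<^sub>0 * sqrt \<tau>) + (norm (g 0 0) + C\<^sub>0 * sqrt \<tau>)"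
  have nonneg: "0 \<le> C\<^sub>0" "0 \<le> C\<^sub>0 * sqrt \<tau>" using constants tau by auto
  have f_growth: "norm (f s x) \<le> K + \<beta>\<^sub>1 * norm x" for s x
    using periodic_Holder_growth[OF f_periodic tau nonneg(1) f_bound, of s x] nonneg norm_ge_zero[of "g 0 0"]
    unfolding K_def by linarith
  have g_growth: "norm (g s x) \<le> K + \<beta>\<^sub>2 * norm x" for s x
    using periodic_Holder_growth[OF g_periodic tau nonneg(1) g_bound, of s x] nonneg norm_ge_zero[of "f 0 0"]
    unfolding K_def by linarith
  have L: "a * norm x + \<beta>\<^sub>1 * norm x \<le> L * norm x" "\<beta>\<^sub>1 * norm x \<le> L * norm x" "\<beta>\<^sub>2 * norm x \<le> L * norm x"
    for x :: "real ^ 'm"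
    unfolding L_def distrib_right[symmetric] using a constants by (intro mult_right_mono; simp)+
  have drift_diff: "(A *v x + f s x) - (A *v y + f t y) = A *v (x - y) + (f s x - f t y)" for s t x y
    by (simp add: matrix_vector_mult_diff_distrib)
  \<comment> \<open>The matrix dissipates at rate at least \<open>- lam 1\<close> and
    \<open>f\<close> can undo at most \<open>\<beta>\<^sub>1\<close> of it; the condition on the
    constants then says exactly that \<open>\<beta>\<^sub>2\<^sup>2 < 2 * \<alpha>\<close>.\<close>
  define \<alpha> where "\<alpha> = - lam 1 - \<beta>\<^sub>1"
  have "sde_mono M W A f g C\<^sub>0 L K \<alpha> \<beta>\<^sub>2"
  proof unfold_locales
    show "two_sided_wiener M W" by (rule wiener)
    show "0 \<le> C\<^sub>0" "0 \<le> L" "0 \<le> K" "0 \<le> \<beta>\<^sub>2"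
      using constants(1-3) a(1) nonneg by (simp_all add: L_def K_def)
    show "\<beta>\<^sub>2\<^sup>2 < 2 * \<alpha>" unfolding \<alpha>_def using constants A_eigenvalues by simp
    fix x y s t
    show "norm ((A *v x + f s x) - (A *v y + f t y)) \<le> C\<^sub>0 * sqrt \<bar>s - t\<bar> + L * norm (x - y)"
    proof -
      have "norm (A *v (x - y) + (f s x - f t y)) \<le> a * norm (x - y) + (C\<^sub>0 * sqrt \<bar>s - t\<bar> + \<beta>\<^sub>1 * norm (x - y))"
        by (intro norm_triangle_le add_mono a f_bound)
      then show ?thesis unfolding drift_diff using L(1)[of "x - y"] by linarith
    qed
    show "norm (g s x - g t y) \<le> C\<^sub>0 * sqrt \<bar>s - t\<bar> + L * norm (x - y)"
      using g_bound[of s x t y] L(3)[of "x - y"] by linarith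
    show "norm (A *v x + f s x) \<le> K + L * norm x"
      using norm_triangle_ineq[of "A *v x" "f s x"] a(2)[of x] f_growth[of s x] L(1)[of x] by linarith
    show "norm (g s x) \<le> K + L * norm x"
      using g_growth[of s x] L(3)[of x] by linarith
    show "norm (g s x - g s y) \<le> \<beta>\<^sub>2 * norm (x - y)"
      using g_bound[of s x s y] by simp
    have "(x - y) \<bullet> ((A *v x + f s x) - (A *v y + f s y)) = (x - y) \<bullet> (A *v (x - y)) + (x - y) \<bullet> (f s x - f s y)"
      unfolding drift_diff by (rule inner_add_right)
    also have "\<dots> \<le> lam 1 * (norm (x - y))\<^sup>2 + norm (x - y) * (\<beta>\<^sub>1 * norm (x - y))"
    proof (rule add_mono)
      show "(x - y) \<bullet> (A *v (x - y)) \<le> lam 1 * (norm (x - y))\<^sup>2"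
        by (rule symmetric_quadratic_form_le[OF A_sym A_eigenvalues(1)])
      have "norm (f s x - f s y) \<le> \<beta>\<^sub>1 * norm (x - y)"
        using f_bound[of s x s y] by simp
      then show "(x - y) \<bullet> (f s x - f s y) \<le> norm (x - y) * (\<beta>\<^sub>1 * norm (x - y))"
        by (intro order_trans[OF norm_cauchy_schwarz] mult_left_mono) auto
    qed
    finally show "(x - y) \<bullet> ((A *v x + f s x) - (A *v y + f s y)) \<le> - \<alpha> * (norm (x - y))\<^sup>2"
      by (simp add: \<alpha>_def algebra_simps power2_eq_square)
  qed
  then interpret S: sde_mono M W A f g C\<^sub>0 L K \<alpha> \<beta>\<^sub>2 .
  obtain \<delta> where \<delta>: "\<delta> > 0" "\<And>h. 0 < h \<Longrightarrow> h \<le> \<delta> \<Longrightarrow> S.small_step h"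
    using S.eventually_small_step by blast
  \<comment> \<open>\<open>c\<close> bounds one plus the second moments, with
    \<open>Kstar\<^sup>2\<close> in place of that of the initial value to be uniform in
    \<open>k\<close>; \<open>e\<close> is the grid error constant, and \<open>B\<close> the constant
    of \<open>em_interp_error\<close>.\<close>
  define c where "c = 1 + Kstar\<^sup>2 + 4 * S.cmom / S.\<kappa>"
  define e where "e = 4 * S.cerr * c / S.\<kappa>"
  define B where "B = 4 * (S.cloc * c) + 4 * e + 8 * (2 * K\<^sup>2 + 4 * L\<^sup>2 * (c + e))"
  have ce: "0 \<le> c" "0 \<le> e"
    using S.cmom_nonneg S.\<kappa>_pos S.cerr_nonneg by (simp_all add: c_def e_def)
  have "0 \<le> B"
    unfolding B_def using ce S.cloc_nonneg by (intro add_nonneg_nonneg mult_nonneg_nonneg) auto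
  have finite_error: "L2_norm M (\<lambda>\<omega>. X k r \<omega> - em_interp W \<tau> A f g n k (\<xi> k) r \<omega>) \<le> sqrt (\<tau> / real n * B)"
    if n: "n > 0" "\<tau> / real n \<le> \<delta>" and r: "r \<ge> 0" for n k r
  proof -
    define h where "h = \<tau> / real n"
    have h: "S.small_step h" "0 < h" using n tau by (auto simp: h_def intro: \<delta>(2))
    define N where "N = nat \<lfloor>r / h\<rfloor>"
    have N: "real N * h \<le> r" "r \<le> real N * h + h"
    proof -
      have "real N \<le> r / h" "r / h \<le> real N + 1"
        using r h(2) unfolding N_def by (simp_all add: of_nat_floor)
      then show "real N * h \<le> r" "r \<le> real N * h + h"
        using h(2) by (simp_all add: field_simps)
    qed
    let ?a = "- (real k * \<tau>)"
    \<comment> \<open>One period consists of \<open>n\<close> steps, so after \<open>k * n\<close>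
      steps from \<open>- k \<tau>\<close> the scheme is at time 0.\<close>
    have grid: "?a + real (k * n + N) * h = real N * h"
      using n by (simp add: h_def field_simps)
    \<comment> \<open>\<open>em_iterate\<close> evaluates the coefficients at \<open>i h\<close>,
      the error estimate at \<open>i h - k \<tau>\<close>; the two times differ by whole
      periods.\<close>
    have shift: "f (t - real k * \<tau>) y = f t y" "g (t - real k * \<tau>) y = g t y" for t y
      using periodic_shift_int[of "\<lambda>t. f t y" \<tau> t "- int k"] periodic_shift_int[of "\<lambda>t. g t y" \<tau> t "- int k"]
      by (simp_all add: f_periodic g_periodic)
    interpret T: sde_mono_sol M W A f g C\<^sub>0 L K \<alpha> \<beta>\<^sub>2 ?a "\<xi> k" "X k"
      by unfold_locales (rule X xi_L2)+
    have cle: "1 + S.msq (\<xi> k) + 4 * S.cmom / S.\<kappa> \<le> c"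
      using power_mono[OF xi_L2(2)[of k], of 2] by (simp add: c_def L2_norm_sq)
    have um: "f (real N * h) \<in> borel_measurable borel"
    proof (rule borel_measurable_continuous_onI)
      show "continuous_on UNIV (f (real N * h))"
        using continuous_on_compose2[OF continuous_on_Holder_Lipschitz[OF f_bound], of UNIV "\<lambda>x. (real N * h, x)"]
        by (simp add: continuous_on_Pair)
    qed
    have "S.msq (\<lambda>\<omega>. X k r \<omega> - (em_iterate W A f g h ?a (\<xi> k) (k * n + N) \<omega> +
        (r - (?a + real (k * n + N) * h)) *\<^sub>R f (real N * h) (em_iterate W A f g h ?a (\<xi> k) (k * n + N) \<omega>) +
        g (?a + real (k * n + N) * h) (em_iterate W A f g h ?a (\<xi> k) (k * n + N) \<omega>) *v
          (W r \<omega> - W (?a + real (k * n + N) * h) \<omega>))) \<le> h * B"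
      unfolding B_def
    proof (rule T.em_interp_error[OF h(1) _ _ _ um _ cle e_def])
      show "\<xi> k \<in> borel_measurable (S.F ?a)"
        by (rule measurable_from_subalg[OF S.subalgebra_incr_F xi_measurable])
      show "norm (f (real N * h) y) \<le> K + L * norm y" for y
        using f_growth[of "real N * h" y] L(2)[of y] by linarith
      show "?a + real (k * n + N) * h \<le> r" "r \<le> ?a + real (k * n + N) * h + h"
        unfolding grid by (rule N)+
    qed (simp_all add: S.b_def shift Let_def scaleR_add_right add.assoc)
    then have "S.msq (\<lambda>\<omega>. X k r \<omega> - em_interp W \<tau> A f g n k (\<xi> k) r \<omega>) \<le> h * B"
      unfolding grid by (simp add: em_interp_def Let_def h_def[symmetric] N_def[symmetric])
    then show ?thesis
      by (simp add: L2_norm_def h_def)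
  qed
  \<comment> \<open>The smallest eigenvalue is negative, hence non-zero; only so is the step bound
    \<open>1 / \<bar>lam CARD('m)\<bar>\<close> positive and not the default value 0 of a division
    by zero.\<close>
  have "lam CARD('m) \<le> lam 1"
    using A_eigenvalues(1) unfolding eigenvalue_list_def monotone_on_def by auto
  then have lam: "0 < 1 / \<bar>lam CARD('m)\<bar>" using A_eigenvalues(2) by simp
  show ?thesis
  proof (intro exI conjI allI impI)
    \<comment> \<open>The constant must be positive while \<open>B\<close> is only known to be
      nonnegative, hence the added 1.\<close>
    show "0 < sqrt B + 1" using \<open>0 \<le> B\<close> by (simp add: add_nonneg_pos)
    show "0 < min \<delta> (min \<delta>\<^sub>0 (1 / \<bar>lam CARD('m)\<bar>))" using \<delta>(1) delta0 lam by simp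
    fix n :: nat and r :: real
    assume n: "0 < n" "\<tau> / real n \<le> min \<delta> (min \<delta>\<^sub>0 (1 / \<bar>lam CARD('m)\<bar>))" and r: "0 \<le> r"
    let ?E = "\<lambda>k. em_interp W \<tau> A f g n k (\<xi> k) r"
    have Y: "L2_limit M (\<lambda>k. X k r) (Xstar r)" by (rule Xstar[OF r])
    have Z: "L2_limit M ?E (Xhatstar n r)" using n r by (intro Xhatstar) auto
    have le: "L2_norm M (\<lambda>\<omega>. Xstar r \<omega> - Xhatstar n r \<omega>) \<le>
        L2_norm M (\<lambda>\<omega>. X k r \<omega> - Xstar r \<omega>) + (sqrt (\<tau> / real n * B) + L2_norm M (\<lambda>\<omega>. ?E k \<omega> - Xhatstar n r \<omega>))" for k
    proof -
      have sq: "sq_integrable M (X k r)" "sq_integrable M (Xstar r)" "sq_integrable M (?E k)" "sq_integrable M (Xhatstar n r)"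
        using Y Z by (auto simp: L2_limit_def)
      have "L2_norm M (\<lambda>\<omega>. Xstar r \<omega> - Xhatstar n r \<omega>) =
          L2_norm M (\<lambda>\<omega>. (Xstar r \<omega> - X k r \<omega>) + ((X k r \<omega> - ?E k \<omega>) + (?E k \<omega> - Xhatstar n r \<omega>)))"
        by simp
      also have "\<dots> \<le> L2_norm M (\<lambda>\<omega>. Xstar r \<omega> - X k r \<omega>) +
          L2_norm M (\<lambda>\<omega>. (X k r \<omega> - ?E k \<omega>) + (?E k \<omega> - Xhatstar n r \<omega>))"
        by (intro L2_norm_triangle sq_integrable_diff sq_integrable_add sq)
      also have "L2_norm M (\<lambda>\<omega>. (X k r \<omega> - ?E k \<omega>) + (?E k \<omega> - Xhatstar n r \<omega>)) \<le>
          L2_norm M (\<lambda>\<omega>. X k r \<omega> - ?E k \<omega>) + L2_norm M (\<lambda>\<omega>. ?E k \<omega> - Xhatstar n r \<omega>)"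
        by (intro L2_norm_triangle sq_integrable_diff sq)
      also have "L2_norm M (\<lambda>\<omega>. X k r \<omega> - ?E k \<omega>) \<le> sqrt (\<tau> / real n * B)"
        using n r by (intro finite_error) auto
      finally show ?thesis
        by (simp add: L2_norm_minus_commute[of M "Xstar r" "X k r"])
    qed
    have "(\<lambda>k. L2_norm M (\<lambda>\<omega>. X k r \<omega> - Xstar r \<omega>) + (sqrt (\<tau> / real n * B) +
        L2_norm M (\<lambda>\<omega>. ?E k \<omega> - Xhatstar n r \<omega>))) \<longlonglongrightarrow> 0 + (sqrt (\<tau> / real n * B) + 0)"
      using Y Z unfolding L2_limit_def by (intro tendsto_add tendsto_const) auto
    then have "L2_norm M (\<lambda>\<omega>. Xstar r \<omega> - Xhatstar n r \<omega>) \<le> 0 + (sqrt (\<tau> / real n * B) + 0)"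
      using le by (intro LIMSEQ_le_const) auto
    also have "\<dots> = sqrt B * sqrt (\<tau> / real n)"
      by (simp add: real_sqrt_mult real_sqrt_divide)
    also have "\<dots> \<le> (sqrt B + 1) * sqrt (\<tau> / real n)"
      using tau by (intro mult_right_mono) auto
    finally show "L2_norm M (\<lambda>\<omega>. Xstar r \<omega> - Xhatstar n r \<omega>) \<le> (sqrt B + 1) * sqrt (\<tau> / real n)" .
  qed
qed

end
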